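(* Let $n\ge 1$ and let $h\in\mathbb{C}[x_1,\ldots,x_n]$ be a polynomial whose Hessian matrix $\mathcal{H}h=\left(\frac{\partial^2 h}{\partial x_i\partial x_j}\right)_{1\le i,j\le n}$ is singular, i.e. $\det\mathcal{H}h=0$. (i) If $2\le n\le 4$ and $h$ is homogeneous, then there exists a nonzero vector $c=(c_1,\ldots,c_n)\in\mathbb{C}^n$ such that $$c_1\frac{\partial h}{\partial x_1}+c_2\frac{\partial h}{\partial x_2}+\cdots+c_n\frac{\partial h}{\partial x_n}=0.$$ (ii) If $n\le 2$ (and $h$ is not necessarily homogeneous), then there exist a nonzero vector $c=(c_1,\ldots,c_n)\in\mathbb{C}^n$ and a constant $c_0\in\mathbb{C}$ such that $$c_1\frac{\partial h}{\partial x_1}+\cdots+c_n\frac{\partial h}{\partial x_n}=c_0,$$ and if moreover $h$ has no terms of degree one, this holds with $c_0=0$.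
   Context: A polynomial is homogeneous of degree $d$ if all its terms have degree $d$. *)

theory Defs
  imports "HOL-Library.Poly_Mapping" "Jordan_Normal_Form.Determinant"
begin

text \<open>A polynomial in the variables \<open>x\<^sub>0, x\<^sub>1, \<dots>\<close> is a finitely supported map from monomials
  (exponent vectors) to coefficients; the ring operations are those of \<^theory>\<open>HOL-Library.Poly_Mapping\<close>.
  Indices start at 0, as for matrices and vectors, so that \<open>\<complex>[x\<^sub>1, \<dots>, x\<^sub>n]\<close> becomes
  the subring of polynomials involving only \<open>x\<^sub>0, \<dots>, x\<^sub>n\<^sub>-\<^sub>1\<close>.\<close>

type_synonym 'a mpoly = "(nat \<Rightarrow>\<^sub>0 nat) \<Rightarrow>\<^sub>0 'a"

definition mpolys :: "nat \<Rightarrow> 'a::zero mpoly set" where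
  "mpolys n = {p. \<forall>m \<in> Poly_Mapping.keys p. Poly_Mapping.keys m \<subseteq> {..<n}}"

definition Const :: "'a::zero \<Rightarrow> 'a mpoly" where
  "Const a = Poly_Mapping.single 0 a"

definition monom_degree :: "(nat \<Rightarrow>\<^sub>0 nat) \<Rightarrow> nat" where
  "monom_degree m = (\<Sum>i \<in> Poly_Mapping.keys m. Poly_Mapping.lookup m i)"

text \<open>The zero polynomial is homogeneous of every degree.\<close>

definition homogeneous_of_degree :: "nat \<Rightarrow> 'a::zero mpoly \<Rightarrow> bool" where
  "homogeneous_of_degree d p \<longleftrightarrow> (\<forall>m \<in> Poly_Mapping.keys p. monom_degree m = d)"

definition homogeneous :: "'a::zero mpoly \<Rightarrow> bool" where
  "homogeneous p \<longleftrightarrow> (\<exists>d. homogeneous_of_degree d p)"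

text \<open>Formal partial derivative with respect to \<open>x\<^sub>i\<close>. The truncated subtraction is harmless:
  if \<open>x\<^sub>i\<close> does not occur in \<open>m\<close>, the coefficient is 0.\<close>

definition partial :: "nat \<Rightarrow> 'a::comm_semiring_1 mpoly \<Rightarrow> 'a mpoly" where
  "partial i p =
     (\<Sum>m \<in> Poly_Mapping.keys p. Poly_Mapping.single (m - Poly_Mapping.single i 1) (of_nat (Poly_Mapping.lookup m i) * Poly_Mapping.lookup p m))"

definition hessian :: "nat \<Rightarrow> 'a::comm_semiring_1 mpoly \<Rightarrow> 'a mpoly mat" where
  "hessian n h = mat n n (\<lambda>(i, j). partial i (partial j h))"

end

theory Submission
  imports Defs "HOL-Computational_Algebra.Field_as_Ring" "HOL-Computational_Algebra.Polynomial_Factorial"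
    "HOL-Computational_Algebra.Fundamental_Theorem_Algebra"
begin

text \<open>Suppose that the Hessian of \<open>h\<close> is singular. The \<open>n\<close> first partial derivatives of \<open>h\<close> are then
  algebraically dependent: otherwise every coordinate \<open>x\<^sub>i\<close> is algebraic over them, and differentiating
  a minimal equation for \<open>x\<^sub>i\<close> shows that the Hessian has no kernel (\<open>gradient_relation\<close>). Let \<open>R\<close> be a
  relation of least degree and put \<open>v = (\<nabla>R)(\<nabla>h)\<close>. This vector field is not zero, it lies in the kernel
  of the Hessian, and so the derivation along \<open>v\<close> annihilates \<open>\<nabla>h\<close> and with it \<open>v\<close> itself. Hence \<open>v\<close>
  is constant on each of its own lines, \<open>v(x + t v(x)) = v(x)\<close> (\<open>polar_field\<close>). The leading coefficient
  in \<open>t\<close> says that the top homogeneous component of every non-constant coordinate of \<open>v\<close> vanishes at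
  \<open>v(x)\<close> for all \<open>x\<close> (\<open>top_component_vanishes\<close>).

  In two variables this component is a binary form, a product of linear forms, so the two coordinates of
  \<open>v\<close> are proportional: \<open>v = g c\<close> with a constant vector \<open>c\<close>. Then \<open>c\<close> is in the kernel of the Hessian,
  which means that \<open>c \<bullet> \<nabla>h\<close> is constant (\<open>singular_hessian_two_variables\<close>).

  In four variables, with \<open>h\<close> homogeneous, \<open>v\<close> can be chosen homogeneous, and division by the common factor
  of its coordinates gives a homogeneous field \<open>u\<close> with coprime coordinates which is still constant on its
  own lines. If \<open>u\<close> has degree 0, it is the vector sought. Otherwise \<open>u(u(x)) = 0\<close>, so the image of \<open>u\<close>
  lies in the zero set of \<open>u\<close>, which has codimension at least two because the coordinates are coprime.
  Projectively the image is at most a curve. Take a general point \<open>a\<close>. The component through \<open>a\<close> of the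
  fibre of \<open>u\<close> is a surface \<open>f = 0\<close>, which is a cone with vertex \<open>u(a)\<close> and contains the whole curve;
  hence it contains all lines joining \<open>u(a)\<close> to the curve, and \<open>u\<close> is proportional to \<open>u(a)\<close> on them.
  Exchanging the two end points shows that \<open>u\<close> vanishes on all secants of the curve
  (\<open>secants_vanish\<close>). If three coordinates of \<open>u\<close> were linearly independent, the secants would
  be dense in a projective plane, which contradicts the codimension of the zero set
  (\<open>three_coordinates_dependent\<close>). So \<open>u = a p + b q\<close> with constant vectors \<open>p\<close>, \<open>q\<close>, and
  \<open>u \<bullet> \<nabla>h = 0\<close> together with its consequence \<open>(\<partial>\<^sub>k u) \<bullet> \<nabla>h = 0\<close> forces \<open>p \<bullet> \<nabla>h = 0\<close>
  (\<open>straight_kernel_field_imp_constant_kernel\<close>).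

  Fewer variables are reduced to these two cases by adding a power \<open>x\<^sub>i\<^sup>d\<close> for each missing variable
  (\<open>add_powers\<close>). The argument is carried out with polynomial functions, for which
  substitution is composition and identities may be checked at general points; the evaluation map transports the result back
  to formal polynomials because it is injective (\<open>eval_mpoly_inject\<close>).\<close>

section \<open>Polynomial functions\<close>

type_synonym point = "nat \<Rightarrow> complex"

text \<open>Polynomial functions in the first \<open>n\<close> coordinates of total degree at most \<open>k\<close>. Points have infinitely
  many coordinates, so that the number of variables can change within a proof.\<close>

inductive poly_fun_le :: "nat \<Rightarrow> nat \<Rightarrow> (point \<Rightarrow> complex) \<Rightarrow> bool" for n where
  const: "poly_fun_le n k (\<lambda>_. c)"
| add: "poly_fun_le n k f \<Longrightarrow> poly_fun_le n k g \<Longrightarrow> poly_fun_le n k (\<lambda>x. f x + g x)"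
| var: "i < n \<Longrightarrow> poly_fun_le n k f \<Longrightarrow> poly_fun_le n (Suc k) (\<lambda>x. x i * f x)"

definition poly_fun :: "nat \<Rightarrow> (point \<Rightarrow> complex) \<Rightarrow> bool" where
  "poly_fun n f \<longleftrightarrow> (\<exists>k. poly_fun_le n k f)"

lemma poly_fun_le_mono: "poly_fun_le n k f \<Longrightarrow> k \<le> l \<Longrightarrow> poly_fun_le n l f"
proof (induction arbitrary: l rule: poly_fun_le.induct)
  case (var i k f)
  then obtain l' where "l = Suc l'" "k \<le> l'" by (cases l) auto
  with var show ?case by (auto intro: poly_fun_le.var)
qed (auto intro: poly_fun_le.intros)

lemma poly_fun_le_mono_vars: "poly_fun_le n k f \<Longrightarrow> n \<le> m \<Longrightarrow> poly_fun_le m k f"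
  by (induction rule: poly_fun_le.induct) (auto intro: poly_fun_le.intros)

lemma poly_fun_le_cmult: "poly_fun_le n k f \<Longrightarrow> poly_fun_le n k (\<lambda>x. c * f x)"
proof (induction rule: poly_fun_le.induct)
  case (add k f g)
  then show ?case by (simp add: distrib_left poly_fun_le.add)
next
  case (var i k f)
  then show ?case using poly_fun_le.var[OF var(1,3)] by (simp add: mult.left_commute)
qed (auto intro: poly_fun_le.intros)

lemma poly_fun_le_mult:
  "poly_fun_le n k f \<Longrightarrow> poly_fun_le n l g \<Longrightarrow> poly_fun_le n (k + l) (\<lambda>x. f x * g x)"
proof (induction rule: poly_fun_le.induct)
  case (const k c)
  then show ?case by (auto intro!: poly_fun_le_cmult intro: poly_fun_le_mono)
next
  case (add k f g)
  then show ?case by (simp add: distrib_right poly_fun_le.add)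
next
  case (var i k f)
  then show ?case by (simp add: mult.assoc poly_fun_le.var)
qed

lemma poly_fun_le_imp_poly_fun [intro]: "poly_fun_le n k f \<Longrightarrow> poly_fun n f"
  by (auto simp: poly_fun_def)

lemma poly_fun_mono_vars: "poly_fun n f \<Longrightarrow> n \<le> m \<Longrightarrow> poly_fun m f"
  by (auto simp: poly_fun_def intro: poly_fun_le_mono_vars)

lemma poly_fun_const [simp]: "poly_fun n (\<lambda>_. c)"
  by (auto intro: poly_fun_le.intros)

lemma poly_fun_var [intro]: "i < n \<Longrightarrow> poly_fun n (\<lambda>x. x i)"
  using poly_fun_le.var[of i n 0 "\<lambda>_. 1"] by (auto intro: poly_fun_le.intros)

lemma poly_fun_add [intro]: "poly_fun n f \<Longrightarrow> poly_fun n g \<Longrightarrow> poly_fun n (\<lambda>x. f x + g x)"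
  unfolding poly_fun_def
  by (metis poly_fun_le.add poly_fun_le_mono max.cobounded1 max.cobounded2)

lemma poly_fun_mult [intro]: "poly_fun n f \<Longrightarrow> poly_fun n g \<Longrightarrow> poly_fun n (\<lambda>x. f x * g x)"
  unfolding poly_fun_def using poly_fun_le_mult by blast

lemma poly_fun_cmult [intro]: "poly_fun n f \<Longrightarrow> poly_fun n (\<lambda>x. c * f x)"
  by (rule poly_fun_mult) auto

lemma poly_fun_minus [intro]: "poly_fun n f \<Longrightarrow> poly_fun n (\<lambda>x. - f x)"
  using poly_fun_cmult[of n f "-1"] by simp

lemma poly_fun_diff [intro]: "poly_fun n f \<Longrightarrow> poly_fun n g \<Longrightarrow> poly_fun n (\<lambda>x. f x - g x)"
  using poly_fun_add[of n f "\<lambda>x. - g x"] by auto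

lemma poly_fun_sum [intro]:
  "(\<And>a. a \<in> A \<Longrightarrow> poly_fun n (f a)) \<Longrightarrow> poly_fun n (\<lambda>x. \<Sum>a\<in>A. f a x)"
  by (induction A rule: infinite_finite_induct) auto

lemma poly_fun_prod [intro]:
  "(\<And>a. a \<in> A \<Longrightarrow> poly_fun n (f a)) \<Longrightarrow> poly_fun n (\<lambda>x. \<Prod>a\<in>A. f a x)"
  by (induction A rule: infinite_finite_induct) auto

lemma poly_fun_power [intro]: "poly_fun n f \<Longrightarrow> poly_fun n (\<lambda>x. f x ^ k)"
  by (induction k) auto

lemma poly_fun_if: "poly_fun n f \<Longrightarrow> poly_fun n g \<Longrightarrow> poly_fun n (\<lambda>x. if b then f x else g x)"
  by (cases b) auto

lemma poly_fun_induct [consumes 1, case_names const add var]: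
  assumes "poly_fun n f"
    and "\<And>c. P (\<lambda>_. c)"
    and "\<And>f g. poly_fun n f \<Longrightarrow> poly_fun n g \<Longrightarrow> P f \<Longrightarrow> P g \<Longrightarrow> P (\<lambda>x. f x + g x)"
    and "\<And>i f. i < n \<Longrightarrow> poly_fun n f \<Longrightarrow> P f \<Longrightarrow> P (\<lambda>x. x i * f x)"
  shows "P f"
proof -
  obtain k where "poly_fun_le n k f" using assms(1) by (auto simp: poly_fun_def)
  then show ?thesis
    by (induction rule: poly_fun_le.induct) (use assms in blast)+
qed

lemma poly_fun_compose:
  assumes "poly_fun n f" "\<And>i. i < n \<Longrightarrow> poly_fun m (g i)"
  shows "poly_fun m (\<lambda>x. f (\<lambda>i. g i x))"
  using assms by (induction rule: poly_fun_induct) auto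

lemma poly_fun_cong_coords:
  assumes "poly_fun n f" "\<And>i. i < n \<Longrightarrow> x i = y i"
  shows "f x = f y"
  using assms by (induction rule: poly_fun_induct) auto

lemma poly_fun_restrict_curve:
  assumes "poly_fun n f" "\<And>i. i < n \<Longrightarrow> \<exists>p. \<forall>t. X t i = poly p t"
  shows "\<exists>p. \<forall>t::complex. f (X t) = poly p t"
  using assms(1)
proof (induction rule: poly_fun_induct)
  case (const c)
  show ?case by (rule exI[of _ "[:c:]"]) simp
next
  case (add f g)
  then obtain p q where "\<forall>t. f (X t) = poly p t" "\<forall>t. g (X t) = poly q t" by blast
  then show ?case by (intro exI[of _ "p + q"]) simp
next
  case (var i f)
  then obtain p q where "\<forall>t. f (X t) = poly p t" "\<forall>t. X t i = poly q t" using assms(2) by blast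
  then show ?case by (intro exI[of _ "q * p"]) simp
qed

lemma poly_fun_restrict_line:
  assumes "poly_fun n f"
  shows "\<exists>p. \<forall>t. f (\<lambda>i. x i + t * v i) = poly p t"
proof (rule poly_fun_restrict_curve[OF assms])
  show "\<exists>p. \<forall>t. x i + t * v i = poly p t" for i
    by (rule exI[of _ "[:x i, v i:]"]) (simp add: mult.commute)
qed

lemma poly_fun_restrict_ray:
  assumes "poly_fun n f"
  obtains p where "\<And>t. f (\<lambda>i. t * x i) = poly p t"
  using poly_fun_restrict_line[OF assms, of "\<lambda>_. 0" x] by auto

text \<open>The ring of polynomial functions is a domain: if \<open>f(a)\<close> and \<open>g(b)\<close> are not zero, then both functions
  restrict to non-zero polynomials in one variable on the line through \<open>a\<close> and \<open>b\<close>.\<close>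

lemma poly_fun_mult_eq_0:
  assumes f: "poly_fun n f" and g: "poly_fun n g" and fg: "\<And>x. f x * g x = 0"
  shows "(\<forall>x. f x = 0) \<or> (\<forall>x. g x = 0)"
proof (rule ccontr)
  assume "\<not> ?thesis"
  then obtain a b where ab: "f a \<noteq> 0" "g b \<noteq> 0" by blast
  define X where "X t = (\<lambda>i. a i + t * (b i - a i))" for t
  obtain p q where p: "\<forall>t. f (X t) = poly p t" and q: "\<forall>t. g (X t) = poly q t"
    using poly_fun_restrict_line[OF f] poly_fun_restrict_line[OF g] unfolding X_def by metis
  have "poly (p * q) t = 0" for t using p q fg by (metis poly_mult)
  then have "p * q = 0" by (metis poly_0 poly_eq_poly_eq_iff ext)
  moreover have "p \<noteq> 0" using p ab(1) by (metis (no_types, lifting) X_def poly_0 mult_zero_left add_0_right ext)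
  moreover have "X 1 = b" by (simp add: X_def)
  then have "q \<noteq> 0" using q ab(2) by (metis poly_0)
  ultimately show False by simp
qed

text \<open>An identity may be checked at general points, that is, where a given non-zero polynomial does not vanish.\<close>

lemma poly_fun_cancel:
  assumes "poly_fun n f" "poly_fun n g" "\<And>x. f x \<noteq> 0 \<Longrightarrow> g x = 0" "f a \<noteq> 0"
  shows "g x = 0"
  using poly_fun_mult_eq_0[OF assms(1,2)] assms(3,4) by fastforce

lemma poly_fun_prod_nonzero:
  assumes "finite A" "\<And>a. a \<in> A \<Longrightarrow> poly_fun n (f a)" "\<And>a. a \<in> A \<Longrightarrow> \<exists>x. f a x \<noteq> 0"
  shows "\<exists>x. \<forall>a\<in>A. f a x \<noteq> 0"
proof -
  have "\<exists>x. (\<Prod>a\<in>A. f a x) \<noteq> 0"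
    using assms
  proof (induction A rule: finite_induct)
    case (insert b A)
    then have "\<exists>x. (\<Prod>a\<in>A. f a x) \<noteq> 0" by auto
    moreover have "poly_fun n (\<lambda>x. \<Prod>a\<in>A. f a x)" using insert by auto
    ultimately show ?case
      using poly_fun_mult_eq_0[of n "f b" "\<lambda>x. \<Prod>a\<in>A. f a x"] insert by fastforce
  qed auto
  then show ?thesis using assms(1) by auto
qed

lemma poly_fun_common_nonzero:
  assumes "poly_fun n f" "poly_fun n g" "f a \<noteq> 0" "g b \<noteq> 0"
  shows "\<exists>x. f x \<noteq> 0 \<and> g x \<noteq> 0"
proof (rule ccontr)
  assume "\<not> ?thesis"
  then have "\<And>x. f x * g x = 0" by auto
  from poly_fun_mult_eq_0[OF assms(1,2) this] show False using assms(3,4) by blast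
qed

section \<open>Partial derivatives\<close>

text \<open>The derivative along a coordinate direction; \<open>THE\<close> is meaningful since the derivative of a polynomial
  function exists.\<close>

definition pd :: "nat \<Rightarrow> (point \<Rightarrow> complex) \<Rightarrow> point \<Rightarrow> complex" where
  "pd i f x = (THE D. ((\<lambda>t. f (x(i := t))) has_field_derivative D) (at (x i)))"

lemma poly_fun_has_field_derivative:
  assumes "poly_fun n f"
  shows "\<exists>D. ((\<lambda>t. f (x(i := t))) has_field_derivative D) (at a)"
  using assms
proof (induction rule: poly_fun_induct)
  case (add f g)
  then obtain D E where "((\<lambda>t. f (x(i := t))) has_field_derivative D) (at a)"
    "((\<lambda>t. g (x(i := t))) has_field_derivative E) (at a)" by blast
  then show ?case by (intro exI) (rule DERIV_add)
next
  case (var j f)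
  have "\<exists>D. ((\<lambda>t. (x(i := t)) j) has_field_derivative D) (at a)"
    by (cases "i = j") (auto intro: exI[of _ 1] exI[of _ 0])
  then obtain D E where "((\<lambda>t. f (x(i := t))) has_field_derivative D) (at a)"
    "((\<lambda>t. (x(i := t)) j) has_field_derivative E) (at a)" using var by blast
  then show ?case by (intro exI) (rule DERIV_mult)
qed (auto intro: exI[of _ 0])

lemma pd_eqI: "((\<lambda>t. f (x(i := t))) has_field_derivative D) (at (x i)) \<Longrightarrow> pd i f x = D"
  unfolding pd_def by (rule the_equality) (auto intro: DERIV_unique)

lemma has_field_derivative_pd:
  assumes "poly_fun n f"
  shows "((\<lambda>t. f (x(i := t))) has_field_derivative pd i f x) (at (x i))"
  using poly_fun_has_field_derivative[OF assms, of x i "x i"] pd_eqI[of f x i] by auto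

lemma pd_const [simp]: "pd i (\<lambda>_. c) = (\<lambda>_. 0)"
  by (auto intro!: pd_eqI)

lemma pd_add:
  assumes "poly_fun n f" "poly_fun n g"
  shows "pd i (\<lambda>x. f x + g x) = (\<lambda>x. pd i f x + pd i g x)"
  using assms by (auto intro!: pd_eqI DERIV_add has_field_derivative_pd)

lemma pd_mult:
  assumes "poly_fun n f" "poly_fun n g"
  shows "pd i (\<lambda>x. f x * g x) = (\<lambda>x. f x * pd i g x + pd i f x * g x)"
proof
  fix x
  show "pd i (\<lambda>x. f x * g x) x = f x * pd i g x + pd i f x * g x"
    using DERIV_mult[OF has_field_derivative_pd[OF assms(1), of x i] has_field_derivative_pd[OF assms(2), of x i]]
    by (intro pd_eqI) (simp add: mult.commute add.commute)
qed

lemma pd_coord: "pd i (\<lambda>x. x j) = (\<lambda>_. if i = j then 1 else 0)"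
  by (cases "i = j") (auto intro!: pd_eqI)

lemma pd_var:
  assumes "poly_fun n f" "j < n"
  shows "pd i (\<lambda>x. x j * f x) = (\<lambda>x. (if i = j then f x else 0) + x j * pd i f x)"
  using pd_mult[OF poly_fun_var[OF assms(2)] assms(1)] by (auto simp: pd_coord fun_eq_iff)

lemma pd_other_variable:
  assumes "poly_fun n f" "n \<le> i"
  shows "pd i f x = 0"
proof (rule pd_eqI)
  have "f (x(i := t)) = f x" for t
    by (rule poly_fun_cong_coords[OF assms(1)]) (use assms(2) in auto)
  then show "((\<lambda>t. f (x(i := t))) has_field_derivative 0) (at (x i))" by simp
qed

lemma poly_fun_le_0:
  "poly_fun_le n k f \<Longrightarrow> k = 0 \<Longrightarrow> \<exists>c. f = (\<lambda>_. c)"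
  by (induction rule: poly_fun_le.induct) auto

text \<open>For \<open>k = 0\<close> the truncated subtraction is harmless, because then \<open>f\<close> is constant.\<close>

lemma poly_fun_le_pd: "poly_fun_le n k f \<Longrightarrow> poly_fun_le n (k - 1) (pd i f)"
proof (induction rule: poly_fun_le.induct)
  case (add k f g)
  then have "poly_fun n f" "poly_fun n g" by auto
  then show ?case using add by (simp only: pd_add) (rule poly_fun_le.add)
next
  case (var j k f)
  have *: "poly_fun_le n k (\<lambda>x. x j * pd i f x)"
  proof (cases k)
    case 0
    then show ?thesis using poly_fun_le_0[OF var(2)] by (auto intro: poly_fun_le.const)
  next
    case (Suc k')
    then show ?thesis using var by (auto intro: poly_fun_le.var)
  qed
  have "poly_fun_le n k (\<lambda>x. if i = j then f x else 0)"
    using var by (cases "i = j") (auto intro: poly_fun_le.const)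
  then have "poly_fun_le n k (pd i (\<lambda>x. x j * f x))"
    using * var by (subst pd_var[of n]) (auto intro: poly_fun_le.add)
  then show ?case by simp
qed (auto intro: poly_fun_le.intros)

lemma poly_fun_pd [intro]: "poly_fun n f \<Longrightarrow> poly_fun n (pd i f)"
  unfolding poly_fun_def using poly_fun_le_pd by blast

lemma pd_cmult: "poly_fun n f \<Longrightarrow> pd i (\<lambda>x. c * f x) = (\<lambda>x. c * pd i f x)"
  using pd_mult[of n "\<lambda>_. c" f] by simp

lemma pd_sum:
  assumes "\<And>a. a \<in> A \<Longrightarrow> poly_fun n (f a)"
  shows "pd i (\<lambda>x. \<Sum>a\<in>A. f a x) = (\<lambda>x. \<Sum>a\<in>A. pd i (f a) x)"
  using assms
proof (induction A rule: infinite_finite_induct)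
  case (insert a A)
  then have "poly_fun n (f a)" "poly_fun n (\<lambda>x. \<Sum>a\<in>A. f a x)" by auto
  from pd_add[OF this] insert show ?case by simp
qed auto

lemma pd_commute: "poly_fun n f \<Longrightarrow> pd i (pd j f) = pd j (pd i f)"
proof (induction rule: poly_fun_induct)
  case (add f g)
  then show ?case by (simp add: pd_add[of n] poly_fun_pd)
next
  case (var l f)
  have e: "pd i' (\<lambda>x. (if j' = l then f x else 0) + x l * pd j' f x) =
     (\<lambda>x. (if j' = l then pd i' f x else 0) + ((if i' = l then pd j' f x else 0) + x l * pd i' (pd j' f) x))" for i' j'
  proof -
    have "pd i' (\<lambda>x. if j' = l then f x else 0) = (\<lambda>x. if j' = l then pd i' f x else 0)"
      by (cases "j' = l") auto
    then show ?thesis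
      using var by (subst pd_add[of n]) (cases "j' = l"; auto simp: pd_var[of n] poly_fun_pd poly_fun_mult poly_fun_var)+
  qed
  show ?case using var by (simp add: pd_var[of n] e) (auto simp: fun_eq_iff)
qed auto

lemma poly_fun_chain_rule:
  assumes "poly_fun n f"
    and "\<And>i. i < n \<Longrightarrow> ((\<lambda>t. X t i) has_field_derivative X' i) (at a)"
  shows "((\<lambda>t. f (X t)) has_field_derivative (\<Sum>i<n. X' i * pd i f (X a))) (at a)"
  using assms(1)
proof (induction rule: poly_fun_induct)
  case (add f g)
  then show ?case by (auto simp: pd_add[of n] distrib_left sum.distrib intro: DERIV_add)
next
  case (var j f)
  have "X' i * pd i (\<lambda>x. x j * f x) (X a) =
      (if i = j then X' i * f (X a) else 0) + X a j * (X' i * pd i f (X a))" for i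
    using var by (subst pd_var[of n]) (auto simp: distrib_left)
  then have "(\<Sum>i<n. X' i * pd i (\<lambda>x. x j * f x) (X a)) =
      (\<Sum>i<n. if i = j then X' i * f (X a) else 0) + X a j * (\<Sum>i<n. X' i * pd i f (X a))"
    by (simp only: sum.distrib sum_distrib_left)
  also have "(\<Sum>i<n. (if i = j then X' i * f (X a) else 0)) = X' j * f (X a)"
    using var(1) by simp
  finally show ?case
    using DERIV_mult[OF assms(2)[OF var(1)] var(3)] by (simp add: mult.commute)
qed auto

lemma poly_fun_line_poly:
  assumes "poly_fun n f"
  obtains p where "\<And>t. f (\<lambda>i. x i + t * v i) = poly p t"
    "\<And>t. (\<Sum>i<n. v i * pd i f (\<lambda>i. x i + t * v i)) = poly (pderiv p) t"
proof -
  obtain p where p: "\<And>t. f (\<lambda>i. x i + t * v i) = poly p t"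
    using poly_fun_restrict_line[OF assms] by blast
  have "((\<lambda>t. f (\<lambda>i. x i + t * v i)) has_field_derivative (\<Sum>i<n. v i * pd i f (\<lambda>i. x i + t * v i))) (at t)" for t
    by (rule poly_fun_chain_rule[OF assms]) (auto intro!: derivative_eq_intros)
  then have "(\<Sum>i<n. v i * pd i f (\<lambda>i. x i + t * v i)) = poly (pderiv p) t" for t
    unfolding p using poly_DERIV[of p t] DERIV_unique by blast
  then show ?thesis using p that by blast
qed

lemma pd_compose:
  assumes f: "poly_fun n f" and g: "\<And>i. i < n \<Longrightarrow> poly_fun m (g i)"
  shows "pd k (\<lambda>x. f (\<lambda>i. g i x)) x = (\<Sum>i<n. pd k (g i) x * pd i f (\<lambda>i. g i x))"
proof -
  have "((\<lambda>t. f (\<lambda>i. g i (x(k := t)))) has_field_derivative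
      (\<Sum>i<n. pd k (g i) x * pd i f (\<lambda>i. g i (x(k := x k))))) (at (x k))"
  proof (rule poly_fun_chain_rule[OF f])
    fix i assume "i < n"
    then show "((\<lambda>t. g i (x(k := t))) has_field_derivative pd k (g i) x) (at (x k))"
      using has_field_derivative_pd[OF g] by blast
  qed
  then show ?thesis by (intro pd_eqI) simp
qed

lemma poly_fun_pd_zero_imp_const:
  assumes f: "poly_fun n f" and 0: "\<And>i x. i < n \<Longrightarrow> pd i f x = 0"
  shows "f x = f y"
proof -
  have "((\<lambda>t. f (\<lambda>i. x i + t * (y i - x i))) has_field_derivative (\<Sum>i<n. (y i - x i) * pd i f (\<lambda>i. x i + t * (y i - x i)))) (at t)" for t
    by (rule poly_fun_chain_rule[OF f]) (auto intro!: derivative_eq_intros)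
  then have "((\<lambda>t. f (\<lambda>i. x i + t * (y i - x i))) has_field_derivative 0) (at t)" for t
    by (simp add: 0)
  moreover obtain p where p: "\<And>t. f (\<lambda>i. x i + t * (y i - x i)) = poly p t"
    using poly_fun_restrict_line[OF f, of x "\<lambda>i. y i - x i"] by blast
  ultimately have "(poly p has_field_derivative 0) (at t)" for t
    by simp
  then have "poly (pderiv p) t = 0" for t
    using poly_DERIV[of p t] DERIV_unique by blast
  then have "pderiv p = 0" by (metis poly_0 poly_eq_poly_eq_iff ext)
  then have "degree p = 0" by (simp add: pderiv_eq_0_iff)
  then obtain c where "p = [:c:]" by (rule degree_eq_zeroE)
  then show ?thesis using p[of 0] p[of 1] by simp
qed

section \<open>Homogeneous components\<close>

lemma poly_eqI_nonzero:
  fixes p q :: "complex poly"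
  assumes "\<And>t. t \<noteq> 0 \<Longrightarrow> poly p t = poly q t"
  shows "p = q"
proof -
  have "poly ([:0, 1:] * (p - q)) t = 0" for t
    using assms by (cases "t = 0") auto
  then have "[:0, 1:] * (p - q) = 0" by (metis poly_0 poly_eq_poly_eq_iff ext)
  then show ?thesis by simp
qed

lemma complex_poly_ext: "(\<And>t. poly p t = poly q t) \<Longrightarrow> p = q" for p q :: "complex poly"
  by (rule poly_eqI_nonzero)

lemma complex_nth_root: "m > 0 \<Longrightarrow> \<exists>t :: complex. t ^ m = s"
proof -
  assume m: "m > 0"
  have "poly (monom 1 m - [:s:]) 0 \<noteq> poly (monom 1 m - [:s:]) 1"
    using m by (cases m) (simp_all add: poly_monom)
  then have "\<not> constant (poly (monom 1 m - [:s:]))" unfolding constant_def by blast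
  then obtain t where "poly (monom 1 m - [:s:]) t = 0" using fundamental_theorem_of_algebra by blast
  then show ?thesis by (auto simp: poly_monom)
qed

lemma coeffs_zero_if_sum_zero:
  fixes c :: "nat \<Rightarrow> complex"
  assumes "\<And>t. (\<Sum>j\<le>k. c j * t ^ j) = 0" "j \<le> k"
  shows "c j = 0"
  using polyfun_eq_0[of c k] assms by auto

definition homog_fun :: "nat \<Rightarrow> (point \<Rightarrow> complex) \<Rightarrow> bool" where
  "homog_fun e f \<longleftrightarrow> (\<forall>t x. f (\<lambda>i. t * x i) = t ^ e * f x)"

lemma homog_funD: "homog_fun e f \<Longrightarrow> f (\<lambda>i. t * x i) = t ^ e * f x"
  by (simp add: homog_fun_def)

text \<open>It suffices to scale by \<open>t \<noteq> 0\<close>: both sides are polynomial in \<open>t\<close>.\<close>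

lemma homog_funI:
  assumes f: "poly_fun n f" and h: "\<And>t x. t \<noteq> 0 \<Longrightarrow> f (\<lambda>i. t * x i) = t ^ e * f x"
  shows "homog_fun e f"
  unfolding homog_fun_def
proof (intro allI)
  fix t x
  obtain p where p: "\<And>t. f (\<lambda>i. t * x i) = poly p t"
    using poly_fun_restrict_line[OF f, of "\<lambda>_. 0" x] by auto
  have "p = monom (f x) e"
    by (rule poly_eqI_nonzero) (simp add: p[symmetric] h poly_monom)
  then show "f (\<lambda>i. t * x i) = t ^ e * f x" by (simp add: p poly_monom)
qed

lemma poly_fun_le_components:
  assumes "poly_fun_le n k f"
  shows "\<exists>F. (\<forall>j. poly_fun_le n j (F j) \<and> homog_fun j (F j)) \<and> (\<forall>x. f x = (\<Sum>j\<le>k. F j x))"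
  using assms
proof (induction rule: poly_fun_le.induct)
  case (const k c)
  show ?case
    by (rule exI[of _ "\<lambda>j _. if j = 0 then c else 0"])
      (auto simp: homog_fun_def intro: poly_fun_le.const)
next
  case (add k f g)
  then obtain F G where
    F: "\<forall>j. poly_fun_le n j (F j) \<and> homog_fun j (F j)" "\<forall>x. f x = (\<Sum>j\<le>k. F j x)" and
    G: "\<forall>j. poly_fun_le n j (G j) \<and> homog_fun j (G j)" "\<forall>x. g x = (\<Sum>j\<le>k. G j x)"
    by blast
  then show ?case
    by (intro exI[of _ "\<lambda>j x. F j x + G j x"])
      (auto simp: homog_fun_def distrib_left sum.distrib intro: poly_fun_le.add)
next
  case (var i k f)
  then obtain F where
    F: "\<forall>j. poly_fun_le n j (F j) \<and> homog_fun j (F j)" "\<forall>x. f x = (\<Sum>j\<le>k. F j x)"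
    by blast
  define G where "G j = (case j of 0 \<Rightarrow> (\<lambda>_. 0) | Suc j \<Rightarrow> (\<lambda>x. x i * F j x))" for j
  have "poly_fun_le n j (G j) \<and> homog_fun j (G j)" for j
    using F(1) var(1) by (cases j) (auto simp: G_def homog_fun_def intro: poly_fun_le.intros)
  moreover have "x i * f x = (\<Sum>j\<le>Suc k. G j x)" for x
    unfolding sum.atMost_Suc_shift using F(2) by (simp add: G_def sum_distrib_left)
  ultimately show ?case by blast
qed

lemma poly_fun_components:
  assumes "poly_fun n f"
  obtains F k where "\<And>j. poly_fun n (F j)" "\<And>j. homog_fun j (F j)" "\<And>x. f x = (\<Sum>j\<le>k. F j x)"
proof -
  obtain k where "poly_fun_le n k f" using assms by (auto simp: poly_fun_def)
  then obtain F where F: "\<And>j. poly_fun_le n j (F j) \<and> homog_fun j (F j)" "\<And>x. f x = (\<Sum>j\<le>k. F j x)"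
    using poly_fun_le_components by blast
  then show ?thesis by (intro that[of F k]) auto
qed

text \<open>The values of the components at \<open>x\<close> are the coefficients of a polynomial in the scaling factor.\<close>

lemma homog_component_zero:
  assumes "\<And>j. homog_fun j (F j)" "\<And>t. (\<Sum>j\<le>k. F j (\<lambda>i. t * x i)) = 0" "j \<le> k"
  shows "F j x = 0"
  by (rule coeffs_zero_if_sum_zero[of "\<lambda>j. F j x" k])
    (use assms(2,3) homog_funD[OF assms(1)] in \<open>simp_all add: mult.commute\<close>)

text \<open>For \<open>e = 0\<close> the function is constant and its derivative 0 is homogeneous of every degree.\<close>

lemma homog_fun_pd:
  assumes f: "poly_fun n f" and h: "homog_fun e f"
  shows "homog_fun (e - 1) (pd i f)"
proof (cases "i < n")
  case i: True
  have "t * pd i f (\<lambda>j. t * x j) = t ^ e * pd i f x" for t x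
  proof -
    have "pd i (\<lambda>x. f (\<lambda>j. t * x j)) x = (\<Sum>l<n. pd i (\<lambda>x. t * x l) x * pd l f (\<lambda>j. t * x j))"
      by (rule pd_compose[OF f]) auto
    also have "\<dots> = (\<Sum>l<n. if l = i then t * pd l f (\<lambda>j. t * x j) else 0)"
      by (intro sum.cong) (auto simp: pd_cmult[OF poly_fun_var] pd_coord)
    also have "\<dots> = t * pd i f (\<lambda>j. t * x j)" using i by simp
    finally show ?thesis using h by (simp add: homog_fun_def pd_cmult[OF f])
  qed
  note * = this
  show ?thesis
  proof (cases e)
    case 0
    have "f x = f (\<lambda>_. 0)" for x
      using h[unfolded homog_fun_def 0, rule_format, of 0 x] by simp
    then have "f = (\<lambda>_. f (\<lambda>_. 0))" by (intro ext)
    then have "pd i f = (\<lambda>_. 0)" by (metis pd_const)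
    then show ?thesis by (simp add: homog_fun_def)
  next
    case (Suc e')
    have "pd i f (\<lambda>j. t * x j) = t ^ e' * pd i f x" if "t \<noteq> 0" for t x
      using *[of t x] that by (simp add: Suc)
    then show ?thesis
      unfolding Suc by (intro homog_funI[OF poly_fun_pd[OF f]]) simp
  qed
next
  case False
  then show ?thesis using pd_other_variable[OF f, of i] by (simp add: homog_fun_def)
qed

lemma homog_fun_euler:
  assumes f: "poly_fun n f" and h: "homog_fun e f"
  shows "(\<Sum>i<n. x i * pd i f x) = of_nat e * f x"
proof -
  obtain p where p: "\<And>t. f (\<lambda>i. 0 + t * x i) = poly p t"
    "\<And>t. (\<Sum>i<n. x i * pd i f (\<lambda>i. 0 + t * x i)) = poly (pderiv p) t"
    using poly_fun_line_poly[OF f, of "\<lambda>_. 0" x] by blast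
  have "p = monom (f x) e"
    by (rule complex_poly_ext) (use p(1) homog_funD[OF h] in \<open>simp add: poly_monom mult.commute\<close>)
  then show ?thesis using p(2)[of 1] by (simp add: pderiv_monom poly_monom)
qed

text \<open>Uniqueness for a homogeneous linear system of differential equations, read off at the initial point: if all
  \<open>d i\<close> are divisible by \<open>X\<^sup>m\<close>, then so are their derivatives, because \<open>c\<close> is prime to \<open>X\<close>, and with the initial
  value 0 this makes all \<open>d i\<close> divisible by \<open>X\<^sup>m\<^sup>+\<^sup>1\<close>.\<close>

lemma poly_ode_zero:
  fixes d :: "nat \<Rightarrow> complex poly"
  assumes d0: "\<And>i. i < n \<Longrightarrow> poly (d i) 0 = 0" and c: "poly c 0 \<noteq> 0"
    and ode: "\<And>i. i < n \<Longrightarrow> c * pderiv (d i) = (\<Sum>j<n. A i j * d j)"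
    and i: "i < n"
  shows "d i = 0"
proof -
  have "\<forall>i<n. \<forall>j<m. coeff (d i) j = 0" for m
  proof (induction m)
    case (Suc m)
    show ?case
    proof (intro allI impI)
      fix i j assume i: "i < n" and j: "j < Suc m"
      have dv: "monom 1 m dvd d l" if "l < n" for l
        using Suc that by (simp add: monom_1_dvd_iff')
      have "monom 1 m dvd c * pderiv (d i)"
        unfolding ode[OF i] by (intro dvd_sum dvd_mult dv) auto
      moreover have "coprime (monom 1 m) c"
      proof -
        have "\<not> [:0, 1:] dvd c"
          using c poly_eq_0_iff_dvd[of c 0] by simp
        moreover have "prime_elem [:0, 1 :: complex:]"
          using prime_elem_linear_field_poly[of 1 0] by simp
        ultimately have "coprime [:0, 1:] c" by (simp add: prime_elem_imp_coprime)
        then show ?thesis by (simp add: monom_altdef coprime_power_left_iff)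
      qed
      ultimately have "monom 1 m dvd pderiv (d i)"
        using coprime_dvd_mult_right_iff by blast
      then have *: "coeff (pderiv (d i)) l = 0" if "l < m" for l
        using that by (simp add: monom_1_dvd_iff')
      show "coeff (d i) j = 0"
      proof (cases j)
        case 0
        then show ?thesis using d0[OF i] by (simp add: poly_0_coeff_0)
      next
        case (Suc l)
        then have "of_nat (Suc l) * coeff (d i) (Suc l) = (0 :: complex)"
          using *[of l] j by (simp add: coeff_pderiv del: of_nat_Suc)
        then show ?thesis using Suc by (simp del: of_nat_Suc)
      qed
    qed
  qed auto
  then show ?thesis using i by (intro poly_eqI) (auto simp: less_Suc_eq)
qed

section \<open>Algebraic dependence of n+1 polynomials in n variables\<close>

text \<open>By induction on the number of equations: the last one eliminates one unknown.\<close>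

lemma underdetermined_system:
  fixes c :: "'a \<Rightarrow> nat \<Rightarrow> complex"
  assumes "finite S" "N < card S"
  shows "\<exists>a. (\<exists>s\<in>S. a s \<noteq> 0) \<and> (\<forall>j<N. (\<Sum>s\<in>S. a s * c s j) = 0)"
  using assms
proof (induction N arbitrary: S c)
  case 0
  then obtain s where "s \<in> S" by (metis card.empty ex_in_conv less_numeral_extra(3))
  then show ?case by (intro exI[of _ "\<lambda>_. 1"]) auto
next
  case (Suc N)
  show ?case
  proof (cases "\<forall>s\<in>S. c s N = 0")
    case True
    obtain a where "\<exists>s\<in>S. a s \<noteq> 0" "\<forall>j<N. (\<Sum>s\<in>S. a s * c s j) = 0"
      using Suc.IH[of S c] Suc.prems by auto
    then show ?thesis using True by (intro exI[of _ a]) (auto simp: less_Suc_eq)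
  next
    case False
    then obtain s0 where s0: "s0 \<in> S" "c s0 N \<noteq> 0" by blast
    define T where "T = S - {s0}"
    have T: "finite T" "N < card T" "s0 \<notin> T" "S = insert s0 T" using Suc.prems s0 by (auto simp: T_def)
    obtain a where a: "\<exists>s\<in>T. a s \<noteq> 0"
      "\<forall>j<N. (\<Sum>s\<in>T. a s * (c s j - c s N / c s0 N * c s0 j)) = 0"
      using Suc.IH[OF T(1,2), of "\<lambda>s j. c s j - c s N / c s0 N * c s0 j"] by blast
    define b where "b = - (\<Sum>s\<in>T. a s * c s N) / c s0 N"
    have split: "(\<Sum>s\<in>S. (a(s0 := b)) s * c s j) = b * c s0 j + (\<Sum>s\<in>T. a s * c s j)" for j
    proof -
      have "(\<Sum>s\<in>T. (a(s0 := b)) s * c s j) = (\<Sum>s\<in>T. a s * c s j)"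
        using T(3) by (intro sum.cong) auto
      then show ?thesis using T by simp
    qed
    have "(\<Sum>s\<in>S. (a(s0 := b)) s * c s j) = 0" if "j < Suc N" for j
    proof (cases "j = N")
      case True
      then show ?thesis unfolding split using s0(2) by (simp add: b_def)
    next
      case False
      then have "0 = (\<Sum>s\<in>T. a s * (c s j - c s N / c s0 N * c s0 j))" using a(2) that by simp
      also have "\<dots> = (\<Sum>s\<in>T. a s * c s j) - (\<Sum>s\<in>T. a s * c s N) / c s0 N * c s0 j"
        by (simp add: right_diff_distrib sum_subtractf sum_divide_distrib sum_distrib_right mult.assoc)
      finally show ?thesis unfolding split by (simp add: b_def)
    qed
    moreover have "\<exists>s\<in>S. (a(s0 := b)) s \<noteq> 0" using a(1) T by auto
    ultimately show ?thesis by blast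
  qed
qed

lemma poly_fun_le_last_variable:
  assumes "poly_fun_le (Suc n) k f"
  shows "\<exists>F. (\<forall>j. poly_fun_le n k (F j)) \<and> (\<forall>x. f x = (\<Sum>j\<le>k. F j x * x n ^ j))"
  using assms
proof (induction rule: poly_fun_le.induct)
  case (const k c)
  show ?case
    by (rule exI[of _ "\<lambda>j _. if j = 0 then c else 0"])
      (auto simp: if_distrib[of "\<lambda>z. z * _"] intro: poly_fun_le.const cong: if_cong)
next
  case (add k f g)
  then obtain F G where
    F: "\<forall>j. poly_fun_le n k (F j)" "\<forall>x. f x = (\<Sum>j\<le>k. F j x * x n ^ j)" and
    G: "\<forall>j. poly_fun_le n k (G j)" "\<forall>x. g x = (\<Sum>j\<le>k. G j x * x n ^ j)"
    by blast
  then show ?case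
    by (intro exI[of _ "\<lambda>j x. F j x + G j x"])
      (auto simp: distrib_right sum.distrib intro: poly_fun_le.add)
next
  case (var i k f)
  then obtain F where F: "\<forall>j. poly_fun_le n k (F j)" "\<forall>x. f x = (\<Sum>j\<le>k. F j x * x n ^ j)"
    by blast
  show ?case
  proof (cases "i = n")
    case True
    define G where "G j = (case j of 0 \<Rightarrow> (\<lambda>_. 0) | Suc j \<Rightarrow> F j)" for j
    have "poly_fun_le n (Suc k) (G j)" for j
      using F(1) by (cases j) (auto simp: G_def intro: poly_fun_le.const poly_fun_le_mono)
    moreover have "x i * f x = (\<Sum>j\<le>Suc k. G j x * x n ^ j)" for x
      unfolding sum.atMost_Suc_shift using F(2) True by (simp add: G_def sum_distrib_left mult_ac)
    ultimately show ?thesis by blast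
  next
    case False
    then have i: "i < n" using var by simp
    define G where "G j = (if j \<le> k then (\<lambda>x. x i * F j x) else (\<lambda>_. 0))" for j
    have "poly_fun_le n (Suc k) (G j)" for j
      using F(1) i by (auto simp: G_def intro: poly_fun_le.intros)
    moreover have "x i * f x = (\<Sum>j\<le>Suc k. G j x * x n ^ j)" for x
      using F(2) by (simp add: G_def sum_distrib_left mult_ac)
    ultimately show ?thesis by blast
  qed
qed

lemma sum_div_mod:
  fixes g :: "nat \<Rightarrow> nat \<Rightarrow> complex"
  assumes "B > 0"
  shows "(\<Sum>m<A * B. g (m div B) (m mod B)) = (\<Sum>i<A. \<Sum>j<B. g i j)"
proof -
  have "(\<Sum>m<A * B. g (m div B) (m mod B)) = (\<Sum>i<A. \<Sum>m\<in>{i * B..<i * B + B}. g (m div B) (m mod B))"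
    by (rule sum.nat_group[symmetric])
  also have "\<dots> = (\<Sum>i<A. \<Sum>j<B. g i j)"
  proof (rule sum.cong[OF refl])
    fix i
    show "(\<Sum>m\<in>{i * B..<i * B + B}. g (m div B) (m mod B)) = (\<Sum>j<B. g i j)"
      using sum.atLeastLessThan_shift_bounds[of "\<lambda>m. g (m div B) (m mod B)" 0 "i * B" B] assms
      by (simp add: add.commute atLeast0LessThan)
  qed
  finally show ?thesis .
qed

text \<open>The bound on the dimension is crude: it is the number of monomials with all exponents at most \<open>k\<close>.\<close>

lemma poly_fun_le_finite_span:
  "\<exists>b. \<forall>f. poly_fun_le n k f \<longrightarrow> (\<exists>c. \<forall>x. f x = (\<Sum>m<(k + 1) ^ n. c m * b m x))"
proof (induction n)
  case 0
  have "\<exists>c. \<forall>x. f x = (\<Sum>m<(k + 1) ^ 0. c m * 1)" if "poly_fun_le 0 k f" for f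
  proof (rule exI[of _ "\<lambda>_. f (\<lambda>_. 0)"], rule allI)
    fix x
    have "f x = f (\<lambda>_. 0)" by (rule poly_fun_cong_coords[OF that[THEN poly_fun_le_imp_poly_fun]]) auto
    then show "f x = (\<Sum>m<(k + 1) ^ 0. f (\<lambda>_. 0) * 1)" by simp
  qed
  then show ?case by (intro exI[of _ "\<lambda>_ _. 1"]) blast
next
  case (Suc n)
  then obtain b where b: "\<And>f. poly_fun_le n k f \<Longrightarrow> \<exists>c. \<forall>x. f x = (\<Sum>m<(k + 1) ^ n. c m * b m x)" by blast
  show ?case
  proof (rule exI[of _ "\<lambda>m x. b (m div (k + 1)) x * x n ^ (m mod (k + 1))"], intro allI impI)
    fix f assume "poly_fun_le (Suc n) k f"
    then obtain F where F: "\<And>j. poly_fun_le n k (F j)" "\<And>x. f x = (\<Sum>j\<le>k. F j x * x n ^ j)"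
      using poly_fun_le_last_variable by blast
    obtain c where c: "\<And>j x. F j x = (\<Sum>m<(k + 1) ^ n. c j m * b m x)" using b[OF F(1)] by metis
    have "f x = (\<Sum>m<(k + 1) ^ Suc n. c (m mod (k + 1)) (m div (k + 1)) *
        (b (m div (k + 1)) x * x n ^ (m mod (k + 1))))" for x
    proof -
      have "f x = (\<Sum>j<k + 1. \<Sum>m<(k + 1) ^ n. c j m * (b m x * x n ^ j))"
        by (simp add: F(2) c sum_distrib_right mult.assoc lessThan_Suc_atMost)
      also have "\<dots> = (\<Sum>m<(k + 1) ^ n. \<Sum>j<k + 1. c j m * (b m x * x n ^ j))"
        by (rule sum.swap)
      also have "\<dots> = (\<Sum>m<(k + 1) ^ n * (k + 1). c (m mod (k + 1)) (m div (k + 1)) *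
        (b (m div (k + 1)) x * x n ^ (m mod (k + 1))))"
        by (rule sum_div_mod[symmetric]) simp
      finally show ?thesis by (simp add: mult.commute)
    qed
    then show "\<exists>c. \<forall>x. f x = (\<Sum>m<(k + 1) ^ Suc n. c m * (b (m div (k + 1)) x * x n ^ (m mod (k + 1))))"
      by (intro exI[of _ "\<lambda>m. c (m mod (k + 1)) (m div (k + 1))"]) blast
  qed
qed

lemma sum_digits: "(\<Sum>i<m. (s div B ^ i mod B) * B ^ i) = s mod B ^ m" for s B :: nat
proof (induction m)
  case (Suc m)
  have "(\<Sum>i<Suc m. (s div B ^ i mod B) * B ^ i) = s mod B ^ m + (s div B ^ m mod B) * B ^ m"
    unfolding sum.lessThan_Suc Suc ..
  also have "\<dots> = s mod (B ^ m * B)"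
    unfolding mod_mult2_eq by (simp only: mult.commute add.commute)
  finally show ?case by (simp only: power_Suc2)
qed simp

lemma poly_fun_le_power: "poly_fun_le n k f \<Longrightarrow> poly_fun_le n (e * k) (\<lambda>x. f x ^ e)"
proof (induction e)
  case (Suc e)
  then show ?case using poly_fun_le_mult[of n k f "e * k" "\<lambda>x. f x ^ e"] by simp
qed (auto intro: poly_fun_le.const)

lemma poly_fun_le_prod:
  assumes "finite A" "\<And>a. a \<in> A \<Longrightarrow> poly_fun_le n k (f a)"
  shows "poly_fun_le n (card A * k) (\<lambda>x. \<Prod>a\<in>A. f a x)"
  using assms
proof (induction A rule: finite_induct)
  case (insert b A)
  then show ?case using poly_fun_le_mult[of n k "f b" "card A * k" "\<lambda>x. \<Prod>a\<in>A. f a x"] by simp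
qed (auto intro: poly_fun_le.const)

text \<open>Dimension count. There are \<open>B\<^sup>n\<^sup>+\<^sup>1\<close> monomials in \<open>n + 1\<close> quantities with exponents below \<open>B\<close>. The corresponding
  products of the \<open>g i\<close> lie in a space of dimension \<open>O(B\<^sup>n)\<close>, so for large \<open>B\<close> they are linearly dependent.
  The monomials are numbered by the digits of \<open>s < B\<^sup>n\<^sup>+\<^sup>1\<close>, so that the substitution
  \<open>y\<^sub>i = t^(B^i)\<close> turns the monomial number \<open>s\<close> into \<open>t\<^sup>s\<close>; this shows that the relation is not trivial.\<close>

lemma algebraic_dependence:
  assumes "\<And>i. i \<le> n \<Longrightarrow> poly_fun n (g i)"
  shows "\<exists>R. poly_fun (Suc n) R \<and> (\<exists>y. R y \<noteq> 0) \<and> (\<forall>x. R (\<lambda>i. g i x) = 0)"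
proof -
  obtain d where d: "\<And>i. i \<le> n \<Longrightarrow> poly_fun_le n (d i) (g i)"
    using assms unfolding poly_fun_def by metis
  define D where "D = (\<Sum>i\<le>n. d i)"
  have D: "poly_fun_le n D (g i)" if "i \<le> n" for i
    using d[OF that] by (rule poly_fun_le_mono) (use that in \<open>auto simp: D_def intro: member_le_sum\<close>)
  \<comment> \<open>The products have degree at most \<open>K\<close>, and \<open>K + 1 \<le> E B\<close>; so \<open>B > E\<^sup>n\<close> suffices.\<close>
  define E where "E = Suc n * D + 1"
  define B where "B = E ^ n + 1"
  define dig where "dig s i = s div B ^ i mod B" for s i :: nat
  define mon where "mon s y = (\<Prod>i\<le>n. y i ^ dig s i)" for s and y :: point
  define K where "K = Suc n * (B * D)"
  have "B > 0" by (simp add: B_def)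
  have monle: "poly_fun_le n K (\<lambda>x. mon s (\<lambda>i. g i x))" for s
  proof -
    have "poly_fun_le n (B * D) (\<lambda>x. g i x ^ dig s i)" if "i \<le> n" for i
    proof (rule poly_fun_le_mono[OF poly_fun_le_power[OF D[OF that]]])
      have "dig s i \<le> B" using \<open>B > 0\<close> by (simp add: dig_def less_imp_le)
      then show "dig s i * D \<le> B * D" by simp
    qed
    then show ?thesis
      unfolding mon_def K_def using poly_fun_le_prod[of "{..n}" n "B * D" "\<lambda>i x. g i x ^ dig s i"] by simp
  qed
  obtain b where b: "\<And>f. poly_fun_le n K f \<Longrightarrow> \<exists>c. \<forall>x. f x = (\<Sum>m<(K + 1) ^ n. c m * b m x)"
    using poly_fun_le_finite_span by blast
  obtain c where c: "\<And>s x. mon s (\<lambda>i. g i x) = (\<Sum>m<(K + 1) ^ n. c s m * b m x)"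
    using b[OF monle] by metis
  have "(K + 1) ^ n \<le> (E * B) ^ n"
    by (rule power_mono) (use \<open>B > 0\<close> in \<open>simp_all add: K_def E_def algebra_simps\<close>)
  also have "\<dots> = E ^ n * B ^ n" by (rule power_mult_distrib)
  also have "\<dots> < B * B ^ n" using \<open>B > 0\<close> by (simp add: B_def)
  finally have "(K + 1) ^ n < B ^ Suc n" by simp
  then obtain a where a: "\<exists>s<B ^ Suc n. a s \<noteq> 0"
    "\<And>m. m < (K + 1) ^ n \<Longrightarrow> (\<Sum>s<B ^ Suc n. a s * c s m) = 0"
    using underdetermined_system[of "{..<B ^ Suc n}" "(K + 1) ^ n" c] by auto
  define R where "R y = (\<Sum>s<B ^ Suc n. a s * mon s y)" for y
  have "poly_fun (Suc n) (mon s)" for s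
    unfolding mon_def by (intro poly_fun_prod poly_fun_power poly_fun_var) auto
  then have "poly_fun (Suc n) R" unfolding R_def by (intro poly_fun_sum poly_fun_cmult)
  moreover have "R (\<lambda>i. g i x) = 0" for x
  proof -
    have "R (\<lambda>i. g i x) = (\<Sum>s<B ^ Suc n. \<Sum>m<(K + 1) ^ n. a s * c s m * b m x)"
      by (simp add: R_def c sum_distrib_left mult.assoc)
    also have "\<dots> = (\<Sum>m<(K + 1) ^ n. \<Sum>s<B ^ Suc n. a s * c s m * b m x)"
      by (rule sum.swap)
    also have "\<dots> = (\<Sum>m<(K + 1) ^ n. (\<Sum>s<B ^ Suc n. a s * c s m) * b m x)"
      by (simp only: sum_distrib_right)
    finally show ?thesis using a(2) by simp
  qed
  moreover have "\<exists>y. R y \<noteq> 0"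
  proof (rule ccontr)
    assume "\<not> ?thesis"
    then have 0: "R y = 0" for y by blast
    define L where "L = B ^ Suc n - 1"
    have "B ^ Suc n = Suc L" using \<open>B > 0\<close> by (simp add: L_def)
    then have L: "{..<B ^ Suc n} = {..L}" by (simp only: lessThan_Suc_atMost)
    \<comment> \<open>Kronecker substitution\<close>
    have "mon s (\<lambda>i. t ^ B ^ i) = t ^ s" if "s < B ^ Suc n" for s t
    proof -
      have "mon s (\<lambda>i. t ^ B ^ i) = t ^ (\<Sum>i<Suc n. dig s i * B ^ i)"
        by (simp add: mon_def power_mult[symmetric] power_sum lessThan_Suc_atMost mult.commute)
      also have "(\<Sum>i<Suc n. dig s i * B ^ i) = s mod B ^ Suc n"
        unfolding dig_def by (rule sum_digits)
      finally show ?thesis using that by simp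
    qed
    then have "(\<Sum>s\<le>L. a s * t ^ s) = 0" for t
      using 0[of "\<lambda>i. t ^ B ^ i"] unfolding R_def L[symmetric] by simp
    then have "a s = 0" if "s \<le> L" for s using coeffs_zero_if_sum_zero that by blast
    then show False using a(1) L by blast
  qed
  ultimately show ?thesis by blast
qed

section \<open>The gradient relation and its polar field\<close>

lemma poly_fun_drop_last:
  assumes R: "poly_fun (Suc n) R" and 0: "\<And>y. pd n R y = 0"
  shows "poly_fun n (\<lambda>y. R (y(n := 0)))" "R (y(n := 0)) = R y"
proof -
  show "poly_fun n (\<lambda>y. R (y(n := 0)))"
  proof -
    have "poly_fun n (\<lambda>y. R (\<lambda>i. if i = n then 0 else y i))"
    proof (rule poly_fun_compose[OF R])
      show "poly_fun n (\<lambda>y. if i = n then 0 else y i)" if "i < Suc n" for i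
        using that by (cases "i = n") auto
    qed
    then show ?thesis by (simp add: fun_upd_def)
  qed
  define S where "S z = R (\<lambda>i. (y(n := z 0)) i)" for z :: point
  have c: "poly_fun 1 (\<lambda>z. (y(n := z 0)) i)" for i by (cases "i = n") auto
  have S: "poly_fun 1 S" unfolding S_def by (rule poly_fun_compose[OF R c])
  have "pd 0 S z = 0" for z
  proof -
    have "pd 0 S z = (\<Sum>i<Suc n. pd 0 (\<lambda>z. (y(n := z 0)) i) z * pd i R (\<lambda>i. (y(n := z 0)) i))"
      unfolding S_def by (rule pd_compose[OF R c])
    also have "\<dots> = 0" using 0 by (auto intro!: sum.neutral simp: less_Suc_eq)
    finally show ?thesis .
  qed
  then have "S (\<lambda>_. 0) = S (\<lambda>_. y n)" by (intro poly_fun_pd_zero_imp_const[OF S]) auto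
  then show "R (y(n := 0)) = R y" by (simp add: S_def fun_upd_def)
qed

lemma minimal_vanishing_poly_fun:
  assumes "poly_fun n R" "R y \<noteq> 0" "P R"
  obtains k S where "poly_fun_le n k S" "\<exists>y. S y \<noteq> 0" "P S"
    "\<And>T l. poly_fun_le n l T \<Longrightarrow> l < k \<Longrightarrow> P T \<Longrightarrow> \<forall>y. T y = 0"
proof -
  let ?Q = "\<lambda>k. \<exists>S. poly_fun_le n k S \<and> (\<exists>y. S y \<noteq> 0) \<and> P S"
  have "\<exists>k. ?Q k" using assms by (auto simp: poly_fun_def)
  then have "?Q (LEAST k. ?Q k)" by (rule LeastI_ex)
  then obtain S where "poly_fun_le n (LEAST k. ?Q k) S" "\<exists>y. S y \<noteq> 0" "P S" by blast
  then show ?thesis using not_less_Least[of _ ?Q] that by blast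
qed

text \<open>Suppose that the partial derivatives \<open>h\<^sub>j\<close> of \<open>h\<close> satisfy no relation. Each \<open>x\<^sub>i\<close> is algebraic over them:
  \<open>R\<^sub>i(h\<^sub>1, \<dots>, h\<^sub>n, x\<^sub>i) = 0\<close>, and for \<open>R\<^sub>i\<close> of least degree the derivative of \<open>R\<^sub>i\<close> in the last argument is not zero
  along this substitution. Differentiating in the direction of a kernel vector \<open>w\<close> of the Hessian leaves
  \<open>w\<^sub>i\<close> times that derivative, so \<open>w = 0\<close> at a general point.\<close>

lemma gradient_relation:
  assumes h: "poly_fun n h"
    and sing: "\<And>x. \<exists>w. (\<exists>i<n. w i \<noteq> 0) \<and> (\<forall>j<n. (\<Sum>k<n. w k * pd k (pd j h) x) = 0)"
  shows "\<exists>R. poly_fun n R \<and> (\<exists>y. R y \<noteq> 0) \<and> (\<forall>x. R (\<lambda>j. pd j h x) = 0)"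
proof (rule ccontr)
  assume no: "\<not> ?thesis"
  \<comment> \<open>For each \<open>i\<close>, these are the \<open>n\<close> partial derivatives followed by the coordinate \<open>x\<^sub>i\<close>.\<close>
  define g where "g i j = (if j < n then pd j h else (\<lambda>x. x i))" for i j
  have g: "poly_fun n (g i j)" if "i < n" for i j using that h by (auto simp: g_def)
  have "\<exists>R. poly_fun (Suc n) R \<and> (\<forall>x. R (\<lambda>j. g i j x) = 0) \<and> (\<exists>x. pd n R (\<lambda>j. g i j x) \<noteq> 0)"
    if i: "i < n" for i
  proof -
    obtain R0 y0 where R0: "poly_fun (Suc n) R0" "R0 y0 \<noteq> 0" "\<forall>x. R0 (\<lambda>j. g i j x) = 0"
      using algebraic_dependence[of n "g i"] g[OF i] by blast
    obtain k R where R: "poly_fun_le (Suc n) k R" "\<exists>y. R y \<noteq> 0" "\<forall>x. R (\<lambda>j. g i j x) = 0"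
      and min: "\<And>T l. poly_fun_le (Suc n) l T \<Longrightarrow> l < k \<Longrightarrow> \<forall>x. T (\<lambda>j. g i j x) = 0 \<Longrightarrow> \<forall>y. T y = 0"
      using minimal_vanishing_poly_fun[where P = "\<lambda>R. \<forall>x. R (\<lambda>j. g i j x) = 0", OF R0] by blast
    have R': "poly_fun (Suc n) R" using R(1) by auto
    have "k > 0" using poly_fun_le_0[OF R(1)] R(2,3) by (cases k) auto
    have "\<exists>x. pd n R (\<lambda>j. g i j x) \<noteq> 0"
    proof (rule ccontr)
      assume "\<not> ?thesis"
      then have "\<And>y. pd n R y = 0" using min[OF poly_fun_le_pd[OF R(1), of n]] \<open>k > 0\<close> by simp
      note drop = poly_fun_drop_last[OF R' this]
      have "R ((\<lambda>j. pd j h x)(n := 0)) = R (\<lambda>j. g i j x)" for x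
        unfolding drop(2)[of "\<lambda>j. g i j x", symmetric]
        by (rule poly_fun_cong_coords[OF R']) (auto simp: g_def)
      then have "R ((\<lambda>j. pd j h x)(n := 0)) = 0" for x using R(3) by simp
      moreover have "\<exists>y. R (y(n := 0)) \<noteq> 0" using R(2) unfolding drop(2) .
      ultimately have "\<exists>S. poly_fun n S \<and> (\<exists>y. S y \<noteq> 0) \<and> (\<forall>x. S (\<lambda>j. pd j h x) = 0)"
        by (intro exI[of _ "\<lambda>y. R (y(n := 0))"] conjI drop(1) allI)
      then show False using no by blast
    qed
    then show ?thesis using R' R(3) by blast
  qed
  then obtain R where R: "\<And>i. i < n \<Longrightarrow> poly_fun (Suc n) (R i)"
    "\<And>i x. i < n \<Longrightarrow> R i (\<lambda>j. g i j x) = 0" "\<And>i. i < n \<Longrightarrow> \<exists>x. pd n (R i) (\<lambda>j. g i j x) \<noteq> 0"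
    by metis
  have "\<exists>x. \<forall>i\<in>{..<n}. pd n (R i) (\<lambda>j. g i j x) \<noteq> 0"
    by (rule poly_fun_prod_nonzero[of "{..<n}" n]) (auto intro!: poly_fun_compose[OF poly_fun_pd] R(1,3) g)
  then obtain x where x: "\<And>i. i < n \<Longrightarrow> pd n (R i) (\<lambda>j. g i j x) \<noteq> 0" by blast
  obtain w where w: "\<exists>i<n. w i \<noteq> 0" "\<forall>j<n. (\<Sum>k<n. w k * pd k (pd j h) x) = 0" using sing by blast
  have "w i = 0" if i: "i < n" for i
  proof -
    let ?d = "\<lambda>j. pd j (R i) (\<lambda>j. g i j x)"
    have e: "(\<Sum>j<n. pd k (pd j h) x * ?d j) + (if k = i then ?d n else 0) = 0" for k
    proof -
      have "0 = pd k (\<lambda>x. R i (\<lambda>j. g i j x)) x" using R(2)[OF i] by simp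
      also have "\<dots> = (\<Sum>j<Suc n. pd k (g i j) x * ?d j)"
        by (rule pd_compose[OF R(1)[OF i] g[OF i]])
      also have "\<dots> = (\<Sum>j<n. pd k (pd j h) x * ?d j) + (if k = i then ?d n else 0)"
        by (simp add: g_def pd_coord)
      finally show ?thesis by simp
    qed
    have "0 = (\<Sum>k<n. w k * ((\<Sum>j<n. pd k (pd j h) x * ?d j) + (if k = i then ?d n else 0)))"
      by (simp add: e)
    also have "\<dots> = (\<Sum>k<n. \<Sum>j<n. w k * pd k (pd j h) x * ?d j) + (\<Sum>k<n. if k = i then w k * ?d n else 0)"
      by (simp add: distrib_left sum.distrib sum_distrib_left mult.assoc if_distrib[of "\<lambda>z. _ * z"] cong: if_cong)
    also have "(\<Sum>k<n. \<Sum>j<n. w k * pd k (pd j h) x * ?d j) = (\<Sum>j<n. (\<Sum>k<n. w k * pd k (pd j h) x) * ?d j)"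
      unfolding sum_distrib_right by (rule sum.swap)
    also have "\<dots> = 0" using w(2) by simp
    finally show ?thesis using i x[OF i] by simp
  qed
  then show False using w(1) by blast
qed

lemma minimal_gradient_relation:
  assumes "poly_fun n h"
    and "\<And>x. \<exists>w. (\<exists>i<n. w i \<noteq> 0) \<and> (\<forall>j<n. (\<Sum>k<n. w k * pd k (pd j h) x) = 0)"
  obtains k R where "poly_fun_le n k R" "\<exists>y. R y \<noteq> 0" "\<And>x. R (\<lambda>j. pd j h x) = 0"
    "\<forall>T l. poly_fun_le n l T \<longrightarrow> l < k \<longrightarrow> (\<forall>x. T (\<lambda>j. pd j h x) = 0) \<longrightarrow> (\<forall>y. T y = 0)"
proof -
  obtain R0 y0 where R0: "poly_fun n R0" "R0 y0 \<noteq> 0" "\<forall>x. R0 (\<lambda>j. pd j h x) = 0"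
    using gradient_relation[OF assms] by blast
  obtain k R where R: "poly_fun_le n k R" "\<exists>y. R y \<noteq> 0" "\<forall>x. R (\<lambda>j. pd j h x) = 0"
    "\<And>T l. poly_fun_le n l T \<Longrightarrow> l < k \<Longrightarrow> \<forall>x. T (\<lambda>j. pd j h x) = 0 \<Longrightarrow> \<forall>y. T y = 0"
    using minimal_vanishing_poly_fun[where P = "\<lambda>R. \<forall>x. R (\<lambda>j. pd j h x) = 0", OF R0] by blast
  show ?thesis by (rule that[of k R]) (use R in blast)+
qed

text \<open>A vector field that is annihilated by the derivation along itself is constant on the lines it spans. The
  difference \<open>d(t) = v(x + t v(x)) - v(x)\<close> satisfies \<open>d' = - J d\<close> with the Jacobian matrix \<open>J\<close> of \<open>v\<close> at the moving point,
  and \<open>d(0) = 0\<close>.\<close>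

lemma straight_flow:
  assumes v: "\<And>i. i < n \<Longrightarrow> poly_fun n (v i)"
    and D: "\<And>i x. i < n \<Longrightarrow> (\<Sum>l<n. v l x * pd l (v i) x) = 0"
    and i: "i < n"
  shows "v i (\<lambda>j. x j + t * v j x) = v i x"
proof -
  have "\<forall>i. \<exists>p. i < n \<longrightarrow> (\<forall>t. v i (\<lambda>j. x j + t * v j x) = poly p t) \<and>
     (\<forall>t. (\<Sum>l<n. v l x * pd l (v i) (\<lambda>j. x j + t * v j x)) = poly (pderiv p) t)"
    using poly_fun_line_poly[OF v, where x = x and v = "\<lambda>j. v j x"] by blast
  from choice[OF this] obtain p where p: "\<And>i t. i < n \<Longrightarrow> v i (\<lambda>j. x j + t * v j x) = poly (p i) t"
    "\<And>i t. i < n \<Longrightarrow> (\<Sum>l<n. v l x * pd l (v i) (\<lambda>j. x j + t * v j x)) = poly (pderiv (p i)) t"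
    by blast
  have "\<forall>i. \<forall>l. \<exists>q. i < n \<longrightarrow> (\<forall>t. pd l (v i) (\<lambda>j. x j + t * v j x) = poly q t)"
    using poly_fun_restrict_line[OF poly_fun_pd[OF v], where x = x and v = "\<lambda>j. v j x"] by blast
  then have "\<forall>i. \<exists>q. \<forall>l. i < n \<longrightarrow> (\<forall>t. pd l (v i) (\<lambda>j. x j + t * v j x) = poly (q l) t)"
    by (intro allI choice) simp
  from choice[OF this] obtain q where q: "\<And>i l t. i < n \<Longrightarrow> pd l (v i) (\<lambda>j. x j + t * v j x) = poly (q i l) t"
    by blast
  define d where "d i = p i - [:v i x:]" for i
  have "d i = 0"
  proof (rule poly_ode_zero[where n = n and c = 1 and A = "\<lambda>i l. - q i l"])
    fix i assume i: "i < n"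
    show "poly (d i) 0 = 0" using p(1)[OF i, of 0] by (simp add: d_def)
    show "1 * pderiv (d i) = (\<Sum>l<n. - q i l * d l)"
    proof (rule complex_poly_ext)
      fix t
      let ?y = "\<lambda>j. x j + t * v j x"
      have "poly (\<Sum>l<n. - q i l * d l) t = (\<Sum>l<n. v l x * pd l (v i) ?y) - (\<Sum>l<n. v l ?y * pd l (v i) ?y)"
        unfolding poly_sum sum_subtractf[symmetric]
        by (rule sum.cong) (auto simp: d_def p(1) q[OF i] algebra_simps)
      also have "\<dots> = poly (1 * pderiv (d i)) t"
        using D[OF i, of ?y] p(2)[OF i, of t] by (simp add: d_def pderiv_diff pderiv_pCons)
      finally show "poly (1 * pderiv (d i)) t = poly (\<Sum>l<n. - q i l * d l) t" ..
    qed
  qed (use i in auto)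
  then have "p i = [:v i x:]" by (simp add: d_def)
  then show ?thesis using p(1)[OF i] by simp
qed

lemma factor_constant_on_line:
  assumes f: "poly_fun n f" and g: "poly_fun n g"
    and c: "\<And>t. f (\<lambda>i. x i + t * v i) * g (\<lambda>i. x i + t * v i) = f x * g x" and nz: "f x * g x \<noteq> 0"
  shows "f (\<lambda>i. x i + t * v i) = f x"
proof -
  obtain p q where p: "\<And>t. f (\<lambda>i. x i + t * v i) = poly p t" and q: "\<And>t. g (\<lambda>i. x i + t * v i) = poly q t"
    using poly_fun_restrict_line[OF f] poly_fun_restrict_line[OF g] by metis
  have "p * q = [:f x * g x:]"
    by (rule complex_poly_ext) (use c in \<open>simp add: p q\<close>)
  then have "p dvd [:f x * g x:]" by (metis dvd_triv_left)
  then have "degree p = 0" using nz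
    by (metis degree_pCons_0 dvd_imp_degree_le le_zero_eq pCons_eq_0_iff)
  then obtain c where "p = [:c:]" by (rule degree_eq_zeroE)
  then show ?thesis using p[of t] p[of 0] by simp
qed

text \<open>The field \<open>v = (\<nabla>R)(\<nabla>h)\<close> is not zero because the partial derivatives of \<open>R\<close> have smaller degree than the
  minimal relation \<open>R\<close>. Differentiating \<open>R(\<nabla>h) = 0\<close> gives the kernel property, by which the derivation along
  \<open>v\<close> annihilates every polynomial in \<open>\<nabla>h\<close>, in particular \<open>v\<close>.\<close>

lemma polar_field:
  assumes h: "poly_fun n h" and R: "poly_fun_le n k R" "\<exists>y. R y \<noteq> 0" "\<And>x. R (\<lambda>j. pd j h x) = 0"
    and min: "\<forall>T l. poly_fun_le n l T \<longrightarrow> l < k \<longrightarrow> (\<forall>x. T (\<lambda>j. pd j h x) = 0) \<longrightarrow> (\<forall>y. T y = 0)"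
  defines "v \<equiv> \<lambda>i x. pd i R (\<lambda>j. pd j h x)"
  shows "\<And>i. poly_fun n (v i)" "\<exists>i<n. \<exists>x. v i x \<noteq> 0"
    "\<And>l x. (\<Sum>j<n. v j x * pd j (pd l h) x) = 0"
    "\<And>i t x. i < n \<Longrightarrow> v i (\<lambda>j. x j + t * v j x) = v i x"
proof -
  have R': "poly_fun n R" using R(1) by auto
  show v: "poly_fun n (v i)" for i
    unfolding v_def by (rule poly_fun_compose) (use R' h in auto)
  show "\<exists>i<n. \<exists>x. v i x \<noteq> 0"
  proof (rule ccontr)
    assume *: "\<not> ?thesis"
    have "k > 0" using poly_fun_le_0[OF R(1)] R(2,3) by (cases k) auto
    have "pd i R y = 0" if "i < n" for i y
      using min[THEN spec, THEN spec, THEN mp, OF poly_fun_le_pd[OF R(1), of i]] \<open>k > 0\<close> * that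
      by (auto simp: v_def)
    then show False using R(2,3) poly_fun_pd_zero_imp_const[OF R'] by metis
  qed
  show ker: "(\<Sum>j<n. v j x * pd j (pd l h) x) = 0" for l x
  proof -
    have "0 = pd l (\<lambda>x. R (\<lambda>j. pd j h x)) x" using R(3) by simp
    also have "\<dots> = (\<Sum>j<n. pd l (pd j h) x * v j x)"
      unfolding v_def by (rule pd_compose[OF R']) (use h in auto)
    finally show ?thesis by (simp add: pd_commute[OF h, of _ l] mult.commute)
  qed
  have "(\<Sum>l<n. v l x * pd l (v i) x) = 0" for i x
  proof -
    have "(\<Sum>l<n. v l x * pd l (v i) x) = (\<Sum>l<n. v l x * (\<Sum>j<n. pd l (pd j h) x * pd j (pd i R) (\<lambda>j. pd j h x)))"
      unfolding v_def by (subst pd_compose[OF poly_fun_pd[OF R']]) (use h in auto)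
    also have "\<dots> = (\<Sum>j<n. (\<Sum>l<n. v l x * pd l (pd j h) x) * pd j (pd i R) (\<lambda>j. pd j h x))"
      unfolding sum_distrib_left sum_distrib_right mult.assoc by (rule sum.swap)
    also have "\<dots> = 0" by (simp add: ker)
    finally show ?thesis .
  qed
  then show "v i (\<lambda>j. x j + t * v j x) = v i x" if "i < n" for i t x
    using straight_flow[of n v] v that by blast
qed

section \<open>Singular Hessians in two variables\<close>

text \<open>If \<open>f = \<Sum> F\<^sub>j\<close> is constant on the line \<open>x + t v\<close>, then the coefficient \<open>F\<^sub>e(v)\<close> of \<open>t\<^sup>e\<close> vanishes. The proof
  substitutes \<open>t = 1/s\<close>, multiplies by \<open>s\<^sup>e\<close> and puts \<open>s = 0\<close>.\<close>

lemma top_component_vanishes: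
  assumes F: "\<And>j. poly_fun n (F j)" "\<And>j. homog_fun j (F j)" and e: "e > 0"
    and flow: "\<And>t. (\<Sum>j\<le>e. F j (\<lambda>i. x i + t * v i)) = (\<Sum>j\<le>e. F j x)"
  shows "F e v = 0"
proof -
  have "\<exists>q. \<forall>s. F j (\<lambda>i. v i + s * x i) = poly q s" for j
    using poly_fun_restrict_line[OF F(1)] by blast
  then obtain q where q: "\<And>j s. F j (\<lambda>i. v i + s * x i) = poly (q j) s" by metis
  have "(\<Sum>j\<le>e. monom 1 (e - j) * q j) = monom (\<Sum>j\<le>e. F j x) e"
  proof (rule poly_eqI_nonzero)
    fix s :: complex assume s: "s \<noteq> 0"
    have "s ^ (e - j) * poly (q j) s = s ^ e * F j (\<lambda>i. x i + 1 / s * v i)" if "j \<le> e" for j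
    proof -
      have "poly (q j) s = F j (\<lambda>i. s * (x i + 1 / s * v i))"
        unfolding q[symmetric] using s by (simp add: distrib_left add.commute)
      also have "\<dots> = s ^ j * F j (\<lambda>i. x i + 1 / s * v i)" by (rule homog_funD[OF F(2)])
      finally show ?thesis using that by (simp add: mult.assoc[symmetric] power_add[symmetric])
    qed
    then have "poly (\<Sum>j\<le>e. monom 1 (e - j) * q j) s = s ^ e * (\<Sum>j\<le>e. F j (\<lambda>i. x i + 1 / s * v i))"
      by (simp add: poly_sum poly_monom sum_distrib_left)
    then show "poly (\<Sum>j\<le>e. monom 1 (e - j) * q j) s = poly (monom (\<Sum>j\<le>e. F j x) e) s"
      using flow[of "1 / s"] by (simp add: poly_monom mult.commute)
  qed
  then have "poly (\<Sum>j\<le>e. monom 1 (e - j) * q j) 0 = 0" using e by (simp add: poly_monom)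
  moreover have "poly (\<Sum>j\<le>e. monom 1 (e - j) * q j) 0 = (\<Sum>j\<le>e. if j = e then poly (q j) 0 else 0)"
    unfolding poly_sum by (rule sum.cong) (auto simp: poly_monom)
  ultimately have "poly (q e) 0 = 0" by simp
  then show ?thesis using q[of e 0] by simp
qed

text \<open>A binary form is a product of linear forms. Instead of factoring, dehomogenize: where \<open>b\<close> does not vanish,
  \<open>a/b\<close> is one of the finitely many roots of \<open>r(t, 1)\<close>, so the product of all \<open>(a - \<gamma> b) b\<close> is zero.\<close>

lemma binary_relation:
  assumes r: "poly_fun 2 r" "homog_fun k r" "r z \<noteq> 0" and a: "poly_fun n a" and b: "poly_fun n b"
    and rel: "\<And>x. r (\<lambda>i. if i = 0 then a x else b x) = 0"
  shows "\<exists>\<alpha> \<beta>. (\<alpha> \<noteq> 0 \<or> \<beta> \<noteq> 0) \<and> (\<forall>x. \<alpha> * a x + \<beta> * b x = 0)"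
proof (cases "\<forall>x. b x = 0")
  case True
  then show ?thesis by (intro exI[of _ 0] exI[of _ 1]) simp
next
  case False
  then obtain y where y: "b y \<noteq> 0" by blast
  have "\<exists>p. \<forall>t. r (\<lambda>i. if i = 0 then t else 1) = poly p t"
  proof (rule poly_fun_restrict_curve[OF r(1)])
    show "\<exists>p. \<forall>t::complex. (if i = 0 then t else 1) = poly p t" for i :: nat
    proof (cases "i = 0")
      case True
      then show ?thesis by (intro exI[of _ "[:0, 1:]"]) simp
    next
      case False
      then show ?thesis by (intro exI[of _ "[:1:]"]) simp
    qed
  qed
  then obtain p where p: "\<And>t. r (\<lambda>i. if i = 0 then t else 1) = poly p t" by blast
  have scale: "r (\<lambda>i. if i = 0 then s else t) = t ^ k * poly p (s / t)" if "t \<noteq> 0" for s t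
  proof -
    have "(\<lambda>i. if i = 0 then s else t) = (\<lambda>i. t * (if i = (0 :: nat) then s / t else 1))"
      using that by auto
    then show ?thesis using homog_funD[OF r(2), of t "\<lambda>i. if i = 0 then s / t else 1"] p by simp
  qed
  have "p \<noteq> 0"
  proof
    assume p0: "p = 0"
    have "r x = 0" for x
    proof (rule poly_fun_cancel[of 2 "\<lambda>x. x 1" r "\<lambda>_. 1"])
      fix x :: point assume "x 1 \<noteq> 0"
      moreover have "r x = r (\<lambda>i. if i = 0 then x 0 else x 1)"
        by (rule poly_fun_cong_coords[OF r(1)]) (auto simp: less_2_cases_iff)
      ultimately show "r x = 0" using scale p0 by simp
    qed (use r in auto)
    then show False using r(3) by blast
  qed
  then have fin: "finite {\<gamma>. poly p \<gamma> = 0}" by (rule poly_roots_finite)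
  have root: "poly p (a x / b x) = 0" if "b x \<noteq> 0" for x
    using scale[OF that, of "a x"] rel[of x] that by simp
  have "\<exists>\<gamma>. \<forall>x. a x - \<gamma> * b x = 0"
  proof (rule ccontr)
    assume *: "\<not> ?thesis"
    let ?f = "\<lambda>\<gamma> x. (a x - \<gamma> * b x) * b x"
    have ab: "poly_fun n (\<lambda>x. a x - \<gamma> * b x)" for \<gamma>
      by (intro poly_fun_diff poly_fun_cmult a b)
    have "\<exists>x. ?f \<gamma> x \<noteq> 0" for \<gamma>
    proof (rule ccontr)
      assume "\<not> ?thesis"
      then have "\<And>x. ?f \<gamma> x = 0" by blast
      from poly_fun_mult_eq_0[OF ab b this] show False using * y by blast
    qed
    then have "\<exists>x. \<forall>\<gamma>\<in>insert 0 {\<gamma>. poly p \<gamma> = 0}. ?f \<gamma> x \<noteq> 0"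
      using fin by (intro poly_fun_prod_nonzero[of _ n] poly_fun_mult[OF ab b]) simp_all
    then obtain x where x: "\<And>\<gamma>. poly p \<gamma> = 0 \<Longrightarrow> ?f \<gamma> x \<noteq> 0" "?f 0 x \<noteq> 0" by blast
    then have "b x \<noteq> 0" by auto
    then show False using x(1)[OF root[of x]] by simp
  qed
  then obtain \<gamma> where "\<forall>x. a x - \<gamma> * b x = 0" by blast
  then show ?thesis by (intro exI[of _ 1] exI[of _ "-\<gamma>"]) simp
qed

lemma constant_kernel_imp_constant_derivative:
  assumes h: "poly_fun n h" and c: "\<And>l x. l < n \<Longrightarrow> (\<Sum>j<n. c j * pd j (pd l h) x) = 0"
  shows "\<exists>c0. \<forall>x. (\<Sum>j<n. c j * pd j h x) = c0"
proof -
  let ?f = "\<lambda>x. \<Sum>j<n. c j * pd j h x"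
  have f: "poly_fun n ?f" using h by (intro poly_fun_sum poly_fun_cmult poly_fun_pd)
  have "pd l ?f x = 0" if l: "l < n" for l x
  proof -
    have "pd l ?f x = (\<Sum>j<n. c j * pd l (pd j h) x)"
      by (subst pd_sum[of _ n])
        (auto intro!: poly_fun_cmult poly_fun_pd h simp: pd_cmult[OF poly_fun_pd[OF h]])
    then show ?thesis using c[OF l, of x] by (simp add: pd_commute[OF h, of l])
  qed
  then have "?f x = ?f (\<lambda>_. 0)" for x by (intro poly_fun_pd_zero_imp_const[OF f])
  then show ?thesis by blast
qed

lemma proportional_kernel:
  assumes h: "poly_fun n h" and g: "poly_fun n g" "g y \<noteq> 0"
    and vc: "\<And>j x. j < n \<Longrightarrow> v j x = c j * g x"
    and ker: "\<And>l x. (\<Sum>j<n. v j x * pd j (pd l h) x) = 0"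
  shows "(\<Sum>j<n. c j * pd j (pd l h) x) = 0"
proof (rule poly_fun_cancel[where f = g and g = "\<lambda>x. \<Sum>j<n. c j * pd j (pd l h) x", OF g(1) _ _ g(2)])
  fix x assume "g x \<noteq> 0"
  moreover have "g x * (\<Sum>j<n. c j * pd j (pd l h) x) = 0"
    using ker[of x l] vc by (simp add: sum_distrib_left mult_ac)
  ultimately show "(\<Sum>j<n. c j * pd j (pd l h) x) = 0" by simp
qed (intro poly_fun_sum poly_fun_cmult poly_fun_pd h)

text \<open>Both cases produce a kernel field of the form \<open>g c\<close> with \<open>c\<close> constant. If the polar field is not constant,
  the top component of one of its coordinates is a binary form that vanishes on the field.\<close>

lemma singular_hessian_two_variables:
  assumes h: "poly_fun 2 h"
    and sing: "\<And>x. \<exists>w. (\<exists>i<2. w i \<noteq> 0) \<and> (\<forall>j<2. (\<Sum>k<2. w k * pd k (pd j h) x) = 0)"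
  shows "\<exists>c c0. (\<exists>i<2. c i \<noteq> 0) \<and> (\<forall>x. (\<Sum>i<2. c i * pd i h x) = c0)"
proof -
  obtain k R where R: "poly_fun_le 2 k R" "\<exists>y. R y \<noteq> 0" "\<And>x. R (\<lambda>j. pd j h x) = 0"
    "\<forall>T l. poly_fun_le 2 l T \<longrightarrow> l < k \<longrightarrow> (\<forall>x. T (\<lambda>j. pd j h x) = 0) \<longrightarrow> (\<forall>y. T y = 0)"
    using minimal_gradient_relation[OF h sing] by blast
  note polar = polar_field[OF h R]
  define v where "v i x = pd i R (\<lambda>j. pd j h x)" for i x
  have v: "\<And>i. poly_fun 2 (v i)" "\<exists>i<2. \<exists>x. v i x \<noteq> 0"
    "\<And>l x. (\<Sum>j<2. v j x * pd j (pd l h) x) = 0"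
    "\<And>i t x. i < 2 \<Longrightarrow> v i (\<lambda>j. x j + t * v j x) = v i x"
    using polar unfolding v_def by blast+
  have "\<exists>c g. poly_fun 2 g \<and> (\<exists>y. g y \<noteq> 0) \<and> (\<exists>i<2. c i \<noteq> 0) \<and> (\<forall>j<2. \<forall>x. v j x = c j * g x)"
  proof (cases "\<forall>i<2. \<forall>x y. v i x = v i y")
    case True
    then have c: "v j x = v j (\<lambda>_. 0) * 1" if "j < 2" for j x using that unfolding mult_1_right by blast
    obtain i x where "i < 2" "v i x \<noteq> 0" using v(2) by blast
    then have "\<exists>i<2. v i (\<lambda>_. 0) \<noteq> 0" using c[of i x] by (intro exI[of _ i]) simp
    then show ?thesis
      by (intro exI[of _ "\<lambda>i. v i (\<lambda>_. 0)"] exI[of _ "\<lambda>_. 1"] conjI allI impI c) simp_all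
  next
    case False
    then obtain i where i: "i < 2" "\<exists>x y. v i x \<noteq> v i y" by blast
    obtain F m where F: "\<And>j. poly_fun 2 (F j)" "\<And>j. homog_fun j (F j)" "\<And>x. v i x = (\<Sum>j\<le>m. F j x)"
      using poly_fun_components[OF v(1)] by blast
    have "\<exists>j\<le>m. j > 0 \<and> (\<exists>x. F j x \<noteq> 0)"
    proof (rule ccontr)
      assume *: "\<not> ?thesis"
      have "v i x = F 0 x" for x
      proof -
        have "(\<Sum>j\<le>m. F j x) = (\<Sum>j\<in>{0}. F j x)"
          by (rule sum.mono_neutral_right) (use * in auto)
        then show ?thesis by (simp add: F(3))
      qed
      moreover have "F 0 x = F 0 (\<lambda>_. 0)" for x using homog_funD[OF F(2)[of 0], of 0 x] by simp
      ultimately show False using i(2) by metis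
    qed
    then have ne: "{j. j \<le> m \<and> j > 0 \<and> (\<exists>x. F j x \<noteq> 0)} \<noteq> {}" by blast
    define e where "e = Max {j. j \<le> m \<and> j > 0 \<and> (\<exists>x. F j x \<noteq> 0)}"
    have e: "e \<le> m" "e > 0" "\<exists>x. F e x \<noteq> 0"
      using Max_in[OF _ ne] unfolding e_def by auto
    have emax: "F j x = 0" if "j \<le> m" "j > e" for j x
    proof (rule ccontr)
      assume "F j x \<noteq> 0"
      then have "j \<le> e" unfolding e_def using that by (intro Max_ge) auto
      then show False using that by simp
    qed
    have vF: "v i x = (\<Sum>j\<le>e. F j x)" for x
      unfolding F(3) by (rule sum.mono_neutral_right) (use e(1) emax in auto)
    have "F e (\<lambda>i. v i x) = 0" for x
      by (rule top_component_vanishes[of 2 F e x]) (use F(1,2) e v(4)[OF i(1), of x] in \<open>auto simp: vF[symmetric]\<close>)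
    moreover have "F e (\<lambda>i. if i = 0 then v 0 x else v 1 x) = F e (\<lambda>i. v i x)" for x
      by (rule poly_fun_cong_coords[of 2]) (use F(1) in \<open>auto simp: less_2_cases_iff\<close>)
    ultimately have "\<exists>\<alpha> \<beta>. (\<alpha> \<noteq> 0 \<or> \<beta> \<noteq> 0) \<and> (\<forall>x. \<alpha> * v 0 x + \<beta> * v 1 x = 0)"
      using e(3) F(1)[of e] v(1) F(2) by (elim exE) (rule binary_relation[where r = "F e" and n = 2]; auto)
    then obtain \<alpha> \<beta> where ab: "\<alpha> \<noteq> 0 \<or> \<beta> \<noteq> 0" "\<And>x. \<alpha> * v 0 x + \<beta> * v 1 x = 0" by blast
    define c where "c i = (if i = 0 then \<beta> else - \<alpha>)" for i :: nat
    define g where "g x = (if \<beta> \<noteq> 0 then v 0 x / \<beta> else - v 1 x / \<alpha>)" for x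
    have vc: "v j x = c j * g x" if "j < 2" for j x
    proof (cases "\<beta> = 0")
      case True
      then have "v 0 x = 0" "\<alpha> \<noteq> 0" using ab(1) ab(2)[of x] by auto
      then show ?thesis using that True by (auto simp: less_2_cases_iff c_def g_def)
    next
      case False
      have "\<beta> * v 1 x = - \<alpha> * v 0 x" using ab(2)[of x] by (simp add: eq_neg_iff_add_eq_0 add.commute)
      then have "v 1 x = - \<alpha> * (v 0 x / \<beta>)" using False by (simp add: field_simps)
      then show ?thesis using that False by (auto simp: less_2_cases_iff c_def g_def)
    qed
    have "poly_fun 2 (\<lambda>x. inverse \<beta> * v 0 x)" "poly_fun 2 (\<lambda>x. - inverse \<alpha> * v 1 x)"
      using v(1) by (intro poly_fun_cmult; simp)+
    then have "poly_fun 2 g" unfolding g_def by (cases "\<beta> = 0") (simp_all add: field_simps)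
    moreover have "\<exists>y. g y \<noteq> 0" using v(2) vc by fastforce
    moreover have "\<exists>i<2. c i \<noteq> 0" using ab(1) by (auto simp: c_def intro: exI[of _ 0] exI[of _ 1])
    ultimately show ?thesis using vc by blast
  qed
  then obtain c g y where "poly_fun 2 g" "g y \<noteq> 0" "\<exists>i<2. c i \<noteq> 0" "\<And>j x. j < 2 \<Longrightarrow> v j x = c j * g x"
    by blast
  with proportional_kernel[OF h this(1,2,4) v(3)] constant_kernel_imp_constant_derivative[OF h]
  show ?thesis by blast
qed

section \<open>Factorization and elimination in four variables\<close>

type_synonym poly3 = "complex poly poly poly"

type_synonym poly4 = "complex poly poly poly poly"

text \<open>The outermost variable of an iterated polynomial is the last coordinate. For iterated polynomials unique
  factorization is known; these evaluations identify them with polynomial functions.\<close>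

definition ev3 :: "poly3 \<Rightarrow> point \<Rightarrow> complex" where
  "ev3 P x = poly (poly (poly P [:[:x 2:]:]) [:x 1:]) (x 0)"

definition ev4 :: "poly4 \<Rightarrow> point \<Rightarrow> complex" where
  "ev4 P x = ev3 (poly P [:[:[:x 3:]:]:]) x"

lemma ev4_simps [simp]:
  "ev4 0 x = 0" "ev4 1 x = 1" "ev4 (P + Q) x = ev4 P x + ev4 Q x" "ev4 (P * Q) x = ev4 P x * ev4 Q x"
  "ev4 [:p:] x = ev3 p x"
  by (simp_all add: ev4_def ev3_def)

lemma ev4_sum: "ev4 (\<Sum>i\<in>A. P i) x = (\<Sum>i\<in>A. ev4 (P i) x)"
  by (induction A rule: infinite_finite_induct) auto

lemma poly_zero_if_infinitely_many_roots:
  fixes p :: "'a::idom poly"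
  assumes "\<And>c :: complex. poly p (g c) = 0" "inj g"
  shows "p = 0"
proof (rule ccontr)
  assume "p \<noteq> 0"
  then have "finite {z. poly p z = 0}" by (rule poly_roots_finite)
  moreover have "range g \<subseteq> {z. poly p z = 0}" using assms(1) by auto
  ultimately have "finite (range g)" by (rule finite_subset[rotated])
  then show False using assms(2) by (simp add: finite_image_iff infinite_UNIV_char_0)
qed

lemma ev3_eq_0:
  assumes "\<And>x. ev3 P x = 0" shows "P = 0"
proof (rule poly_zero_if_infinitely_many_roots[of _ "\<lambda>c. [:[:c:]:]"])
  fix c2
  show "poly P [:[:c2:]:] = 0"
  proof (rule poly_zero_if_infinitely_many_roots[of _ "\<lambda>c. [:c:]"])
    fix c1
    show "poly (poly P [:[:c2:]:]) [:c1:] = 0"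
    proof (rule poly_zero_if_infinitely_many_roots[of _ "\<lambda>c. c"])
      fix c0
      show "poly (poly (poly P [:[:c2:]:]) [:c1:]) c0 = 0"
        using assms[of "(\<lambda>_. 0)(0 := c0, 1 := c1, 2 := c2)"] by (simp add: ev3_def)
    qed auto
  qed (auto simp: inj_def)
qed (auto simp: inj_def)

lemma ev4_eq_0:
  assumes "\<And>x. ev4 P x = 0" shows "P = 0"
proof (rule poly_zero_if_infinitely_many_roots[of _ "\<lambda>c. [:[:[:c:]:]:]"])
  fix c
  show "poly P [:[:[:c:]:]:] = 0"
  proof (rule ev3_eq_0)
    fix x
    show "ev3 (poly P [:[:[:c:]:]:]) x = 0"
      using assms[of "x(3 := c)"] by (simp add: ev3_def ev4_def)
  qed
qed (auto simp: inj_def)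

lemma ev4_inject: "(\<And>x. ev4 P x = ev4 Q x) \<Longrightarrow> P = Q"
proof -
  assume *: "\<And>x. ev4 P x = ev4 Q x"
  have "ev4 (P - Q) x = 0" for x
    using *[of x] by (simp add: ev4_def ev3_def)
  then have "P - Q = 0" by (rule ev4_eq_0)
  then show ?thesis by simp
qed

text \<open>Horner's rule: a polynomial in the coordinate \<open>x j\<close> whose coefficients evaluate to polynomial functions.\<close>

lemma poly_fun_horner:
  assumes "\<And>a. poly_fun n (E a)" and "\<And>x. E 0 x = 0" "j < n"
    and "\<And>a p x. E' (pCons a p) x = E a x + x j * E' p x" "\<And>x. E' 0 x = 0"
  shows "poly_fun n (E' p)"
proof (induction p)
  case 0
  have "E' 0 = (\<lambda>_. 0)" using assms(5) by auto
  then show ?case by simp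
next
  case (pCons a p)
  have "E' (pCons a p) = (\<lambda>x. E a x + x j * E' p x)" using assms(4) by auto
  moreover have "poly_fun n (\<lambda>x. E a x + x j * E' p x)"
    by (intro poly_fun_add poly_fun_mult poly_fun_var assms(1,3) pCons.IH)
  ultimately show ?case by simp
qed

lemma poly_fun_ev3: "poly_fun 3 (ev3 P)"
proof -
  have 0: "poly_fun 3 (\<lambda>x. poly p (x 0))" for p
    by (rule poly_fun_horner[where E = "\<lambda>a _. a" and j = 0]) auto
  have 1: "poly_fun 3 (\<lambda>x. poly (poly p [:x 1:]) (x 0))" for p
    by (rule poly_fun_horner[where E = "\<lambda>p x. poly p (x 0)" and j = 1]) (use 0 in auto)
  show ?thesis
    by (rule poly_fun_horner[where E = "\<lambda>p x. poly (poly p [:x 1:]) (x 0)" and j = 2])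
      (use 1 in \<open>auto simp: ev3_def\<close>)
qed

lemma poly_fun_ev4: "poly_fun 4 (ev4 P)"
  by (rule poly_fun_horner[where E = ev3 and j = 3])
    (auto simp: ev4_def ev3_def intro: poly_fun_mono_vars[OF poly_fun_ev3])

lemma poly_fun_eq_ev4: "poly_fun 4 f \<Longrightarrow> \<exists>P. f = ev4 P"
proof (induction rule: poly_fun_induct)
  case (const c)
  show ?case by (rule exI[of _ "[:[:[:[:c:]:]:]:]"]) (auto simp: ev3_def)
next
  case (add f g)
  then obtain P Q where "f = ev4 P" "g = ev4 Q" by blast
  then show ?case by (intro exI[of _ "P + Q"]) auto
next
  case (var i f)
  then obtain P where P: "f = ev4 P" by blast
  have "\<exists>Q. \<forall>x. ev4 Q x = x i"
  proof -
    have "i = 0 \<or> i = 1 \<or> i = 2 \<or> i = 3" using var(1) by auto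
    moreover have "\<forall>x. ev4 [:[:[:[:0, 1:]:]:]:] x = x 0" "\<forall>x. ev4 [:[:[:0, 1:]:]:] x = x 1"
      "\<forall>x. ev4 [:[:0, 1:]:] x = x 2" "\<forall>x. ev4 [:0, 1:] x = x 3"
      by (simp_all add: ev4_def ev3_def)
    ultimately show ?thesis by blast
  qed
  then obtain Q where "\<forall>x. ev4 Q x = x i" by blast
  then show ?case using P by (intro exI[of _ "Q * P"]) auto
qed

definition fun_dvd :: "nat \<Rightarrow> (point \<Rightarrow> complex) \<Rightarrow> (point \<Rightarrow> complex) \<Rightarrow> bool" where
  "fun_dvd n f g \<longleftrightarrow> (\<exists>q. poly_fun n q \<and> (\<forall>x. g x = f x * q x))"

definition fun_coprime :: "nat \<Rightarrow> (nat \<Rightarrow> point \<Rightarrow> complex) \<Rightarrow> bool" where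
  "fun_coprime n u \<longleftrightarrow> (\<forall>g. poly_fun n g \<longrightarrow> (\<forall>i<n. fun_dvd n g (u i)) \<longrightarrow> (\<exists>c. \<forall>x. g x = c))"

lemma fun_dvd_ev4: "fun_dvd 4 (ev4 P) (ev4 Q) \<longleftrightarrow> P dvd Q"
proof
  assume "fun_dvd 4 (ev4 P) (ev4 Q)"
  then obtain q where "poly_fun 4 q" "\<And>x. ev4 Q x = ev4 P x * q x" by (auto simp: fun_dvd_def)
  moreover then obtain S where "q = ev4 S" using poly_fun_eq_ev4 by blast
  ultimately have "Q = P * S" by (intro ev4_inject) simp
  then show "P dvd Q" by simp
next
  assume "P dvd Q"
  then show "fun_dvd 4 (ev4 P) (ev4 Q)"
    unfolding fun_dvd_def using poly_fun_ev4 by (elim dvdE) auto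
qed

lemma ev4_const: assumes "\<And>x. ev4 P x = c" shows "P = [:[:[:[:c:]:]:]:]"
  by (rule ev4_inject) (simp add: assms, simp add: ev3_def)

lemma extract_common_factor:
  assumes v: "\<And>i. i < 4 \<Longrightarrow> poly_fun 4 (v i)" and nz: "\<exists>i<4. \<exists>x. v i x \<noteq> 0"
  shows "\<exists>g u. poly_fun 4 g \<and> (\<forall>i<4. poly_fun 4 (u i) \<and> (\<forall>x. v i x = g x * u i x)) \<and> fun_coprime 4 u"
proof -
  have "\<forall>i. \<exists>V. i < 4 \<longrightarrow> v i = ev4 V" using v poly_fun_eq_ev4 by blast
  from choice[OF this] obtain V where V: "\<And>i. i < 4 \<Longrightarrow> v i = ev4 (V i)" by blast
  define G where "G = Gcd (V ` {..<4})"
  have "\<exists>i<4. V i \<noteq> 0" using nz V by fastforce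
  then have "G \<noteq> 0" by (auto simp: G_def)
  have dv: "G dvd V i" if "i < 4" for i unfolding G_def using that by (intro Gcd_dvd) auto
  then obtain U where U: "\<And>i. i < 4 \<Longrightarrow> V i = G * U i" unfolding dvd_def by metis
  have "fun_coprime 4 (\<lambda>i. ev4 (U i))"
    unfolding fun_coprime_def
  proof (intro allI impI)
    fix g assume "poly_fun 4 g" and d: "\<forall>i<4. fun_dvd 4 g (ev4 (U i))"
    then obtain H where H: "g = ev4 H" using poly_fun_eq_ev4 by blast
    have "G * H dvd V i" if "i < 4" for i
      using d that U by (simp add: H fun_dvd_ev4)
    then have "G * H dvd G" unfolding G_def by (intro Gcd_greatest) auto
    then have "H dvd 1" using \<open>G \<noteq> 0\<close> by (metis dvd_mult_cancel_left mult.right_neutral)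
    then obtain K where "H * K = 1" by (metis dvdE)
    then have K: "ev4 H x * ev4 K x = 1" for x by (metis ev4_simps(2,4))
    have "ev4 H x = ev4 H y" for x y
    proof -
      have "ev4 H (\<lambda>i. x i + 1 * (y i - x i)) = ev4 H x"
        by (rule factor_constant_on_line[OF poly_fun_ev4 poly_fun_ev4[of K]]) (use K in auto)
      then show ?thesis by simp
    qed
    then show "\<exists>c. \<forall>x. g x = c" using H by blast
  qed
  moreover have "\<forall>x. v i x = ev4 G x * ev4 (U i) x" if "i < 4" for i using V U that by simp
  ultimately show ?thesis
    by (intro exI[of _ "ev4 G"] exI[of _ "\<lambda>i. ev4 (U i)"]) (simp add: poly_fun_ev4)
qed

text \<open>A non-zero element \<open>G\<close> of least degree in the ideal generated by the \<open>U i\<close> divides a multiple \<open>c U\<^sub>i\<close> with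
  a coefficient \<open>c\<close>, by pseudo-division. By Gauss's lemma its primitive part divides all \<open>U i\<close>, and so has
  degree 0.\<close>

lemma ideal_contains_constant:
  fixes U :: "nat \<Rightarrow> 'a::{factorial_ring_gcd,semiring_gcd_mult_normalize} poly"
  assumes nz: "\<exists>i<m. U i \<noteq> 0" and cop: "\<And>G. (\<And>i. i < m \<Longrightarrow> G dvd U i) \<Longrightarrow> degree G = 0"
  shows "\<exists>p r. r \<noteq> 0 \<and> (\<Sum>i<m. p i * U i) = [:r:]"
proof -
  define I where "I = {f. \<exists>p. f = (\<Sum>i<m. p i * U i)}"
  have UI: "U i \<in> I" if "i < m" for i
    unfolding I_def using that by (auto intro!: exI[of _ "\<lambda>j. if j = i then 1 else 0"] simp: if_distrib[of "\<lambda>z. z * _"] cong: if_cong)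
  have lin: "smult a f - q * g \<in> I" if "f \<in> I" "g \<in> I" for a f q g
  proof -
    obtain p p' where "f = (\<Sum>i<m. p i * U i)" "g = (\<Sum>i<m. p' i * U i)" using \<open>f \<in> I\<close> \<open>g \<in> I\<close> by (auto simp: I_def)
    then have "[:a:] * f - q * g = (\<Sum>i<m. ([:a:] * p i - q * p' i) * U i)"
      by (simp only: left_diff_distrib sum_subtractf sum_distrib_left mult.assoc)
    moreover have "[:a:] * f = smult a f" by simp
    ultimately show ?thesis unfolding I_def by (intro CollectI exI) simp
  qed
  obtain G where G: "G \<in> I" "G \<noteq> 0" and min: "\<And>f. f \<in> I \<Longrightarrow> f \<noteq> 0 \<Longrightarrow> degree G \<le> degree f"
  proof -
    obtain i where "i < m" "U i \<noteq> 0" using nz by blast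
    then have "U i \<in> I \<and> U i \<noteq> 0" using UI by simp
    from ex_has_least_nat[of "\<lambda>f. f \<in> I \<and> f \<noteq> 0" "U i" degree, OF this] show thesis
      using that by blast
  qed
  have "primitive_part G dvd U i" if i: "i < m" for i
  proof -
    obtain q r where qr: "pseudo_divmod (U i) G = (q, r)" by (cases "pseudo_divmod (U i) G")
    define c where "c = coeff G (degree G) ^ (Suc (degree (U i)) - degree G)"
    have c: "c \<noteq> 0" using G(2) by (simp add: c_def)
    have *: "smult c (U i) = G * q + r" "r = 0 \<or> degree r < degree G"
      using pseudo_divmod[OF G(2) qr] by (auto simp: c_def)
    have "r \<in> I" using lin[OF UI[OF i] G(1), of c q] *(1) by (simp add: mult.commute)
    then have "r = 0" using *(2) min by fastforce
    then have "G dvd smult c (U i)" using * by simp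
    moreover have "primitive_part G dvd G" by (metis content_times_primitive_part dvd_refl dvd_smult)
    ultimately have "primitive_part G dvd smult c (U i)" by (rule dvd_trans[rotated])
    then have "fract_poly (primitive_part G) dvd smult (to_fract c) (fract_poly (U i))"
      unfolding fract_poly_smult[symmetric] by (rule fract_poly_dvd)
    then have "fract_poly (primitive_part G) dvd fract_poly (U i)"
      using c by (simp add: dvd_smult_iff)
    then show ?thesis by (rule fract_poly_dvdD) (use G(2) in simp)
  qed
  then have "degree (primitive_part G) = 0" by (rule cop)
  then have "degree G = 0" by simp
  then obtain r where r: "G = [:r:]" by (rule degree_eq_zeroE)
  obtain p where "G = (\<Sum>i<m. p i * U i)" using G(1) unfolding I_def by blast
  then have "(\<Sum>i<m. p i * U i) = [:r:]" by (simp only: r)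
  moreover have "r \<noteq> 0" using G(2) r by simp
  ultimately show ?thesis by blast
qed

text \<open>Coprime polynomials have a zero set of codimension at least two. In the form used below: its projection along
  the last coordinate lies in a hypersurface \<open>r = 0\<close>.\<close>

lemma eliminate_last_variable:
  assumes u: "\<And>i. i < 4 \<Longrightarrow> poly_fun 4 (u i)" and nz: "\<exists>i<4. \<exists>x. u i x \<noteq> 0" and cop: "fun_coprime 4 u"
  shows "\<exists>p r. poly_fun 3 r \<and> (\<exists>x. r x \<noteq> 0) \<and> (\<forall>x. r x = (\<Sum>i<4. p i x * u i x))"
proof -
  have "\<forall>i. \<exists>U. i < 4 \<longrightarrow> u i = ev4 U" using u poly_fun_eq_ev4 by blast
  from choice[OF this] obtain U where U: "\<And>i. i < 4 \<Longrightarrow> u i = ev4 (U i)" by blast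
  have "\<exists>p r. r \<noteq> 0 \<and> (\<Sum>i<4. p i * U i) = [:r:]"
  proof (rule ideal_contains_constant)
    show "\<exists>i<4. U i \<noteq> 0" using nz U by fastforce
    fix G assume "\<And>i. i < 4 \<Longrightarrow> G dvd U i"
    then have "\<exists>c. \<forall>x. ev4 G x = c"
      using cop[unfolded fun_coprime_def, rule_format, OF poly_fun_ev4[of G]] U by (simp add: fun_dvd_ev4)
    then obtain c where "G = [:[:[:[:c:]:]:]:]" using ev4_const by blast
    then show "degree G = 0" by simp
  qed
  then obtain p r where r: "r \<noteq> 0" "(\<Sum>i<4. p i * U i) = [:r:]" by blast
  have "ev3 r x = (\<Sum>i<4. ev4 (p i) x * u i x)" for x
    using arg_cong[OF r(2), of "\<lambda>P. ev4 P x"] U by (simp add: ev4_sum)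
  moreover have "\<exists>x. ev3 r x \<noteq> 0" using ev3_eq_0[of r] r(1) by blast
  ultimately show ?thesis
    by (intro exI[of _ "\<lambda>i. ev4 (p i)"] exI[of _ "ev3 r"]) (simp add: poly_fun_ev3)
qed

text \<open>Non-zero constants have this property as well; a prime is always used together with one of its zeros.\<close>

definition fun_prime :: "nat \<Rightarrow> (point \<Rightarrow> complex) \<Rightarrow> bool" where
  "fun_prime n f \<longleftrightarrow> (\<exists>x. f x \<noteq> 0) \<and>
     (\<forall>a b. poly_fun n a \<longrightarrow> poly_fun n b \<longrightarrow> fun_dvd n f (\<lambda>x. a x * b x) \<longrightarrow> fun_dvd n f a \<or> fun_dvd n f b)"

lemma prime_factor_through_zero:
  assumes P: "poly_fun 4 P" "P y \<noteq> 0" "P a = 0"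
  shows "\<exists>f. poly_fun 4 f \<and> f a = 0 \<and> fun_dvd 4 f P \<and> fun_prime 4 f"
proof -
  obtain Q where Q: "P = ev4 Q" using poly_fun_eq_ev4[OF P(1)] by blast
  have "Q \<noteq> 0" using P Q by auto
  then obtain A where A: "\<And>f. f \<in># A \<Longrightarrow> prime_elem f" "normalize (prod_mset A) = normalize Q"
    using prime_factorization_exists[OF \<open>Q \<noteq> 0\<close>] by blast
  have d: "Q dvd prod_mset A" "prod_mset A dvd Q" by (rule associatedD2[OF A(2)], rule associatedD1[OF A(2)])
  obtain K where "prod_mset A = Q * K" using d(1) by (elim dvdE)
  then have "ev4 (prod_mset A) a = 0" using P(3) Q by simp
  then have "\<exists>f\<in>#A. ev4 f a = 0" by (induction A) auto
  then obtain f where f: "f \<in># A" "ev4 f a = 0" by blast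
  have pf: "prime_elem f" using A f by blast
  have "f dvd Q" by (rule dvd_trans[OF dvd_prod_mset[OF f(1)] d(2)])
  moreover have "fun_prime 4 (ev4 f)"
    unfolding fun_prime_def
  proof (intro conjI allI impI)
    show "\<exists>x. ev4 f x \<noteq> 0" using ev4_eq_0[of f] prime_elem_not_zeroI[OF pf] by blast
    fix b c assume "poly_fun 4 b" "poly_fun 4 c" and fd: "fun_dvd 4 (ev4 f) (\<lambda>x. b x * c x)"
    then obtain B C where BC: "b = ev4 B" "c = ev4 C" using poly_fun_eq_ev4 by blast
    have "(\<lambda>x. b x * c x) = ev4 (B * C)" using BC by auto
    then have "f dvd B * C" using fd by (simp add: fun_dvd_ev4)
    then show "fun_dvd 4 (ev4 f) b \<or> fun_dvd 4 (ev4 f) c"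
      using prime_elem_dvd_multD[OF pf] by (auto simp: BC fun_dvd_ev4)
  qed
  ultimately show ?thesis
    using f(2) by (intro exI[of _ "ev4 f"]) (simp add: Q poly_fun_ev4 fun_dvd_ev4)
qed

section \<open>Factors, invariants and Wronskians\<close>

text \<open>On a ray through a general point the product is a monomial \<open>c t\<^sup>e\<close>, so each factor is a monomial as well: its order at
  0 equals its degree. Two non-zero components of \<open>f\<close> would contradict this.\<close>

lemma homog_fun_factor:
  assumes f: "poly_fun n f" and q: "poly_fun n q" and P: "poly_fun n P" "homog_fun e P" "P y \<noteq> 0"
    and fq: "\<And>x. P x = f x * q x"
  shows "\<exists>m. homog_fun m f"
proof -
  obtain F k where F: "\<And>j. poly_fun n (F j)" "\<And>j. homog_fun j (F j)" "\<And>x. f x = (\<Sum>j\<le>k. F j x)"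
    using poly_fun_components[OF f] by blast
  note F' = F(1)
  have one: "\<not> (i < j \<and> j \<le> k \<and> F i a \<noteq> 0 \<and> F j b \<noteq> 0)" for i j a b
  proof
    assume *: "i < j \<and> j \<le> k \<and> F i a \<noteq> 0 \<and> F j b \<noteq> 0"
    obtain c where c: "F i c * F j c \<noteq> 0"
      using poly_fun_common_nonzero[OF F' F'] * by (metis mult_eq_0_iff)
    obtain x where x: "F i x * F j x \<noteq> 0" "P x \<noteq> 0"
      using poly_fun_common_nonzero[OF poly_fun_mult[OF F' F'] P(1), OF c P(3)] by blast
    define p where "p = (\<Sum>l\<le>k. monom (F l x) l)"
    have p: "f (\<lambda>i. t * x i) = poly p t" for t
      by (simp add: p_def F(3) poly_sum poly_monom homog_funD[OF F(2)] mult.commute)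
    have cp: "coeff p l = (if l \<le> k then F l x else 0)" for l
      by (simp add: p_def coeff_sum)
    obtain r where r: "\<And>t. q (\<lambda>i. t * x i) = poly r t" using poly_fun_restrict_ray[OF q] by blast
    have pr: "p * r = monom (P x) e"
      by (rule complex_poly_ext) (simp add: p[symmetric] r[symmetric] fq[symmetric] homog_funD[OF P(2)] poly_monom mult.commute)
    then have nz: "p * r \<noteq> 0" using x by simp
    have "order 0 p + order 0 r = e"
      using order_mult[OF nz, of 0] x(2) by (simp add: pr order_0_monom)
    moreover have "degree p + degree r = e"
    proof -
      have "degree (p * r) = degree p + degree r" by (rule degree_mult_eq) (use nz in auto)
      then show ?thesis using x(2) by (simp add: pr degree_monom_eq)
    qed
    moreover have "order 0 p \<le> degree p" "order 0 r \<le> degree r"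
      using nz by (auto intro: order_degree)
    ultimately have "order 0 p = degree p" by simp
    moreover have "degree p \<ge> j" by (rule le_degree) (use * x in \<open>auto simp: cp\<close>)
    moreover have "order 0 p \<le> i"
    proof (rule ccontr)
      assume "\<not> order 0 p \<le> i"
      moreover have "monom 1 (order 0 p) dvd p"
        using order_1[of 0 p] by (simp add: monom_altdef)
      ultimately have "coeff p i = 0" by (simp add: monom_1_dvd_iff')
      then show False using * x by (simp add: cp)
    qed
    ultimately show False using * by simp
  qed
  have "f y \<noteq> 0" using P(3) fq[of y] by auto
  then obtain m where m: "m \<le> k" "F m y \<noteq> 0" unfolding F(3) by (meson atMost_iff sum.neutral)
  have "F j x = 0" if "j \<le> k" "j \<noteq> m" for j x
    using one[of j m x y] one[of m j y x] m that by (cases "j < m") auto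
  then have "f x = F m x" for x
  proof -
    have "(\<Sum>j\<le>k. F j x) = (\<Sum>j\<in>{m}. F j x)"
      by (rule sum.mono_neutral_right) (use m \<open>\<And>j x. j \<le> k \<Longrightarrow> j \<noteq> m \<Longrightarrow> F j x = 0\<close> in auto)
    then show ?thesis by (simp add: F(3))
  qed
  then have "homog_fun m f" using F(2)[of m] by (simp add: homog_fun_def)
  then show ?thesis ..
qed

lemma invariant_derivative_zero:
  assumes f: "poly_fun n f" and inv: "\<And>t. f (\<lambda>i. x i + t * v i) = f x"
  shows "(\<Sum>i<n. v i * pd i f x) = 0"
proof -
  obtain p where p: "\<And>t. f (\<lambda>i. x i + t * v i) = poly p t"
    "\<And>t. (\<Sum>i<n. v i * pd i f (\<lambda>i. x i + t * v i)) = poly (pderiv p) t"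
    using poly_fun_line_poly[OF f, of x v] by blast
  have "p = [:f x:]" by (rule complex_poly_ext) (simp add: p(1)[symmetric] inv)
  then show ?thesis using p(2)[of 0] by (simp add: pderiv_pCons)
qed

lemma derivative_zero_invariant:
  assumes f: "poly_fun n f" and 0: "\<And>x. (\<Sum>i<n. v i * pd i f x) = 0"
  shows "f (\<lambda>i. x i + t * v i) = f x"
proof -
  obtain p where p: "\<And>t. f (\<lambda>i. x i + t * v i) = poly p t"
    "\<And>t. (\<Sum>i<n. v i * pd i f (\<lambda>i. x i + t * v i)) = poly (pderiv p) t"
    using poly_fun_line_poly[OF f, of x v] by blast
  have "pderiv p = 0" by (rule complex_poly_ext) (simp add: p(2)[symmetric] 0)
  then have "degree p = 0" by (simp add: pderiv_eq_0_iff)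
  then obtain c where "p = [:c:]" by (rule degree_eq_zeroE)
  then show ?thesis using p(1)[of t] p(1)[of 0] by simp
qed

text \<open>The ring of invariants of a field that moves every point along a line is closed under taking factors, because a product of
  polynomials in \<open>t\<close> that is a non-zero constant has constant factors.\<close>

lemma factor_flow_invariant:
  assumes f: "poly_fun n f" and q: "poly_fun n q" and P: "poly_fun n P" "P y \<noteq> 0"
    and fq: "\<And>x. P x = f x * q x" and v: "\<And>i. i < n \<Longrightarrow> poly_fun n (v i)"
    and inv: "\<And>x t. P (\<lambda>i. x i + t * v i x) = P x"
  shows "f (\<lambda>i. x i + t * v i x) = f x"
proof -
  have "f (\<lambda>i. x i + t * v i x) - f x = 0"
  proof (rule poly_fun_cancel[where f = P and g = "\<lambda>x. f (\<lambda>i. x i + t * v i x) - f x", OF P(1) _ _ P(2)])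
    show "poly_fun n (\<lambda>x. f (\<lambda>i. x i + t * v i x) - f x)"
      by (intro poly_fun_diff f poly_fun_compose[OF f] poly_fun_add poly_fun_cmult poly_fun_var v)
    fix x assume "P x \<noteq> 0"
    then show "f (\<lambda>i. x i + t * v i x) - f x = 0"
      using factor_constant_on_line[OF f q, of x "\<lambda>i. v i x" t] inv[of x] by (simp add: fq)
  qed
  then show ?thesis by simp
qed

lemma invariant_vanishes_on_field:
  assumes f: "poly_fun n f" and m: "homog_fun m f" "m > 0" and inv: "\<And>t. f (\<lambda>i. x i + t * v i) = f x"
  shows "f v = 0"
proof -
  let ?F = "\<lambda>j. if j = m then f else (\<lambda>_. 0)"
  have s: "(\<Sum>j\<le>m. ?F j z) = f z" for z
  proof -
    have "(\<Sum>j\<le>m. ?F j z) = (\<Sum>j\<le>m. if j = m then f z else 0)" by (rule sum.cong) auto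
    then show ?thesis by simp
  qed
  have "?F m v = 0"
    by (rule top_component_vanishes[of n ?F m x v]) (use f m inv in \<open>auto simp: s homog_fun_def\<close>)
  then show ?thesis by simp
qed

text \<open>The quotient \<open>b/a\<close> has derivative zero. On a line through a point where \<open>a\<close> does not vanish,
  \<open>d = b - \<gamma> a\<close> solves \<open>a d' = a' d\<close> with \<open>d(0) = 0\<close>.\<close>

lemma wronskian_zero_imp_dependent:
  assumes a: "poly_fun n a" and b: "poly_fun n b"
    and W: "\<And>k x. k < n \<Longrightarrow> a x * pd k b x = b x * pd k a x"
  shows "\<exists>\<alpha> \<beta>. (\<alpha> \<noteq> 0 \<or> \<beta> \<noteq> 0) \<and> (\<forall>x. \<alpha> * a x + \<beta> * b x = 0)"
proof (cases "\<forall>x. a x = 0")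
  case True
  then show ?thesis by (intro exI[of _ 1] exI[of _ 0]) simp
next
  case False
  then obtain y where y: "a y \<noteq> 0" by blast
  define \<gamma> where "\<gamma> = b y / a y"
  have "b x = \<gamma> * a x" for x
  proof -
    let ?v = "\<lambda>i. x i - y i"
    obtain A where A: "\<And>t. a (\<lambda>i. y i + t * ?v i) = poly A t"
      "\<And>t. (\<Sum>i<n. ?v i * pd i a (\<lambda>i. y i + t * ?v i)) = poly (pderiv A) t"
      using poly_fun_line_poly[OF a, of y ?v] by blast
    obtain B where B: "\<And>t. b (\<lambda>i. y i + t * ?v i) = poly B t"
      "\<And>t. (\<Sum>i<n. ?v i * pd i b (\<lambda>i. y i + t * ?v i)) = poly (pderiv B) t"
      using poly_fun_line_poly[OF b, of y ?v] by blast
    have AB: "A * pderiv B = B * pderiv A"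
    proof (rule complex_poly_ext)
      fix t
      show "poly (A * pderiv B) t = poly (B * pderiv A) t"
        unfolding poly_mult A(1)[symmetric] A(2)[symmetric] B(1)[symmetric] B(2)[symmetric] sum_distrib_left
        by (rule sum.cong) (use W in \<open>simp_all add: mult.left_commute\<close>)
    qed
    define d where "d = B - smult \<gamma> A"
    have "(\<lambda>_::nat. d) 0 = 0"
    proof (rule poly_ode_zero[where n = 1 and d = "\<lambda>_. d" and c = A and A = "\<lambda>_ _. pderiv A"])
      show "poly d 0 = 0" using y A(1)[of 0] B(1)[of 0] by (simp add: d_def \<gamma>_def)
      show "poly A 0 \<noteq> 0" using y A(1)[of 0] by simp
      have "A * pderiv d = pderiv A * d"
        using AB by (simp add: d_def pderiv_diff pderiv_smult algebra_simps)
      then show "A * pderiv d = (\<Sum>j<1::nat. pderiv A * d)" by simp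
    qed auto
    then have "B = smult \<gamma> A" by (simp add: d_def)
    then show ?thesis using A(1)[of 1] B(1)[of 1] by simp
  qed
  then show ?thesis by (intro exI[of _ \<gamma>] exI[of _ "-1"]) simp
qed

lemma fun_dvd_mult_right: "fun_dvd n f a \<Longrightarrow> poly_fun n b \<Longrightarrow> fun_dvd n f (\<lambda>x. b x * a x)"
  unfolding fun_dvd_def
proof (elim exE conjE)
  fix q assume "poly_fun n b" "poly_fun n q" "\<forall>x. a x = f x * q x"
  then show "\<exists>q. poly_fun n q \<and> (\<forall>x. b x * a x = f x * q x)"
    by (intro exI[of _ "\<lambda>x. b x * q x"]) (auto simp: mult.left_commute)
qed

lemma fun_dvd_add: "fun_dvd n f a \<Longrightarrow> fun_dvd n f b \<Longrightarrow> fun_dvd n f (\<lambda>x. a x + b x)"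
  unfolding fun_dvd_def
proof (elim exE conjE)
  fix q r assume "poly_fun n r" "poly_fun n q" "\<forall>x. a x = f x * q x" "\<forall>x. b x = f x * r x"
  then show "\<exists>q. poly_fun n q \<and> (\<forall>x. a x + b x = f x * q x)"
    by (intro exI[of _ "\<lambda>x. q x + r x"]) (auto simp: distrib_left)
qed

lemma fun_dvd_0: "fun_dvd n f (\<lambda>_. 0)"
  unfolding fun_dvd_def by (intro exI[of _ "\<lambda>_. 0"]) simp

lemma fun_dvd_sum: "(\<And>i. i \<in> A \<Longrightarrow> fun_dvd n f (a i)) \<Longrightarrow> fun_dvd n f (\<lambda>x. \<Sum>i\<in>A. a i x)"
  by (induction A rule: infinite_finite_induct) (auto intro: fun_dvd_add fun_dvd_0)

lemma fun_dvd_imp_zero: "fun_dvd n f g \<Longrightarrow> f x = 0 \<Longrightarrow> g x = 0"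
  by (auto simp: fun_dvd_def)

lemma fun_dvd_composition_diff:
  assumes r: "poly_fun m r"
    and a: "\<And>i. i < m \<Longrightarrow> poly_fun n (a i)" and b: "\<And>i. i < m \<Longrightarrow> poly_fun n (b i)"
    and d: "\<And>i. i < m \<Longrightarrow> fun_dvd n f (\<lambda>x. a i x - b i x)"
  shows "fun_dvd n f (\<lambda>x. r (\<lambda>i. a i x) - r (\<lambda>i. b i x))"
  using r
proof (induction rule: poly_fun_induct)
  case (const c)
  show ?case by (simp add: fun_dvd_0)
next
  case (add g h)
  have "fun_dvd n f (\<lambda>x. (g (\<lambda>i. a i x) - g (\<lambda>i. b i x)) + (h (\<lambda>i. a i x) - h (\<lambda>i. b i x)))"
    by (rule fun_dvd_add[OF add.IH])
  then show ?case by (simp add: algebra_simps)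
next
  case (var i g)
  have "fun_dvd n f (\<lambda>x. a i x * (g (\<lambda>i. a i x) - g (\<lambda>i. b i x)) + g (\<lambda>i. b i x) * (a i x - b i x))"
    by (intro fun_dvd_add fun_dvd_mult_right var.IH d a var.hyps poly_fun_compose[OF var.hyps(2)] b)
  then show ?case by (simp add: algebra_simps)
qed

lemma fun_prime_dvd_power:
  assumes "fun_prime n f" "poly_fun n a" "poly_fun n b" "fun_dvd n f (\<lambda>x. a x ^ k * b x)"
  shows "fun_dvd n f a \<or> fun_dvd n f b"
  using assms(4)
proof (induction k)
  case (Suc k)
  then have "fun_dvd n f (\<lambda>x. a x * (a x ^ k * b x))" by (simp add: mult.assoc)
  then have "fun_dvd n f a \<or> fun_dvd n f (\<lambda>x. a x ^ k * b x)"
    using assms(1)[unfolded fun_prime_def, THEN conjunct2, rule_format, OF assms(2)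
        poly_fun_mult[OF poly_fun_power[OF assms(2)] assms(3)]] by blast
  then show ?case using Suc.IH by blast
qed simp

lemma fun_prime_dvd_prod_mset:
  assumes "fun_prime n f" "\<And>\<gamma>. poly_fun n (a \<gamma>)" "fun_dvd n f (\<lambda>x. c * (\<Prod>\<gamma>\<in>#A. a \<gamma> x))"
  shows "fun_dvd n f (\<lambda>_. c) \<or> (\<exists>\<gamma>. fun_dvd n f (a \<gamma>))"
  using assms(3)
proof (induction A)
  case (add \<gamma> A)
  have "poly_fun n (\<lambda>x. \<Prod>\<gamma>\<in>#A. a \<gamma> x)"
    by (induction A) (auto intro!: poly_fun_mult assms(2))
  then have pf: "poly_fun n (\<lambda>x. c * (\<Prod>\<gamma>\<in>#A. a \<gamma> x))" by (rule poly_fun_cmult)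
  have "fun_dvd n f (\<lambda>x. a \<gamma> x * (c * (\<Prod>\<gamma>\<in>#A. a \<gamma> x)))" using add.prems by (simp add: mult.left_commute)
  then have "fun_dvd n f (a \<gamma>) \<or> fun_dvd n f (\<lambda>x. c * (\<Prod>\<gamma>\<in>#A. a \<gamma> x))"
    using assms(1)[unfolded fun_prime_def, THEN conjunct2, rule_format, OF assms(2) pf] by blast
  then show ?case using add.IH by blast
qed simp

section \<open>Homogeneous fields that are constant on their own lines\<close>

text \<open>Cramer's rule: \<open>D\<close> is the determinant of the coefficients, up to sign.\<close>

lemma cramer_3:
  fixes a0 a1 a2 b0 b1 b2 c0 c1 c2 r0 r1 r2 :: complex
  assumes A: "a0 * r0 + a1 * r1 + a2 * r2 = 0" and B: "b0 * r0 + b1 * r1 + b2 * r2 = 0"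
    and C: "c0 * r0 + c1 * r1 + c2 * r2 = 0"
  defines "D \<equiv> (c1 * b2 - c2 * b1) * a0 + (c2 * b0 - c0 * b2) * a1 + (c0 * b1 - c1 * b0) * a2"
  shows "D * r0 = 0" "D * r1 = 0" "D * r2 = 0"
proof -
  have "D * r0 = (c1 * b2 - c2 * b1) * (a0 * r0 + a1 * r1 + a2 * r2)
      + (b1 * a2 - b2 * a1) * (c0 * r0 + c1 * r1 + c2 * r2)
      + (a1 * c2 - a2 * c1) * (b0 * r0 + b1 * r1 + b2 * r2)"
    unfolding D_def by (simp add: algebra_simps)
  then show "D * r0 = 0" unfolding A B C by simp
  have "D * r1 = (c2 * b0 - c0 * b2) * (a0 * r0 + a1 * r1 + a2 * r2)
      + (b2 * a0 - b0 * a2) * (c0 * r0 + c1 * r1 + c2 * r2)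
      + (a2 * c0 - a0 * c2) * (b0 * r0 + b1 * r1 + b2 * r2)"
    unfolding D_def by (simp add: algebra_simps)
  then show "D * r1 = 0" unfolding A B C by simp
  have "D * r2 = (c0 * b1 - c1 * b0) * (a0 * r0 + a1 * r1 + a2 * r2)
      + (b0 * a1 - b1 * a0) * (c0 * r0 + c1 * r1 + c2 * r2)
      + (a0 * c1 - a1 * c0) * (b0 * r0 + b1 * r1 + b2 * r2)"
    unfolding D_def by (simp add: algebra_simps)
  then show "D * r2 = 0" unfolding A B C by simp
qed

lemma cross_zero:
  fixes x0 x1 y0 y1 z0 z1 :: complex
  assumes "x0 * z1 = x1 * z0" "y0 * z1 = y1 * z0"
  shows "(x0 * y1 - x1 * y0) * z0 = 0"
proof -
  have "(x0 * y1 - x1 * y0) * z0 = x0 * (y1 * z0) - y0 * (x1 * z0)" by (simp add: algebra_simps)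
  then show ?thesis unfolding assms[symmetric] by simp
qed

text \<open>The fields that remain after division of a homogeneous polar field of positive degree by the common factor
  of its coordinates. The hypotheses are symmetric in the coordinates, which is used to transfer
  results on the first coordinates to arbitrary ones.\<close>

locale straight_homogeneous_field =
  fixes u :: "nat \<Rightarrow> point \<Rightarrow> complex" and e :: nat
  assumes u: "i < 4 \<Longrightarrow> poly_fun 4 (u i)"
    and hom: "i < 4 \<Longrightarrow> homog_fun e (u i)"
    and e: "e > 0"
    and flow: "i < 4 \<Longrightarrow> u i (\<lambda>j. x j + t * u j x) = u i x"
    and nz: "\<exists>i<4. \<exists>x. u i x \<noteq> 0"
    and cop: "fun_coprime 4 u"
begin

lemma scale: "i < 4 \<Longrightarrow> u i (\<lambda>j. t * x j) = t ^ e * u i x"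
  using hom by (rule homog_funD)

lemma scale_image:
  obtains t where "\<And>i. i < 4 \<Longrightarrow> u i (\<lambda>j. t * x j) = s * u i x"
proof -
  obtain t where "t ^ e = s" using complex_nth_root[OF e] by blast
  then show ?thesis using scale by (intro that[of t]) simp
qed

text \<open>The leading coefficient of \<open>u(x + t u(x)) = u(x)\<close> as a polynomial in \<open>t\<close>.\<close>

lemma zero_at_image: "i < 4 \<Longrightarrow> u i (\<lambda>j. u j x) = 0"
  by (rule invariant_vanishes_on_field[where f = "u i" and n = 4 and m = e and x = x])
    (simp_all add: u hom e flow)

lemma permute_coordinates:
  assumes st: "\<And>i. i < 4 \<Longrightarrow> \<sigma> i < 4 \<and> \<tau> i < 4 \<and> \<sigma> (\<tau> i) = i \<and> \<tau> (\<sigma> i) = i"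
  shows "straight_homogeneous_field (\<lambda>i x. u (\<sigma> i) (\<lambda>j. x (\<tau> j))) e"
proof
  fix i :: nat and x :: point and t :: complex
  {
    assume i: "i < 4"
    show pf: "poly_fun 4 (\<lambda>x. u (\<sigma> i) (\<lambda>j. x (\<tau> j)))"
      using st i by (intro poly_fun_compose[OF u] poly_fun_var) auto
    show "homog_fun e (\<lambda>x. u (\<sigma> i) (\<lambda>j. x (\<tau> j)))"
      using st[OF i] by (simp add: homog_fun_def scale[of "\<sigma> i" _ "\<lambda>j. _ (\<tau> j)"])
    have "u (\<sigma> i) (\<lambda>j. x (\<tau> j) + t * u (\<sigma> (\<tau> j)) (\<lambda>j. x (\<tau> j))) =
        u (\<sigma> i) (\<lambda>j. x (\<tau> j) + t * u j (\<lambda>j. x (\<tau> j)))"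
      by (rule poly_fun_cong_coords[OF u]) (use st i in auto)
    also have "\<dots> = u (\<sigma> i) (\<lambda>j. x (\<tau> j))"
      using st[OF i] by (intro flow) simp
    finally show "u (\<sigma> i) (\<lambda>j. x (\<tau> j) + t * u (\<sigma> (\<tau> j)) (\<lambda>j. x (\<tau> j))) = u (\<sigma> i) (\<lambda>j. x (\<tau> j))" .
  }
  have back_eq: "u i (\<lambda>j. x (\<sigma> (\<tau> j))) = u i x" if "i < 4" for i x
    by (rule poly_fun_cong_coords[OF u[OF that]]) (use st in auto)
  show "e > 0" by (rule e)
  show "\<exists>i<4. \<exists>x. u (\<sigma> i) (\<lambda>j. x (\<tau> j)) \<noteq> 0"
  proof -
    obtain i x where "i < 4" "u i x \<noteq> 0" using nz by blast
    then show ?thesis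
      using st[of i] back_eq[of i x] by (intro exI[of _ "\<tau> i"] conjI exI[of _ "\<lambda>j. x (\<sigma> j)"]) auto
  qed
  show "fun_coprime 4 (\<lambda>i x. u (\<sigma> i) (\<lambda>j. x (\<tau> j)))"
    unfolding fun_coprime_def
  proof (intro allI impI)
    fix g assume g: "poly_fun 4 g" and d: "\<forall>i<4. fun_dvd 4 g (\<lambda>x. u (\<sigma> i) (\<lambda>j. x (\<tau> j)))"
    let ?g = "\<lambda>x. g (\<lambda>j. x (\<sigma> j))"
    have pg: "poly_fun 4 (\<lambda>x. q (\<lambda>j. x (\<sigma> j)))" if "poly_fun 4 q" for q
      using st by (intro poly_fun_compose[OF that] poly_fun_var) auto
    have "fun_dvd 4 ?g (u i)" if i: "i < 4" for i
    proof -
      obtain q where q: "poly_fun 4 q" "\<And>x. u (\<sigma> (\<tau> i)) (\<lambda>j. x (\<tau> j)) = g x * q x"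
        using d st[OF i] unfolding fun_dvd_def by blast
      have "u i x = ?g x * q (\<lambda>j. x (\<sigma> j))" for x
        using q(2)[of "\<lambda>j. x (\<sigma> j)"] st[OF i] back_eq[OF i, of x] by simp
      then show ?thesis unfolding fun_dvd_def using pg[OF q(1)] by blast
    qed
    then obtain c where c: "\<And>x. ?g x = c" using cop pg[OF g] unfolding fun_coprime_def by blast
    have "g x = c" for x
    proof -
      have "g x = g (\<lambda>j. (\<lambda>j. x (\<tau> j)) (\<sigma> j))"
        by (rule poly_fun_cong_coords[OF g]) (use st in auto)
      then show ?thesis using c[of "\<lambda>j. x (\<tau> j)"] by simp
    qed
    then show "\<exists>c. \<forall>x. g x = c" by blast
  qed
qed

lemma elimination_relation:
  obtains r where "poly_fun 3 r" "\<exists>z. r z \<noteq> 0" "\<And>z. (\<And>i. i < 4 \<Longrightarrow> u i z = 0) \<Longrightarrow> r z = 0"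
proof -
  obtain p r where "poly_fun 3 r" "\<exists>x. r x \<noteq> 0" "\<And>x. r x = (\<Sum>i<4. p i x * u i x)"
    using eliminate_last_variable[OF u nz cop] by blast
  then show ?thesis by (intro that[of r]) auto
qed

lemma homogeneous_relation:
  obtains r k where "poly_fun 3 r" "\<exists>z. r z \<noteq> 0" "homog_fun k r"
    "\<And>z. (\<And>i. i < 4 \<Longrightarrow> u i z = 0) \<Longrightarrow> r z = 0"
proof -
  obtain r where r: "poly_fun 3 r" "\<exists>z. r z \<noteq> 0" "\<And>z. (\<And>i. i < 4 \<Longrightarrow> u i z = 0) \<Longrightarrow> r z = 0"
    using elimination_relation by blast
  obtain F k where F: "\<And>j. poly_fun 3 (F j)" "\<And>j. homog_fun j (F j)" "\<And>x. r x = (\<Sum>j\<le>k. F j x)"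
    using poly_fun_components[OF r(1)] by blast
  obtain y where "(\<Sum>j\<le>k. F j y) \<noteq> 0" using r(2) F(3) by metis
  then obtain j where j: "j \<le> k" "F j y \<noteq> 0" by (meson atMost_iff sum.neutral)
  show ?thesis
  proof (rule that)
    show "poly_fun 3 (F j)" using F(1)[of j] by auto
    show "\<exists>z. F j z \<noteq> 0" using j by blast
    show "homog_fun j (F j)" by (rule F(2))
    fix z assume z: "\<And>i. i < 4 \<Longrightarrow> u i z = 0"
    show "F j z = 0"
    proof (rule homog_component_zero[OF F(2) _ j(1)])
      fix t
      have "r (\<lambda>i. t * z i) = 0" by (rule r(3)) (simp add: scale z)
      then show "(\<Sum>j\<le>k. F j (\<lambda>i. t * z i)) = 0" by (simp add: F(3))
    qed
  qed
qed

text \<open>The image of \<open>u\<close> lies in its zero set, so a relation satisfied by that zero set holds between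
  coordinates of \<open>u\<close>. For \<open>w = 3\<close> the last two coordinates are exchanged before the elimination.\<close>

lemma image_relation:
  assumes "w = 2 \<or> w = 3"
  obtains r k where "poly_fun 3 r" "\<exists>z. r z \<noteq> 0" "homog_fun k r"
    "\<And>x. r (\<lambda>i. if i = 0 then u 0 x else if i = 1 then u 1 x else u w x) = 0"
proof -
  define \<sigma> :: "nat \<Rightarrow> nat" where "\<sigma> = (if w = 2 then id else transpose 2 3)"
  interpret v: straight_homogeneous_field "\<lambda>i x. u (\<sigma> i) (\<lambda>j. x (\<sigma> j))" e
    by (rule permute_coordinates) (auto simp: \<sigma>_def transpose_def)
  have inv: "\<sigma> (\<sigma> i) = i" for i by (simp add: \<sigma>_def)
  obtain r k where r: "poly_fun 3 r" "\<exists>z. r z \<noteq> 0" "homog_fun k r"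
    "\<And>z. (\<And>i. i < 4 \<Longrightarrow> u (\<sigma> i) (\<lambda>j. z (\<sigma> j)) = 0) \<Longrightarrow> r z = 0"
    using v.homogeneous_relation by blast
  have "r (\<lambda>i. if i = 0 then u 0 x else if i = 1 then u 1 x else u w x) = 0" for x
  proof -
    have "r (\<lambda>i. u (\<sigma> i) x) = 0"
    proof (rule r(4))
      fix i :: nat assume "i < 4"
      then have "\<sigma> i < 4" by (auto simp: \<sigma>_def transpose_def)
      then show "u (\<sigma> i) (\<lambda>j. u (\<sigma> (\<sigma> j)) x) = 0" by (simp add: inv zero_at_image)
    qed
    moreover have "r (\<lambda>i. if i = 0 then u 0 x else if i = 1 then u 1 x else u w x) = r (\<lambda>i. u (\<sigma> i) x)"
      by (rule poly_fun_cong_coords[OF r(1)]) (use assms in \<open>auto simp: \<sigma>_def transpose_def numeral_3_eq_3 less_Suc_eq\<close>)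
    ultimately show ?thesis by simp
  qed
  then show ?thesis using r that by blast
qed

text \<open>Two linearly independent forms of the same positive degree are algebraically independent: every multiple of a
  value \<open>u x\<close> is again a value, so a relation holds for each of its homogeneous components, and binary forms
  split into linear factors.\<close>

lemma binary_form_nonzero_on_image:
  assumes ind: "\<And>\<alpha> \<beta>. (\<And>x. \<alpha> * u 0 x + \<beta> * u 1 x = 0) \<Longrightarrow> \<alpha> = 0 \<and> \<beta> = 0"
    and r: "poly_fun 2 r" "r z \<noteq> 0"
  shows "\<exists>x. r (\<lambda>i. if i = 0 then u 0 x else u 1 x) \<noteq> 0"
proof (rule ccontr)
  assume "\<not> ?thesis"
  then have 0: "r (\<lambda>i. if i = 0 then u 0 x else u 1 x) = 0" for x by blast
  obtain F k where F: "\<And>j. poly_fun 2 (F j)" "\<And>j. homog_fun j (F j)" "\<And>x. r x = (\<Sum>j\<le>k. F j x)"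
    using poly_fun_components[OF r(1)] by blast
  obtain j where j: "j \<le> k" "F j z \<noteq> 0" using r(2) F(3) by (metis atMost_iff sum.neutral)
  have "F j (\<lambda>i. if i = 0 then u 0 x else u 1 x) = 0" for x
  proof (rule homog_component_zero[OF F(2) _ j(1)])
    fix s
    obtain t where t: "\<And>i. i < 4 \<Longrightarrow> u i (\<lambda>j. t * x j) = s * u i x" using scale_image by blast
    have "(\<lambda>i. s * (if i = 0 then u 0 x else u 1 x)) =
      (\<lambda>i::nat. if i = 0 then u 0 (\<lambda>j. t * x j) else u 1 (\<lambda>j. t * x j))"
      by (auto simp: t)
    then have "r (\<lambda>i. s * (if i = 0 then u 0 x else u 1 x)) = 0" using 0 by simp
    then show "(\<Sum>j\<le>k. F j (\<lambda>i. s * (if i = 0 then u 0 x else u 1 x))) = 0" by (simp add: F(3))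
  qed
  then have "\<exists>\<alpha> \<beta>. (\<alpha> \<noteq> 0 \<or> \<beta> \<noteq> 0) \<and> (\<forall>x. \<alpha> * u 0 x + \<beta> * u 1 x = 0)"
    using F(1)[of j] j(2) by (intro binary_relation[where r = "F j" and n = 4, OF _ F(2)] u) auto
  then show False using ind by blast
qed

text \<open>Let \<open>p = u(a)\<close>. Modulo the prime \<open>f\<close> one has \<open>u\<^sub>1 \<equiv> (p\<^sub>1/p\<^sub>0) u\<^sub>0\<close>. In the relation
  \<open>r(u\<^sub>0, u\<^sub>1, u\<^sub>w) = 0\<close> this leaves a binary form in \<open>u\<^sub>0\<close> and \<open>u\<^sub>w\<close>, which splits into factors
  \<open>p\<^sub>0 u\<^sub>w - \<gamma> u\<^sub>0\<close>; since \<open>f\<close> is prime it divides one of them, and evaluation at \<open>a\<close> gives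
  \<open>\<gamma> = p\<^sub>w\<close>. The polynomial \<open>N\<close> describes the points \<open>a\<close> at which \<open>p\<^sub>0\<close> or the binary form degenerates.\<close>

lemma prime_divisor_third_coordinate:
  assumes ind: "\<And>\<alpha> \<beta>. (\<And>x. \<alpha> * u 0 x + \<beta> * u 1 x = 0) \<Longrightarrow> \<alpha> = 0 \<and> \<beta> = 0"
    and w: "w = 2 \<or> w = 3"
  obtains N where "poly_fun 4 N" "\<exists>x. N x \<noteq> 0"
    "\<And>a f. N a \<noteq> 0 \<Longrightarrow> poly_fun 4 f \<Longrightarrow> fun_prime 4 f \<Longrightarrow> f a = 0 \<Longrightarrow>
       fun_dvd 4 f (\<lambda>x. u 0 a * u 1 x - u 1 a * u 0 x) \<Longrightarrow>
       fun_dvd 4 f (\<lambda>x. u 0 a * u w x - u w a * u 0 x)"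
proof -
  obtain r k where r: "poly_fun 3 r" "\<exists>z. r z \<noteq> 0" "homog_fun k r"
    "\<And>x. r (\<lambda>i. if i = 0 then u 0 x else if i = 1 then u 1 x else u w x) = 0"
    using image_relation[OF w] by blast
  have w4: "w < 4" using w by auto
  obtain m where "poly_fun_le 3 m r" using r(1) by (auto simp: poly_fun_def)
  then have "poly_fun_le (Suc 2) m r" by (simp add: numeral_3_eq_3 numeral_2_eq_2)
  then obtain F where F: "\<And>j. poly_fun_le 2 m (F j)" "\<And>x. r x = (\<Sum>j\<le>m. F j x * x 2 ^ j)"
    using poly_fun_le_last_variable by blast
  have "\<exists>j\<le>m. \<exists>z. F j z \<noteq> 0"
  proof (rule ccontr)
    assume "\<not> ?thesis"
    then have "r z = 0" for z using F(2) by simp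
    then show False using r(2) by blast
  qed
  then obtain j z where j: "j \<le> m" "F j z \<noteq> 0" by blast
  define G where "G x = F j (\<lambda>i. if i = 0 then u 0 x else u 1 x)" for x
  have F2: "poly_fun 2 (F j)" for j using F(1)[of j] by auto
  have "\<exists>x. G x \<noteq> 0" unfolding G_def by (rule binary_form_nonzero_on_image[OF ind F2 j(2)])
  moreover have G: "poly_fun 4 G" unfolding G_def
    by (rule poly_fun_compose[OF F2]) (intro poly_fun_if u; simp)
  moreover have u0: "\<exists>x. u 0 x \<noteq> 0" using ind[of 1 0] by auto
  ultimately have "\<exists>x. G x * u 0 x \<noteq> 0"
    using poly_fun_common_nonzero[OF G u[of 0]] by auto
  show ?thesis
  proof (rule that[of "\<lambda>x. G x * u 0 x"])
    show "poly_fun 4 (\<lambda>x. G x * u 0 x)" using G u by auto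
    show "\<exists>x. G x * u 0 x \<noteq> 0" by fact
    fix a f
    assume "G a * u 0 a \<noteq> 0" and f: "poly_fun 4 f" "fun_prime 4 f" "f a = 0"
      and d: "fun_dvd 4 f (\<lambda>x. u 0 a * u 1 x - u 1 a * u 0 x)"
    then have Ga: "G a \<noteq> 0" and p0: "u 0 a \<noteq> 0" by auto
    \<comment> \<open>The dehomogenized binary form \<open>r(p\<^sub>0, p\<^sub>1, t)\<close>; \<open>A\<close> consists of its roots.\<close>
    define b where "b = (\<Sum>j\<le>m. monom (F j (\<lambda>i. if i = 0 then u 0 a else u 1 a)) j)"
    have b: "poly b t = r (\<lambda>i. if i = 0 then u 0 a else if i = 1 then u 1 a else t)" for t
    proof -
      have "F j (\<lambda>i. if i = 0 then u 0 a else if i = 1 then u 1 a else t) = F j (\<lambda>i. if i = 0 then u 0 a else u 1 a)" for j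
        by (rule poly_fun_cong_coords[OF F2]) auto
      then show ?thesis by (simp add: b_def F(2) poly_sum poly_monom)
    qed
    have "coeff b j \<noteq> 0" using Ga j(1) by (simp add: b_def coeff_sum G_def)
    then have "b \<noteq> 0" by auto
    obtain A where A: "size A = degree b" "b = smult (lead_coeff b) (\<Prod>x\<in>#A. [:- x, 1:])"
      using alg_closed_imp_factorization[OF \<open>b \<noteq> 0\<close>] by blast
    have lc: "lead_coeff b \<noteq> 0" using \<open>b \<noteq> 0\<close> by simp
    define L where "L \<gamma> x = u 0 a * u w x - \<gamma> * u 0 x" for \<gamma> x
    have L: "poly_fun 4 (L \<gamma>)" for \<gamma> unfolding L_def using u[of 0] u[OF w4] by (intro poly_fun_diff poly_fun_cmult) auto
    have polyb: "y ^ size A * poly b (t / y) = lead_coeff b * (\<Prod>\<gamma>\<in>#A. t - \<gamma> * y)" if "y \<noteq> 0" for t y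
    proof -
      have "poly (\<Prod>x\<in>#M. [:- x, 1:]) (t / y) * y ^ size M = (\<Prod>\<gamma>\<in>#M. t - \<gamma> * y)" for M
        using that by (induction M) (auto simp: field_simps)
      then show ?thesis by (subst A(2)) (simp add: mult_ac)
    qed
    define H where "H x = r (\<lambda>i. if i = 0 then u 0 a * u 0 x else if i = 1 then u 1 a * u 0 x else u 0 a * u w x)" for x
    \<comment> \<open>\<open>H\<close> differs from \<open>p\<^sub>0\<^sup>k r(u\<^sub>0, u\<^sub>1, u\<^sub>w) = 0\<close> only by the replacement of \<open>p\<^sub>0 u\<^sub>1\<close> by \<open>p\<^sub>1 u\<^sub>0\<close>,
      and \<open>f\<close> divides the difference of these.\<close>
    have dH: "fun_dvd 4 f H"
    proof -
      define c where "c i x = (if i = 0 then u 0 a * u 0 x else if i = 1 then u 0 a * u 1 x else u 0 a * u w x)" for i :: nat and x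
      define c' where "c' i x = (if i = 0 then u 0 a * u 0 x else if i = 1 then u 1 a * u 0 x else u 0 a * u w x)" for i :: nat and x
      have c: "poly_fun 4 (c i)" "poly_fun 4 (c' i)" for i
        unfolding c_def c'_def using u[of 0] u[of 1] u[OF w4]
        by (cases "i = 0"; cases "i = 1"; auto intro: poly_fun_cmult)+
      have "fun_dvd 4 f (\<lambda>x. c i x - c' i x)" for i
        unfolding c_def c'_def using d fun_dvd_0 by (cases "i = 0"; cases "i = 1"; simp)
      then have "fun_dvd 4 f (\<lambda>x. r (\<lambda>i. c i x) - r (\<lambda>i. c' i x))"
        by (intro fun_dvd_composition_diff[OF r(1)] c)
      moreover have "r (\<lambda>i. c i x) = 0" for x
      proof -
        have "(\<lambda>i. c i x) = (\<lambda>i. u 0 a * (if i = 0 then u 0 x else if i = 1 then u 1 x else u w x))"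
          by (auto simp: c_def)
        then show ?thesis using homog_funD[OF r(3)] r(4)[of x] by simp
      qed
      moreover have "(\<lambda>x. r (\<lambda>i. c' i x)) = H" by (simp add: H_def c'_def fun_eq_iff)
      ultimately have "fun_dvd 4 f (\<lambda>x. - H x)" by (metis (no_types, lifting) ext diff_0)
      then have "fun_dvd 4 f (\<lambda>x. - 1 * - H x)" by (rule fun_dvd_mult_right) simp
      then show ?thesis by simp
    qed
    have Hpf: "poly_fun 4 H" unfolding H_def
      by (rule poly_fun_compose[OF r(1)]) (use u[of 0] u[OF w4] in \<open>auto intro!: poly_fun_if poly_fun_cmult\<close>)
    have Lprod: "poly_fun 4 (\<lambda>x. lead_coeff b * (\<Prod>\<gamma>\<in>#A. L \<gamma> x))"
    proof -
      have "poly_fun 4 (\<lambda>x. \<Prod>\<gamma>\<in>#M. L \<gamma> x)" for M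
        by (induction M) (auto intro: poly_fun_mult L)
      then show ?thesis by (rule poly_fun_cmult)
    qed
    \<comment> \<open>The powers of \<open>u\<^sub>0\<close> clear the denominators that arise from \<open>t = p\<^sub>0 u\<^sub>w / u\<^sub>0\<close>.\<close>
    have key: "u 0 x ^ size A * H x = u 0 x ^ k * (lead_coeff b * (\<Prod>\<gamma>\<in>#A. L \<gamma> x))" for x
    proof -
      have "u 0 x ^ size A * H x - u 0 x ^ k * (lead_coeff b * (\<Prod>\<gamma>\<in>#A. L \<gamma> x)) = 0"
      proof (rule poly_fun_cancel[where f = "u 0" and n = 4 and
            g = "\<lambda>x. u 0 x ^ size A * H x - u 0 x ^ k * (lead_coeff b * (\<Prod>\<gamma>\<in>#A. L \<gamma> x))"])
        show "poly_fun 4 (\<lambda>x. u 0 x ^ size A * H x - u 0 x ^ k * (lead_coeff b * (\<Prod>\<gamma>\<in>#A. L \<gamma> x)))"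
          using u[of 0] by (intro poly_fun_diff poly_fun_mult[OF _ Hpf] poly_fun_mult[OF _ Lprod] poly_fun_power) auto
        show "u 0 a \<noteq> 0" by fact
        fix x assume x: "u 0 x \<noteq> 0"
        have "(\<lambda>i. if i = 0 then u 0 a * u 0 x else if i = 1 then u 1 a * u 0 x else u 0 a * u w x) =
          (\<lambda>i::nat. u 0 x * (if i = 0 then u 0 a else if i = 1 then u 1 a else u 0 a * u w x / u 0 x))"
          using x by auto
        then have "H x = u 0 x ^ k * poly b (u 0 a * u w x / u 0 x)"
          unfolding H_def b using homog_funD[OF r(3)] by simp
        then show "u 0 x ^ size A * H x - u 0 x ^ k * (lead_coeff b * (\<Prod>\<gamma>\<in>#A. L \<gamma> x)) = 0"
          using polyb[OF x, of "u 0 a * u w x"] by (simp add: L_def mult.left_commute)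
      qed (use u[of 0] in auto)
      then show ?thesis by simp
    qed
    have "fun_dvd 4 f (\<lambda>x. u 0 x ^ size A * H x)"
      by (rule fun_dvd_mult_right[OF dH]) (use u[of 0] in auto)
    then have "fun_dvd 4 f (\<lambda>x. u 0 x ^ k * (lead_coeff b * (\<Prod>\<gamma>\<in>#A. L \<gamma> x)))" by (simp only: key)
    then have "fun_dvd 4 f (u 0) \<or> fun_dvd 4 f (\<lambda>x. lead_coeff b * (\<Prod>\<gamma>\<in>#A. L \<gamma> x))"
      using fun_prime_dvd_power[OF f(2) _ Lprod] u[of 0] by auto
    moreover have "\<not> fun_dvd 4 f (u 0)" using fun_dvd_imp_zero f(3) p0 by blast
    ultimately have "fun_dvd 4 f (\<lambda>_. lead_coeff b) \<or> (\<exists>\<gamma>. fun_dvd 4 f (L \<gamma>))"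
      using fun_prime_dvd_prod_mset[where a = L, OF f(2) L] by blast
    moreover have "\<not> fun_dvd 4 f (\<lambda>_. lead_coeff b)" using fun_dvd_imp_zero[of 4 f _ a] f(3) lc by blast
    ultimately obtain \<gamma> where \<gamma>: "fun_dvd 4 f (L \<gamma>)" by blast
    then have "L \<gamma> a = 0" using fun_dvd_imp_zero f(3) by blast
    then have "\<gamma> = u w a" using p0 by (simp add: L_def)
    then show "fun_dvd 4 f (\<lambda>x. u 0 a * u w x - u w a * u 0 x)" using \<gamma> by (simp add: L_def[abs_def])
  qed
qed

text \<open>The zero set of this polynomial contains the fibre of \<open>u\<close> (as a map to projective space) through \<open>a\<close>.\<close>

lemma fibre_polynomial:
  assumes ind: "\<And>\<alpha> \<beta>. (\<And>x. \<alpha> * u 0 x + \<beta> * u 1 x = 0) \<Longrightarrow> \<alpha> = 0 \<and> \<beta> = 0" and "u 0 a \<noteq> 0"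
  shows "poly_fun 4 (\<lambda>x. u 0 a * u 1 x - u 1 a * u 0 x)" "\<exists>z. u 0 a * u 1 z - u 1 a * u 0 z \<noteq> 0"
proof -
  show "poly_fun 4 (\<lambda>x. u 0 a * u 1 x - u 1 a * u 0 x)"
    using u[of 0] u[of 1] by (intro poly_fun_diff poly_fun_cmult) auto
  show "\<exists>z. u 0 a * u 1 z - u 1 a * u 0 z \<noteq> 0"
  proof (rule ccontr)
    assume "\<not> ?thesis"
    then have "\<And>x. (- u 1 a) * u 0 x + u 0 a * u 1 x = 0" by (auto simp: algebra_simps)
    from ind[OF this] show False using assms(2) by simp
  qed
qed

text \<open>Here \<open>f = 0\<close> is a component through \<open>a\<close> of the fibre of \<open>u\<close>; put \<open>p = u(a)\<close>. As a factor of an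
  invariant, \<open>f\<close> is constant along \<open>u\<close>, so it vanishes on the image of \<open>u\<close>. Modulo \<open>f\<close> the field
  \<open>u\<close> is parallel to \<open>p\<close>, hence \<open>f\<close> divides \<open>u\<^sub>0\<close> times its derivative \<open>D\<close> in the direction \<open>p\<close>. As \<open>D\<close> has
  smaller degree than \<open>f\<close>, it vanishes: the hypersurface is a cone with vertex \<open>p\<close>, and so it contains the lines
  that join \<open>p\<close> to the image.\<close>

lemma secant_proportional:
  assumes ind: "\<And>\<alpha> \<beta>. (\<And>x. \<alpha> * u 0 x + \<beta> * u 1 x = 0) \<Longrightarrow> \<alpha> = 0 \<and> \<beta> = 0"
    and f: "poly_fun 4 f" "fun_prime 4 f" "f a = 0" and p0: "u 0 a \<noteq> 0"
    and d: "\<And>i. i < 4 \<Longrightarrow> fun_dvd 4 f (\<lambda>x. u 0 a * u i x - u i a * u 0 x)"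
    and i: "i < 4"
  shows "u 0 a * u i (\<lambda>j. u j y + s * u j a) = u i a * u 0 (\<lambda>j. u j y + s * u j a)"
proof -
  let ?P = "\<lambda>x. u 0 a * u 1 x - u 1 a * u 0 x"
  note P = fibre_polynomial(1)[OF ind p0]
  have Phom: "homog_fun e ?P" by (simp add: homog_fun_def scale algebra_simps)
  obtain z where z: "?P z \<noteq> 0" using fibre_polynomial(2)[OF ind p0] by blast
  obtain q where q: "poly_fun 4 q" "\<And>x. ?P x = f x * q x" using d[of 1] unfolding fun_dvd_def by auto
  obtain m where m: "homog_fun m f" using homog_fun_factor[OF f(1) q(1) P Phom z q(2)] by blast
  have "m > 0"
  proof (rule ccontr)
    assume "\<not> m > 0"
    then have "f x = f a" for x
      using homog_funD[OF m, of 0 x] homog_funD[OF m, of 0 a] by simp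
    then show False using f(2,3) unfolding fun_prime_def by auto
  qed
  have inv: "f (\<lambda>i. x i + t * u i x) = f x" for x t
    by (rule factor_flow_invariant[where n = 4 and v = u and P = ?P and q = q and y = z])
      (use f(1) q P z in \<open>simp_all add: u flow\<close>)
  have f_image: "f (\<lambda>j. u j x) = 0" for x
    by (rule invariant_vanishes_on_field[where n = 4 and m = m and x = x]) (use f(1) m \<open>m > 0\<close> inv in auto)
  define D where "D x = (\<Sum>i<4. u i a * pd i f x)" for x
  have Dpf: "poly_fun 4 D" unfolding D_def using f(1) by (intro poly_fun_sum poly_fun_cmult poly_fun_pd)
  have "fun_dvd 4 f (\<lambda>x. u 0 x * D x)"
  proof -
    have "(\<Sum>i<4. pd i f x * (u 0 a * u i x - u i a * u 0 x)) = - (u 0 x * D x)" for x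
    proof -
      have "(\<Sum>i<4. pd i f x * (u 0 a * u i x - u i a * u 0 x)) =
        u 0 a * (\<Sum>i<4. u i x * pd i f x) - u 0 x * D x"
        by (simp add: D_def sum_distrib_left sum_subtractf[symmetric] algebra_simps)
      then show ?thesis using invariant_derivative_zero[where n = 4 and f = f and x = x and v = "\<lambda>i. u i x", OF f(1) inv] by simp
    qed
    moreover have "fun_dvd 4 f (\<lambda>x. \<Sum>i<4. pd i f x * (u 0 a * u i x - u i a * u 0 x))"
      using d f(1) by (intro fun_dvd_sum fun_dvd_mult_right) auto
    ultimately have "fun_dvd 4 f (\<lambda>x. - (u 0 x * D x))" by simp
    then have "fun_dvd 4 f (\<lambda>x. - 1 * - (u 0 x * D x))" by (rule fun_dvd_mult_right) simp
    then show ?thesis by simp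
  qed
  then have "fun_dvd 4 f (u 0) \<or> fun_dvd 4 f D"
    using f(2)[unfolded fun_prime_def, THEN conjunct2, rule_format, OF u[of 0] Dpf] by auto
  moreover have "\<not> fun_dvd 4 f (u 0)" using fun_dvd_imp_zero f(3) p0 by blast
  ultimately obtain h where h: "poly_fun 4 h" "\<And>x. D x = f x * h x" unfolding fun_dvd_def by blast
  have Dhom: "homog_fun (m - 1) D"
    unfolding D_def homog_fun_def
    by (auto simp: homog_funD[OF homog_fun_pd[OF f(1) m]] sum_distrib_left mult_ac)
  \<comment> \<open>On a ray, \<open>D\<close> has degree \<open>m - 1\<close> and is divisible by \<open>t\<^sup>m\<close>.\<close>
  have D0: "D x = 0" for x
  proof -
    obtain r where r: "\<And>t. h (\<lambda>i. t * x i) = poly r t" using poly_fun_restrict_ray[OF h(1)] by blast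
    have "monom (D x) (m - 1) = monom (f x) m * r"
    proof (rule complex_poly_ext)
      fix t
      have "t ^ (m - 1) * D x = D (\<lambda>i. t * x i)" using homog_funD[OF Dhom] by simp
      also have "\<dots> = t ^ m * f x * poly r t" by (simp add: h(2) r homog_funD[OF m])
      finally show "poly (monom (D x) (m - 1)) t = poly (monom (f x) m * r) t"
        by (simp add: poly_monom mult_ac)
    qed
    then have "coeff (monom (D x) (m - 1)) (m - 1) = coeff (monom (f x) m * r) (m - 1)" by simp
    then show ?thesis using \<open>m > 0\<close> by (simp add: coeff_monom_mult)
  qed
  have "f (\<lambda>j. u j y + s * u j a) = f (\<lambda>j. u j y)"
    by (rule derivative_zero_invariant[OF f(1)]) (use D0 in \<open>simp add: D_def\<close>)
  then have "f (\<lambda>j. u j y + s * u j a) = 0" using f_image by simp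
  from fun_dvd_imp_zero[OF d[OF i] this] show ?thesis by simp
qed

text \<open>On the line joining \<open>p = u(x)\<close> and \<open>q = u(y)\<close> the field is parallel to \<open>p\<close> and, by symmetry, to \<open>q\<close>, so it
  vanishes if these are independent. This holds for general \<open>x\<close> and \<open>y\<close>, therefore for all.\<close>

lemma secants_vanish:
  assumes ind: "\<And>\<alpha> \<beta>. (\<And>x. \<alpha> * u 0 x + \<beta> * u 1 x = 0) \<Longrightarrow> \<alpha> = 0 \<and> \<beta> = 0"
    and i: "i < 4"
  shows "u i (\<lambda>j. u j y + s * u j x) = 0"
proof -
  obtain N2 where N2: "poly_fun 4 N2" "\<exists>x. N2 x \<noteq> 0"
    "\<And>a f. N2 a \<noteq> 0 \<Longrightarrow> poly_fun 4 f \<Longrightarrow> fun_prime 4 f \<Longrightarrow> f a = 0 \<Longrightarrow>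
       fun_dvd 4 f (\<lambda>x. u 0 a * u 1 x - u 1 a * u 0 x) \<Longrightarrow>
       fun_dvd 4 f (\<lambda>x. u 0 a * u 2 x - u 2 a * u 0 x)"
    using prime_divisor_third_coordinate[OF ind, of 2] by auto
  obtain N3 where N3: "poly_fun 4 N3" "\<exists>x. N3 x \<noteq> 0"
    "\<And>a f. N3 a \<noteq> 0 \<Longrightarrow> poly_fun 4 f \<Longrightarrow> fun_prime 4 f \<Longrightarrow> f a = 0 \<Longrightarrow>
       fun_dvd 4 f (\<lambda>x. u 0 a * u 1 x - u 1 a * u 0 x) \<Longrightarrow>
       fun_dvd 4 f (\<lambda>x. u 0 a * u 3 x - u 3 a * u 0 x)"
    using prime_divisor_third_coordinate[OF ind, of 3] by auto
  \<comment> \<open>At points \<open>a\<close> where \<open>N\<close> does not vanish, a prime factor of \<open>u\<^sub>0(a) u\<^sub>1 - u\<^sub>1(a) u\<^sub>0\<close> divides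
    the analogous expressions for all coordinates.\<close>
  define N where "N x = u 0 x * (N2 x * N3 x)" for x
  have Npf: "poly_fun 4 N" unfolding N_def using u[of 0] N2(1) N3(1) by (intro poly_fun_mult) auto
  have Nnz: "\<exists>x. N x \<noteq> 0"
  proof -
    obtain x0 where "u 0 x0 \<noteq> 0" using ind[of 1 0] by auto
    moreover obtain x1 where "N2 x1 * N3 x1 \<noteq> 0" using poly_fun_common_nonzero[OF N2(1) N3(1)] N2(2) N3(2) by fastforce
    ultimately show ?thesis
      using poly_fun_common_nonzero[OF u[of 0] poly_fun_mult[OF N2(1) N3(1)]] unfolding N_def by fastforce
  qed
  have parallel: "u 0 a * u i (\<lambda>j. u j y + s * u j a) = u i a * u 0 (\<lambda>j. u j y + s * u j a)"
    if a: "N a \<noteq> 0" and i: "i < 4" for a y s i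
  proof -
    have nza: "u 0 a \<noteq> 0" "N2 a \<noteq> 0" "N3 a \<noteq> 0" using a by (auto simp: N_def)
    let ?P = "\<lambda>x. u 0 a * u 1 x - u 1 a * u 0 x"
    note P = fibre_polynomial(1)[OF ind nza(1)]
    obtain z where z: "?P z \<noteq> 0" using fibre_polynomial(2)[OF ind nza(1)] by blast
    have "?P a = 0" by simp
    then obtain f where f: "poly_fun 4 f" "f a = 0" "fun_dvd 4 f ?P" "fun_prime 4 f"
      using prime_factor_through_zero[OF P z] by blast
    have "fun_dvd 4 f (\<lambda>x. u 0 a * u j x - u j a * u 0 x)" if "j < 4" for j
    proof -
      have "j = 0 \<or> j = 1 \<or> j = 2 \<or> j = 3" using that by auto
      then show ?thesis
        using f(3) N2(3)[OF nza(2) f(1,4,2,3)] N3(3)[OF nza(3) f(1,4,2,3)] fun_dvd_0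
        by (elim disjE) (simp_all add: mult.commute)
    qed
    from secant_proportional[OF ind f(1,4,2) nza(1) this i] show ?thesis .
  qed
  have gen: "u i (\<lambda>j. u j y + s * u j x) = 0"
    if N: "N x \<noteq> 0" "N y \<noteq> 0" and \<delta>: "u 0 x * u 1 y - u 1 x * u 0 y \<noteq> 0" and i: "i < 4" for x y s i
  proof (cases "s = 0")
    case True
    then show ?thesis using zero_at_image[OF i, of y] by simp
  next
    case False
    let ?z = "\<lambda>j. u j y + s * u j x"
    \<comment> \<open>the same point, seen from \<open>u(x)\<close>\<close>
    have z: "?z = (\<lambda>j. s * (u j x + 1 / s * u j y))" using False by (auto simp: distrib_left add.commute)
    have py: "u 0 y * u j ?z = u j y * u 0 ?z" if "j < 4" for j
      unfolding z using parallel[OF N(2) that, of x "1 / s"] that by (simp add: scale)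
    have px: "u 0 x * u j ?z = u j x * u 0 ?z" if "j < 4" for j using parallel[OF N(1) that] .
    have "(u 0 x * u 1 y - u 1 x * u 0 y) * u 0 ?z = 0"
      by (rule cross_zero) (use px[of 1] py[of 1] in simp_all)
    then have "u 0 ?z = 0" using \<delta> by simp
    moreover have "u 0 x \<noteq> 0" using N by (auto simp: N_def)
    ultimately show ?thesis using px[OF i] by simp
  qed
  have pfy: "poly_fun 4 (\<lambda>y. u i (\<lambda>j. u j y + s * u j x))" for x s
    by (rule poly_fun_compose[OF u[OF i]]) (intro poly_fun_add poly_fun_const u; simp)
  have pfx: "poly_fun 4 (\<lambda>x. u i (\<lambda>j. u j y + s * u j x))" for y s
    by (rule poly_fun_compose[OF u[OF i]]) (intro poly_fun_add poly_fun_const poly_fun_cmult u; simp)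
  have half: "u i (\<lambda>j. u j y + s * u j x) = 0" if x: "N x \<noteq> 0" for x y s
  proof -
    let ?\<delta> = "\<lambda>y. u 0 x * u 1 y - u 1 x * u 0 y"
    have "u 0 x \<noteq> 0" using x by (auto simp: N_def)
    then have \<delta>: "poly_fun 4 ?\<delta>" "\<exists>z. ?\<delta> z \<noteq> 0"
      using fibre_polynomial[OF ind, of x] by blast+
    obtain z where z: "N z * ?\<delta> z \<noteq> 0" using Nnz \<delta>(2) poly_fun_common_nonzero[OF Npf \<delta>(1)] by fastforce
    show ?thesis
      by (rule poly_fun_cancel[where f = "\<lambda>z. N z * ?\<delta> z" and g = "\<lambda>y. u i (\<lambda>j. u j y + s * u j x)",
          OF poly_fun_mult[OF Npf \<delta>(1)] pfy _ z])
        (rule gen[OF x _ _ i]; simp)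
  qed
  obtain z where "N z \<noteq> 0" using Nnz by blast
  then show ?thesis
    using poly_fun_cancel[where f = N and g = "\<lambda>x. u i (\<lambda>j. u j y + s * u j x)" and a = z,
        OF Npf pfx] half by blast
qed

text \<open>By elimination some non-zero polynomial \<open>r\<close> in three variables vanishes on all secants; choose its degree
  minimal. The derivatives of \<open>r(u(y) + s u(x)) = 0\<close> in \<open>s\<close> and \<open>y\<close> say that the gradient of \<open>r\<close> at a point of
  a secant is orthogonal to \<open>u(x)\<close>, to the derivatives of \<open>u\<close> at \<open>y\<close>, and by Euler's identity to \<open>u(y)\<close>.
  If the three coordinates are independent, the determinant of \<open>u(x)\<close>, \<open>u(y)\<close> and some \<open>\<partial>\<^sub>k u(y)\<close> is not zero, so
  the partial derivatives of \<open>r\<close> vanish on all secants as well, contrary to minimality.\<close>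

lemma three_coordinates_dependent:
  "\<exists>c. (\<exists>i<3. c i \<noteq> 0) \<and> (\<forall>x. (\<Sum>i<3. c i * u i x) = 0)"
proof (rule ccontr)
  assume no: "\<not> ?thesis"
  have ind3: "c 0 = 0 \<and> c 1 = 0 \<and> c 2 = 0" if "\<And>x. c 0 * u 0 x + c 1 * u 1 x + c 2 * u 2 x = 0" for c :: "nat \<Rightarrow> complex"
  proof -
    have "\<forall>x. (\<Sum>i<3. c i * u i x) = 0" using that by (simp add: numeral_3_eq_3 numeral_2_eq_2)
    then have "\<not> (\<exists>i<3. c i \<noteq> 0)" using no by blast
    then show ?thesis by auto
  qed
  have ind: "\<alpha> = 0 \<and> \<beta> = 0" if "\<And>x. \<alpha> * u 0 x + \<beta> * u 1 x = 0" for \<alpha> \<beta>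
    using ind3[of "(\<lambda>_. 0)(0 := \<alpha>, 1 := \<beta>)"] that by simp
  note sec = secants_vanish[OF ind]
  obtain r0 z0 where r0: "poly_fun 3 r0" "r0 z0 \<noteq> 0" "\<And>z. (\<And>i. i < 4 \<Longrightarrow> u i z = 0) \<Longrightarrow> r0 z = 0"
    using elimination_relation by metis
  then have "\<forall>x y s. r0 (\<lambda>j. u j y + s * u j x) = 0" using sec by blast
  from minimal_vanishing_poly_fun[where P = "\<lambda>r. \<forall>x y s. r (\<lambda>j. u j y + s * u j x) = 0", OF r0(1,2) this]
  obtain k r where r: "poly_fun_le 3 k r" "\<exists>y. r y \<noteq> 0" "\<forall>x y s. r (\<lambda>j. u j y + s * u j x) = 0"
    and min: "\<And>T l. poly_fun_le 3 l T \<Longrightarrow> l < k \<Longrightarrow> \<forall>x y s. T (\<lambda>j. u j y + s * u j x) = 0 \<Longrightarrow> \<forall>y. T y = 0"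
    by blast
  have rpf: "poly_fun 3 r" using r(1) by auto
  have u3: "poly_fun 4 (u i)" if "i < 3" for i using u that by simp
  have sum3: "(\<Sum>i<3. a i) = a 0 + a 1 + a 2" for a :: "nat \<Rightarrow> complex"
    by (simp add: numeral_3_eq_3 numeral_2_eq_2)
  have d1: "(\<Sum>i<3. u i x * pd i r (\<lambda>j. u j y + s * u j x)) = 0" for x y s
  proof (rule invariant_derivative_zero[OF rpf])
    fix t
    have "(\<lambda>i. u i y + s * u i x + t * u i x) = (\<lambda>i. u i y + (s + t) * u i x)" by (simp add: algebra_simps)
    then show "r (\<lambda>i. u i y + s * u i x + t * u i x) = r (\<lambda>j. u j y + s * u j x)" using r(3) by simp
  qed
  have d2: "(\<Sum>i<3. pd k (u i) y * pd i r (\<lambda>j. u j y + s * u j x)) = 0" for x y s k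
  proof -
    have g: "poly_fun 4 (\<lambda>y. u i y + s * u i x)" if "i < 3" for i using u3[OF that] by auto
    have "0 = pd k (\<lambda>y. r (\<lambda>i. u i y + s * u i x)) y" using r(3) by simp
    also have "\<dots> = (\<Sum>i<3. pd k (\<lambda>y. u i y + s * u i x) y * pd i r (\<lambda>j. u j y + s * u j x))"
      by (rule pd_compose[OF rpf g])
    also have "\<dots> = (\<Sum>i<3. pd k (u i) y * pd i r (\<lambda>j. u j y + s * u j x))"
      by (intro sum.cong) (auto simp: pd_add[OF u3])
    finally show ?thesis by simp
  qed
  have d3: "(\<Sum>i<3. u i y * pd i r (\<lambda>j. u j y + s * u j x)) = 0" for x y s
  proof -
    have "of_nat e * (\<Sum>i<3. u i y * pd i r (\<lambda>j. u j y + s * u j x)) =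
       (\<Sum>i<3. (\<Sum>k<4. y k * pd k (u i) y) * pd i r (\<lambda>j. u j y + s * u j x))"
      unfolding sum_distrib_left
      by (intro sum.cong) (auto simp: homog_fun_euler[OF u hom])
    also have "\<dots> = (\<Sum>k<4. \<Sum>i<3. y k * pd k (u i) y * pd i r (\<lambda>j. u j y + s * u j x))"
      unfolding sum_distrib_right by (rule sum.swap)
    also have "\<dots> = (\<Sum>k<4. y k * (\<Sum>i<3. pd k (u i) y * pd i r (\<lambda>j. u j y + s * u j x)))"
      by (simp add: sum_distrib_left mult.assoc)
    also have "\<dots> = 0" by (simp add: d2)
    finally show ?thesis using e by simp
  qed
  have "\<exists>k<4. \<exists>y. u 0 y * pd k (u 1) y - u 1 y * pd k (u 0) y \<noteq> 0"
  proof (rule ccontr)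
    assume "\<not> ?thesis"
    then have "\<exists>\<alpha> \<beta>. (\<alpha> \<noteq> 0 \<or> \<beta> \<noteq> 0) \<and> (\<forall>x. \<alpha> * u 0 x + \<beta> * u 1 x = 0)"
      by (intro wronskian_zero_imp_dependent[of 4] u) auto
    then show False using ind by blast
  qed
  then obtain k1 y1 where y1: "u 0 y1 * pd k1 (u 1) y1 - u 1 y1 * pd k1 (u 0) y1 \<noteq> 0" by blast
  \<comment> \<open>the cross product of \<open>u(y)\<close> and \<open>\<partial>\<^sub>k u(y)\<close> for \<open>k = k1\<close>\<close>
  define C where "C y i = (if i = 0 then u 1 y * pd k1 (u 2) y - u 2 y * pd k1 (u 1) y
     else if i = 1 then u 2 y * pd k1 (u 0) y - u 0 y * pd k1 (u 2) y
     else u 0 y * pd k1 (u 1) y - u 1 y * pd k1 (u 0) y)" for y and i :: nat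
  define \<Delta> where "\<Delta> x y = C y 0 * u 0 x + C y 1 * u 1 x + C y 2 * u 2 x" for x y
  obtain x1 where x1: "\<Delta> x1 y1 \<noteq> 0"
    using ind3[of "C y1"] y1 unfolding \<Delta>_def by (auto simp: C_def)
  have Cpf: "poly_fun 4 (\<lambda>y. C y i)" for i
    unfolding C_def using u[of 0] u[of 1] u[of 2]
    by (cases "i = 0"; cases "i = 1"; auto intro!: poly_fun_diff poly_fun_mult poly_fun_pd)
  have \<Delta>y: "poly_fun 4 (\<lambda>y. \<Delta> x y)" for x
    unfolding \<Delta>_def by (intro poly_fun_add poly_fun_mult Cpf poly_fun_const)
  have \<Delta>x: "poly_fun 4 (\<lambda>x. \<Delta> x y)" for y
    unfolding \<Delta>_def by (intro poly_fun_add poly_fun_cmult u) auto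
  have \<Delta>_eq: "\<Delta> x y = (u 1 y * pd k1 (u 2) y - u 2 y * pd k1 (u 1) y) * u 0 x
      + (u 2 y * pd k1 (u 0) y - u 0 y * pd k1 (u 2) y) * u 1 x
      + (u 0 y * pd k1 (u 1) y - u 1 y * pd k1 (u 0) y) * u 2 x" for x y
    by (simp add: \<Delta>_def C_def)
  have cramer: "\<Delta> x y * pd i r (\<lambda>j. u j y + s * u j x) = 0" if i: "i < 3" for x y s i
  proof -
    let ?r = "\<lambda>i. pd i r (\<lambda>j. u j y + s * u j x)"
    have A: "u 0 x * ?r 0 + u 1 x * ?r 1 + u 2 x * ?r 2 = 0"
      and B: "pd k1 (u 0) y * ?r 0 + pd k1 (u 1) y * ?r 1 + pd k1 (u 2) y * ?r 2 = 0"
      and D: "u 0 y * ?r 0 + u 1 y * ?r 1 + u 2 y * ?r 2 = 0"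
      using d1[of x y s] d2[of k1 y s x] d3[of y s x] by (simp_all add: sum3)
    have "i = 0 \<or> i = 1 \<or> i = 2" using i by auto
    moreover note cramer_3[OF A B D]
    ultimately show ?thesis unfolding \<Delta>_eq by blast
  qed
  have van: "pd i r (\<lambda>j. u j y + s * u j x) = 0" if i: "i < 3" for x y s i
  proof -
    have pfy: "poly_fun 4 (\<lambda>y. pd i r (\<lambda>j. u j y + s * u j x))" for x
      by (rule poly_fun_compose[OF poly_fun_pd[OF rpf]]) (intro poly_fun_add poly_fun_const u; simp)
    have pfx: "poly_fun 4 (\<lambda>x. pd i r (\<lambda>j. u j y + s * u j x))" for y
      by (rule poly_fun_compose[OF poly_fun_pd[OF rpf]]) (intro poly_fun_add poly_fun_const poly_fun_cmult u; simp)
    have half: "pd i r (\<lambda>j. u j y + s * u j x) = 0" if x: "\<Delta> x y1 \<noteq> 0" for x y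
      by (rule poly_fun_cancel[where f = "\<lambda>y. \<Delta> x y" and g = "\<lambda>y. pd i r (\<lambda>j. u j y + s * u j x)", OF \<Delta>y pfy _ x])
        (use cramer[OF i, of x _ s] in auto)
    show ?thesis
      by (rule poly_fun_cancel[where f = "\<lambda>x. \<Delta> x y1" and g = "\<lambda>x. pd i r (\<lambda>j. u j y + s * u j x)", OF \<Delta>x pfx _ x1])
        (rule half)
  qed
  have "k > 0" using poly_fun_le_0[OF r(1)] r(2,3) by (cases k) auto
  have "pd i r y = 0" if "i < 3" for i y
    using min[OF poly_fun_le_pd[OF r(1), of i]] \<open>k > 0\<close> van[OF that] by simp
  then have "r x = r y" for x y by (intro poly_fun_pd_zero_imp_const[OF rpf])
  then show False using r(2,3) by metis
qed

lemma triple_dependent: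
  assumes "i < 4" "j < 4" "k < 4" "i \<noteq> j" "i \<noteq> k" "j \<noteq> k"
  obtains \<alpha> \<beta> \<gamma> where "\<alpha> \<noteq> 0 \<or> \<beta> \<noteq> 0 \<or> \<gamma> \<noteq> 0" "\<And>x. \<alpha> * u i x + \<beta> * u j x + \<gamma> * u k x = 0"
proof -
  obtain l where l: "l < 4" "l \<noteq> i" "l \<noteq> j" "l \<noteq> k"
  proof -
    have "card {i, j, k} < card {..<4::nat}" using assms by simp
    then have "\<not> {..<4} \<subseteq> {i, j, k}" by (meson card_mono finite.intros not_le)
    then show ?thesis using that by auto
  qed
  have all: "{i, j, k, l} = {..<4}"
    by (rule card_subset_eq) (use assms l in auto)
  define \<sigma> where "\<sigma> = (\<lambda>m::nat. if m = 0 then i else if m = 1 then j else if m = 2 then k else l)"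
  define \<tau> where "\<tau> = (\<lambda>m::nat. if m = i then 0 else if m = j then 1 else if m = k then 2 else (3::nat))"
  interpret v: straight_homogeneous_field "\<lambda>i x. u (\<sigma> i) (\<lambda>j. x (\<tau> j))" e
  proof (rule permute_coordinates)
    fix m :: nat assume m: "m < 4"
    have "m \<in> {i, j, k, l}" unfolding all using m by simp
    then have "m = i \<or> m = j \<or> m = k \<or> m = l" by blast
    then have "\<sigma> (\<tau> m) = m"
      using assms(4-6) l(2-4) not_sym[OF assms(4)] not_sym[OF assms(5)] not_sym[OF assms(6)]
      by (elim disjE) (simp_all add: \<sigma>_def \<tau>_def)
    moreover have "m = 0 \<or> m = 1 \<or> m = 2 \<or> m = 3" using m by auto
    then have "\<tau> (\<sigma> m) = m"
      using assms(4-6) l(2-4) not_sym[OF assms(4)] not_sym[OF assms(5)] not_sym[OF assms(6)]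
      by (elim disjE) (simp_all add: \<sigma>_def \<tau>_def)
    moreover have "\<sigma> m < 4" using assms(1-3) l(1) by (simp add: \<sigma>_def)
    moreover have "\<tau> m < 4" by (simp add: \<tau>_def)
    ultimately show "\<sigma> m < 4 \<and> \<tau> m < 4 \<and> \<sigma> (\<tau> m) = m \<and> \<tau> (\<sigma> m) = m" by blast
  qed
  obtain c where c: "\<exists>i<3. c i \<noteq> 0" "\<And>x. (\<Sum>i<3. c i * u (\<sigma> i) (\<lambda>j. x (\<tau> j))) = 0"
    using v.three_coordinates_dependent by blast
  have sum3: "(\<Sum>i<3. a i) = a 0 + a 1 + a 2" for a :: "nat \<Rightarrow> complex"
    by (simp add: numeral_3_eq_3 numeral_2_eq_2)
  have "c 0 * u i x + c 1 * u j x + c 2 * u k x = 0" for x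
  proof -
    have st: "m < 4 \<Longrightarrow> \<sigma> (\<tau> m) = m" for m
      using all[symmetric] by (auto simp: \<sigma>_def \<tau>_def)
    have "u m (\<lambda>j. x (\<sigma> (\<tau> j))) = u m x" if "m < 4" for m
      by (rule poly_fun_cong_coords[OF u[OF that]]) (simp add: st)
    then show ?thesis
      using c(2)[of "\<lambda>m. x (\<sigma> m)"] assms by (simp add: sum3 \<sigma>_def)
  qed
  moreover have "c 0 \<noteq> 0 \<or> c 1 \<noteq> 0 \<or> c 2 \<noteq> 0"
  proof -
    obtain m where "m < 3" "c m \<noteq> 0" using c(1) by blast
    moreover then have "m = 0 \<or> m = 1 \<or> m = 2" by auto
    ultimately show ?thesis by auto
  qed
  ultimately show ?thesis using that by blast
qed

end

section \<open>Homogeneous polynomials in four variables\<close>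

text \<open>Euler's identity turns \<open>u\<close> being in the kernel of the Hessian into \<open>u \<bullet> \<nabla>h = 0\<close>, and the derivatives of the latter give
  \<open>(\<partial>\<^sub>k u) \<bullet> \<nabla>h = 0\<close>. Since any three coordinates of \<open>u\<close> are dependent, \<open>u\<close> is a combination of at most two
  constant vectors, \<open>u = a c + b c'\<close>. With \<open>A = c \<bullet> \<nabla>h\<close> and \<open>B = c' \<bullet> \<nabla>h\<close> the equations read
  \<open>a A + b B = 0\<close> and \<open>(\<partial>\<^sub>k a) A + (\<partial>\<^sub>k b) B = 0\<close>; if \<open>u\<close> has no constant direction, their
  determinant is a Wronskian of independent functions.\<close>

lemma straight_kernel_field_imp_constant_kernel:
  assumes h: "poly_fun 4 h" "homog_fun d h" "d \<ge> 2"
    and field: "straight_homogeneous_field u e"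
    and ker: "\<And>l x. (\<Sum>j<4. u j x * pd j (pd l h) x) = 0"
  shows "\<exists>c. (\<exists>i<4. c i \<noteq> 0) \<and> (\<forall>x. (\<Sum>i<4. c i * pd i h x) = 0)"
proof -
  interpret straight_homogeneous_field u e by (rule field)
  have uh: "(\<Sum>j<4. u j x * pd j h x) = 0" for x
  proof -
    have euler: "(\<Sum>l<4. x l * pd l (pd j h) x) = of_nat (d - 1) * pd j h x" for j
      by (rule homog_fun_euler[OF poly_fun_pd[OF h(1)] homog_fun_pd[OF h(1,2)]])
    have "of_nat (d - 1) * (\<Sum>j<4. u j x * pd j h x) = (\<Sum>j<4. u j x * (\<Sum>l<4. x l * pd l (pd j h) x))"
      unfolding euler by (simp add: sum_distrib_left mult.left_commute)
    also have "\<dots> = (\<Sum>l<4. x l * (\<Sum>j<4. u j x * pd j (pd l h) x))"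
      unfolding sum_distrib_left
      by (subst sum.swap) (simp add: mult.left_commute pd_commute[OF h(1)])
    also have "\<dots> = 0" by (simp add: ker)
    finally show ?thesis using h(3) by simp
  qed
  have duh: "(\<Sum>j<4. pd k (u j) x * pd j h x) = 0" for k x
  proof -
    have "0 = pd k (\<lambda>x. \<Sum>j<4. u j x * pd j h x) x" using uh by simp
    also have "\<dots> = (\<Sum>j<4. u j x * pd k (pd j h) x + pd k (u j) x * pd j h x)"
      by (subst pd_sum[of _ 4]) (auto intro!: poly_fun_mult u poly_fun_pd h(1) sum.cong simp: pd_mult[OF u poly_fun_pd[OF h(1)]])
    also have "\<dots> = (\<Sum>j<4. u j x * pd j (pd k h) x) + (\<Sum>j<4. pd k (u j) x * pd j h x)"
      by (simp add: sum.distrib pd_commute[OF h(1), of k])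
    finally show ?thesis by (simp add: ker)
  qed
  obtain i0 z0 where i0: "i0 < 4" "u i0 z0 \<noteq> 0" using nz by blast
  let ?a = "u i0"
  show ?thesis
  proof (cases "\<exists>j0<4. \<forall>\<alpha> \<beta>. (\<forall>x. \<alpha> * ?a x + \<beta> * u j0 x = 0) \<longrightarrow> \<alpha> = 0 \<and> \<beta> = 0")
    case False
    have "\<forall>j. \<exists>\<gamma>. j < 4 \<longrightarrow> (\<forall>x. u j x = \<gamma> * ?a x)"
    proof (intro allI)
      fix j
      show "\<exists>\<gamma>. j < 4 \<longrightarrow> (\<forall>x. u j x = \<gamma> * ?a x)"
      proof (cases "j < 4")
        case True
        then obtain \<alpha> \<beta> where ab: "\<And>x. \<alpha> * ?a x + \<beta> * u j x = 0" "\<not> (\<alpha> = 0 \<and> \<beta> = 0)" using False by blast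
        have "\<beta> \<noteq> 0" using ab(1)[of z0] ab(2) i0(2) by auto
        then have "u j x = (- \<alpha> / \<beta>) * ?a x" for x
          using ab(1)[of x] by (simp add: field_simps eq_neg_iff_add_eq_0)
        then show ?thesis by blast
      qed auto
    qed
    from choice[OF this] obtain c where c: "\<And>j x. j < 4 \<Longrightarrow> u j x = c j * ?a x" by blast
    have "(\<Sum>i<4. c i * pd i h x) = 0" for x
    proof (rule poly_fun_cancel[where f = ?a and g = "\<lambda>x. \<Sum>i<4. c i * pd i h x", OF u[OF i0(1)] _ _ i0(2)])
      fix x assume "?a x \<noteq> 0"
      moreover have "?a x * (\<Sum>i<4. c i * pd i h x) = (\<Sum>j<4. u j x * pd j h x)"
        unfolding sum_distrib_left by (rule sum.cong) (auto simp: c[of _ x])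
      ultimately show "(\<Sum>i<4. c i * pd i h x) = 0" using uh by simp
    qed (intro poly_fun_sum poly_fun_cmult poly_fun_pd h(1))
    moreover have "c i0 \<noteq> 0" using c[OF i0(1), of z0] i0(2) by auto
    ultimately show ?thesis using i0(1) by blast
  next
    case True
    then obtain j0 where j0: "j0 < 4"
      and ind: "\<And>\<alpha> \<beta>. (\<And>x. \<alpha> * ?a x + \<beta> * u j0 x = 0) \<Longrightarrow> \<alpha> = 0 \<and> \<beta> = 0" by blast
    let ?b = "u j0"
    have ij: "i0 \<noteq> j0" using ind[of 1 "-1"] by auto
    have "\<forall>j. \<exists>\<alpha> \<beta>. j < 4 \<longrightarrow> (\<forall>x. u j x = \<alpha> * ?a x + \<beta> * ?b x)"
    proof
      fix j
      show "\<exists>\<alpha> \<beta>. j < 4 \<longrightarrow> (\<forall>x. u j x = \<alpha> * ?a x + \<beta> * ?b x)"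
      proof (cases "j < 4 \<and> j \<noteq> i0 \<and> j \<noteq> j0")
        case True
        then obtain \<alpha> \<beta> \<gamma> where r: "\<alpha> \<noteq> 0 \<or> \<beta> \<noteq> 0 \<or> \<gamma> \<noteq> 0" "\<And>x. \<alpha> * ?a x + \<beta> * ?b x + \<gamma> * u j x = 0"
          using triple_dependent[of i0 j0 j] i0 j0 ij by metis
        have "\<gamma> \<noteq> 0" using r ind[of \<alpha> \<beta>] by auto
        have "u j x = (- \<alpha> / \<gamma>) * ?a x + (- \<beta> / \<gamma>) * ?b x" for x
        proof -
          have "\<gamma> * u j x = - \<alpha> * ?a x - \<beta> * ?b x" using r(2)[of x] by (simp add: algebra_simps eq_neg_iff_add_eq_0)
          then show ?thesis using \<open>\<gamma> \<noteq> 0\<close> by (simp add: field_simps)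
        qed
        then show ?thesis by blast
      next
        case False
        then consider "\<not> j < 4" | "j = i0" | "j = j0" by blast
        then show ?thesis
        proof cases
          case 2
          then show ?thesis by (intro exI[of _ 1] exI[of _ 0]) simp
        next
          case 3
          then show ?thesis by (intro exI[of _ 0] exI[of _ 1]) simp
        qed simp
      qed
    qed
    from choice[OF this] obtain c where "\<forall>j. \<exists>\<beta>. j < 4 \<longrightarrow> (\<forall>x. u j x = c j * ?a x + \<beta> * ?b x)" by blast
    from choice[OF this] obtain c' where c: "\<And>j x. j < 4 \<Longrightarrow> u j x = c j * ?a x + c' j * ?b x" by blast
    define A where "A x = (\<Sum>i<4. c i * pd i h x)" for x
    define B where "B x = (\<Sum>i<4. c' i * pd i h x)" for x
    have Apf: "poly_fun 4 A" unfolding A_def by (intro poly_fun_sum poly_fun_cmult poly_fun_pd h(1))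
    have AB: "A x * ?a x + B x * ?b x = 0" for x
    proof -
      have "A x * ?a x + B x * ?b x = (\<Sum>j<4. u j x * pd j h x)"
        unfolding A_def B_def sum_distrib_right sum.distrib[symmetric]
        by (rule sum.cong) (auto simp: c[of _ x] algebra_simps)
      then show ?thesis using uh by simp
    qed
    have dAB: "A x * pd k ?a x + B x * pd k ?b x = 0" for k x
    proof -
      have "pd k (u j) x = c j * pd k ?a x + c' j * pd k ?b x" if "j < 4" for j
      proof -
        have "u j = (\<lambda>x. c j * ?a x + c' j * ?b x)" using c[OF that] by blast
        then show ?thesis
          using pd_add[OF poly_fun_cmult[OF u[OF i0(1)]] poly_fun_cmult[OF u[OF j0]], of k "c j" "c' j"]
          by (simp add: pd_cmult[OF u[OF i0(1)]] pd_cmult[OF u[OF j0]])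
      qed
      then have "A x * pd k ?a x + B x * pd k ?b x = (\<Sum>j<4. pd k (u j) x * pd j h x)"
        unfolding A_def B_def sum_distrib_right sum.distrib[symmetric]
        by (intro sum.cong) (auto simp: algebra_simps)
      then show ?thesis using duh by simp
    qed
    have "\<exists>k<4. \<exists>x. ?a x * pd k ?b x - ?b x * pd k ?a x \<noteq> 0"
    proof (rule ccontr)
      assume "\<not> ?thesis"
      then have "\<exists>\<alpha> \<beta>. (\<alpha> \<noteq> 0 \<or> \<beta> \<noteq> 0) \<and> (\<forall>x. \<alpha> * ?a x + \<beta> * ?b x = 0)"
        by (intro wronskian_zero_imp_dependent[of 4] u i0 j0) auto
      then show False using ind by blast
    qed
    then obtain k z where k: "?a z * pd k ?b z - ?b z * pd k ?a z \<noteq> 0" by blast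
    have "A x = 0" for x
    proof (rule poly_fun_cancel[where f = "\<lambda>x. ?a x * pd k ?b x - ?b x * pd k ?a x" and g = A, OF _ Apf _ k])
      show "poly_fun 4 (\<lambda>x. ?a x * pd k ?b x - ?b x * pd k ?a x)"
        by (intro poly_fun_diff poly_fun_mult poly_fun_pd u i0 j0)
      fix x assume nz: "?a x * pd k ?b x - ?b x * pd k ?a x \<noteq> 0"
      have "(?a x * pd k ?b x - ?b x * pd k ?a x) * A x =
        (A x * ?a x + B x * ?b x) * pd k ?b x - ?b x * (A x * pd k ?a x + B x * pd k ?b x)"
        by (simp add: algebra_simps)
      also have "\<dots> = 0" unfolding AB dAB by simp
      finally show "A x = 0" using nz by simp
    qed
    moreover have "c i0 = 1"
    proof -
      have "(c i0 - 1) * ?a x + c' i0 * ?b x = 0" for x using c[OF i0(1), of x] by (simp add: algebra_simps)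
      from ind[OF this] show ?thesis by simp
    qed
    ultimately show ?thesis using i0(1) by (intro exI[of _ c]) (auto simp: A_def)
  qed
qed

text \<open>Scaling its argument stays in the image of \<open>G\<close>, on which \<open>f\<close> vanishes.\<close>

lemma relation_component_zero:
  assumes F: "\<And>j. homog_fun j (F j)" and f: "\<And>x. f x = (\<Sum>j\<le>k. F j x)"
    and G: "\<And>x s. \<exists>x'. \<forall>i<n. G x' i = s * G x i" and fn: "poly_fun n f" and rel: "\<And>x. f (G x) = 0" and j: "j \<le> k"
  shows "F j (G x) = 0"
proof (rule homog_component_zero[OF F _ j])
  fix s
  obtain x' where x': "\<forall>i<n. G x' i = s * G x i" using G by blast
  have "f (\<lambda>i. s * G x i) = f (G x')" by (rule poly_fun_cong_coords[OF fn]) (use x' in auto)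
  then show "(\<Sum>j\<le>k. F j (\<lambda>i. s * G x i)) = 0" using rel f by simp
qed

text \<open>The minimal relation is homogeneous, because its components are relations as well and those of smaller degree vanish. So the
  polar field \<open>v = g u\<close> is homogeneous, and so are its common factor \<open>g\<close> and the coprime field \<open>u\<close>. The factor
  \<open>g\<close> is constant along the flow of \<open>v\<close>, which makes \<open>u\<close> constant on its own lines.\<close>

theorem gordan_noether_four_variables:
  assumes h: "poly_fun 4 h" "homog_fun d h" "d \<ge> 2"
    and sing: "\<And>x. \<exists>w. (\<exists>i<4. w i \<noteq> 0) \<and> (\<forall>j<4. (\<Sum>k<4. w k * pd k (pd j h) x) = 0)"
  shows "\<exists>c. (\<exists>i<4. c i \<noteq> 0) \<and> (\<forall>x. (\<Sum>i<4. c i * pd i h x) = 0)"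
proof -
  obtain k R1 where R1: "poly_fun_le 4 k R1" "\<exists>y. R1 y \<noteq> 0" "\<And>x. R1 (\<lambda>j. pd j h x) = 0"
    and min: "\<forall>T l. poly_fun_le 4 l T \<longrightarrow> l < k \<longrightarrow> (\<forall>x. T (\<lambda>j. pd j h x) = 0) \<longrightarrow> (\<forall>y. T y = 0)"
    using minimal_gradient_relation[OF h(1) sing] by blast
  obtain F where F: "\<And>j. poly_fun_le 4 j (F j)" "\<And>j. homog_fun j (F j)" "\<And>x. R1 x = (\<Sum>j\<le>k. F j x)"
    using poly_fun_le_components[OF R1(1)] by blast
  have dh: "homog_fun (d - 1) (pd j h)" for j by (rule homog_fun_pd[OF h(1,2)])
  \<comment> \<open>The image of the gradient is a cone, by scaling with a root of order \<open>d - 1\<close>.\<close>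
  have "\<exists>x'. \<forall>i<4. pd i h x' = s * pd i h x" for x s
  proof -
    obtain t where "t ^ (d - 1) = s" using complex_nth_root[of "d - 1" s] h(3) by auto
    then have "\<forall>i<4. pd i h (\<lambda>j. t * x j) = s * pd i h x" using homog_funD[OF dh] by simp
    then show ?thesis by blast
  qed
  then have Frel: "F j (\<lambda>i. pd i h x) = 0" if "j \<le> k" for j x
    using relation_component_zero[where F = F and f = R1 and k = k and n = 4 and G = "\<lambda>x i. pd i h x" and j = j and x = x]
      F R1 that by blast
  define R where "R = F k"
  have "F j x = 0" if "j < k" for j x using min[THEN spec, THEN spec, THEN mp, OF F(1)[of j]] Frel[of j] that by simp
  then have "(\<Sum>j\<le>k. F j x) = (\<Sum>j\<in>{k}. F j x)" for x
    by (intro sum.mono_neutral_right) auto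
  then have "R1 = R" by (auto simp: R_def F(3))
  then have R: "poly_fun_le 4 k R" "\<exists>y. R y \<noteq> 0" "\<And>x. R (\<lambda>j. pd j h x) = 0" "homog_fun k R"
    using R1 F(2)[of k] by (auto simp: R_def)
  have Rpf: "poly_fun 4 R" using R(1) by auto
  note polar = polar_field[OF h(1) R(1-3) min]
  define v where "v i x = pd i R (\<lambda>j. pd j h x)" for i x
  have v: "\<And>i. poly_fun 4 (v i)" "\<exists>i<4. \<exists>x. v i x \<noteq> 0"
    "\<And>l x. (\<Sum>j<4. v j x * pd j (pd l h) x) = 0"
    "\<And>i t x. i < 4 \<Longrightarrow> v i (\<lambda>j. x j + t * v j x) = v i x"
    using polar unfolding v_def by blast+
  define E where "E = (d - 1) * (k - 1)"
  have vhom: "homog_fun E (v i)" for i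
    unfolding homog_fun_def v_def
    by (simp add: homog_funD[OF dh] homog_funD[OF homog_fun_pd[OF Rpf R(4)]] E_def power_mult)
  obtain g u where gu: "poly_fun 4 g" "\<And>i. i < 4 \<Longrightarrow> poly_fun 4 (u i)" "\<And>i x. i < 4 \<Longrightarrow> v i x = g x * u i x" "fun_coprime 4 u"
    using extract_common_factor[OF v(1,2)] by blast
  obtain i0 z0 where i0: "i0 < 4" "v i0 z0 \<noteq> 0" using v(2) by blast
  then have gz: "g z0 \<noteq> 0" "u i0 z0 \<noteq> 0" using gu(3)[of i0 z0] by auto
  obtain m where m: "homog_fun m g"
    using homog_fun_factor[OF gu(1) gu(2)[OF i0(1)] v(1) vhom i0(2) gu(3)[OF i0(1)]] by blast
  have ginv: "g (\<lambda>j. x j + t * v j x) = g x" for x t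
    by (rule factor_flow_invariant[where n = 4 and v = v and P = "v i0" and q = "u i0" and y = z0])
      (use gu i0 v in auto)
  have uinv: "u i (\<lambda>j. x j + t * u j x) = u i x" if i: "i < 4" for i x t
  proof -
    have "u i (\<lambda>j. x j + t * u j x) - u i x = 0"
    proof (rule poly_fun_cancel[where f = g and g = "\<lambda>x. u i (\<lambda>j. x j + t * u j x) - u i x", OF gu(1) _ _ gz(1)])
      show "poly_fun 4 (\<lambda>x. u i (\<lambda>j. x j + t * u j x) - u i x)"
        by (intro poly_fun_diff gu(2) i poly_fun_compose[OF gu(2)[OF i]] poly_fun_add poly_fun_cmult poly_fun_var)
      fix x assume x: "g x \<noteq> 0"
      let ?y = "\<lambda>j. x j + (t / g x) * v j x"
      have "u i ?y = u i (\<lambda>j. x j + t * u j x)"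
        by (rule poly_fun_cong_coords[OF gu(2)[OF i]]) (use x gu(3) in auto)
      moreover have "g ?y * u i ?y = g x * u i x" using v(4)[OF i] gu(3)[OF i] by metis
      ultimately show "u i (\<lambda>j. x j + t * u j x) - u i x = 0" using ginv[of x "t / g x"] x by simp
    qed
    then show ?thesis by simp
  qed
  have uker: "(\<Sum>j<4. u j x * pd j (pd l h) x) = 0" for l x
  proof (rule poly_fun_cancel[where f = g and g = "\<lambda>x. \<Sum>j<4. u j x * pd j (pd l h) x", OF gu(1) _ _ gz(1)])
    show "poly_fun 4 (\<lambda>x. \<Sum>j<4. u j x * pd j (pd l h) x)"
      using gu(2) h(1) by (intro poly_fun_sum poly_fun_mult poly_fun_pd) auto
    fix x assume "g x \<noteq> 0"
    moreover have "g x * (\<Sum>j<4. u j x * pd j (pd l h) x) = (\<Sum>j<4. v j x * pd j (pd l h) x)"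
      unfolding sum_distrib_left by (rule sum.cong) (auto simp: gu(3))
    ultimately show "(\<Sum>j<4. u j x * pd j (pd l h) x) = 0" using v(3) by simp
  qed
  have "m \<le> E"
  proof -
    obtain q where q: "\<And>t. u i0 (\<lambda>i. t * z0 i) = poly q t" using poly_fun_restrict_ray[OF gu(2)[OF i0(1)]] by blast
    have "monom (g z0) m * q = monom (v i0 z0) E"
    proof (rule complex_poly_ext)
      fix t
      have "t ^ E * v i0 z0 = v i0 (\<lambda>i. t * z0 i)" using homog_funD[OF vhom] by simp
      also have "\<dots> = t ^ m * g z0 * poly q t" by (simp add: gu(3)[OF i0(1)] q homog_funD[OF m])
      finally show "poly (monom (g z0) m * q) t = poly (monom (v i0 z0) E) t"
        by (simp add: poly_monom mult_ac)
    qed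
    then have "coeff (monom (g z0) m * q) E \<noteq> 0" using i0(2) by simp
    then show ?thesis by (auto simp: coeff_monom_mult split: if_splits)
  qed
  define e where "e = E - m"
  have uhom: "homog_fun e (u i)" if i: "i < 4" for i
  proof (rule homog_funI[OF gu(2)[OF i]])
    fix t :: complex and x assume t: "t \<noteq> 0"
    have "u i (\<lambda>i. t * x i) - t ^ e * u i x = 0"
    proof (rule poly_fun_cancel[where f = g and g = "\<lambda>x. u i (\<lambda>i. t * x i) - t ^ e * u i x", OF gu(1) _ _ gz(1)])
      show "poly_fun 4 (\<lambda>x. u i (\<lambda>i. t * x i) - t ^ e * u i x)"
        by (intro poly_fun_diff gu(2) i poly_fun_compose[OF gu(2)[OF i]] poly_fun_cmult poly_fun_var)
      fix x assume x: "g x \<noteq> 0"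
      have "t ^ m * g x * u i (\<lambda>i. t * x i) = t ^ E * (g x * u i x)"
        using homog_funD[OF vhom, of i t x] by (simp add: gu(3)[OF i] homog_funD[OF m])
      also have "t ^ E = t ^ m * t ^ e" using \<open>m \<le> E\<close> by (simp add: e_def power_add[symmetric])
      finally show "u i (\<lambda>i. t * x i) - t ^ e * u i x = 0" using x t by simp
    qed
    then show "u i (\<lambda>i. t * x i) = t ^ e * u i x" by simp
  qed
  show ?thesis
  proof (cases "e = 0")
    case False
    have "straight_homogeneous_field u e"
      by unfold_locales (use gu uhom uinv False i0(1) gz(2) in auto)
    from straight_kernel_field_imp_constant_kernel[OF h this uker] show ?thesis .
  next
    case True
    have "u i x = u i (\<lambda>_. 0) * 1" if "i < 4" for i x
      using homog_funD[OF uhom[OF that], of 0 x] True by simp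
    from proportional_kernel[where n = 4 and h = h and g = "\<lambda>_. 1" and v = u and c = "\<lambda>i. u i (\<lambda>_. 0)", OF h(1) _ _ this uker]
    have "(\<Sum>j<4. u j (\<lambda>_. 0) * pd j (pd l h) x) = 0" for l x by simp
    from constant_kernel_imp_constant_derivative[OF h(1), of "\<lambda>j. u j (\<lambda>_. 0)", OF this]
    obtain c0 where c0: "\<And>x. (\<Sum>j<4. u j (\<lambda>_. 0) * pd j h x) = c0" by blast
    have "pd j h (\<lambda>_. 0) = 0" for j
    proof -
      have 0: "(0 :: complex) ^ (d - 1) = 0" using h(3) by (simp add: zero_power)
      show ?thesis using homog_funD[OF dh[of j], of 0 "\<lambda>_. 0"] unfolding 0 by simp
    qed
    then have "c0 = 0" using c0[of "\<lambda>_. 0"] by simp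
    moreover have "u i0 (\<lambda>_. 0) \<noteq> 0"
      using homog_funD[OF uhom[OF i0(1)], of 0 z0] True gz(2) by simp
    ultimately show ?thesis using c0 i0(1) by (intro exI[of _ "\<lambda>j. u j (\<lambda>_. 0)"]) auto
  qed
qed

section \<open>Evaluation of formal polynomials\<close>

abbreviation "keys \<equiv> Poly_Mapping.keys"
abbreviation "lookup \<equiv> Poly_Mapping.lookup"
abbreviation "single \<equiv> Poly_Mapping.single"

definition eval_monom :: "(nat \<Rightarrow>\<^sub>0 nat) \<Rightarrow> point \<Rightarrow> complex" where
  "eval_monom m x = (\<Prod>i\<in>keys m. x i ^ lookup m i)"

definition eval_mpoly :: "complex mpoly \<Rightarrow> point \<Rightarrow> complex" where
  "eval_mpoly p x = (\<Sum>m\<in>keys p. lookup p m * eval_monom m x)"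

lemma eval_monom_superset:
  assumes "finite S" "keys m \<subseteq> S"
  shows "eval_monom m x = (\<Prod>i\<in>S. x i ^ lookup m i)"
  unfolding eval_monom_def
  by (rule prod.mono_neutral_left) (use assms in \<open>auto simp: in_keys_iff\<close>)

lemma eval_mpoly_superset:
  assumes "finite S" "keys p \<subseteq> S"
  shows "eval_mpoly p x = (\<Sum>m\<in>S. lookup p m * eval_monom m x)"
  unfolding eval_mpoly_def
  by (rule sum.mono_neutral_left) (use assms in \<open>auto simp: in_keys_iff\<close>)

lemma eval_monom_add: "eval_monom (m + m') x = eval_monom m x * eval_monom m' x"
proof -
  let ?S = "keys m \<union> keys m'"
  have "keys (m + m') \<subseteq> ?S" by (rule Poly_Mapping.keys_add)
  then show ?thesis
    using eval_monom_superset[of ?S] by (simp add: lookup_add power_add prod.distrib)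
qed

lemma eval_monom_0 [simp]: "eval_monom 0 x = 1"
  by (simp add: eval_monom_def)

lemma eval_mpoly_0 [simp]: "eval_mpoly 0 x = 0"
  by (simp add: eval_mpoly_def)

lemma eval_mpoly_single [simp]: "eval_mpoly (single m c) x = c * eval_monom m x"
  by (cases "c = 0") (simp_all add: eval_mpoly_def)

lemma eval_mpoly_add: "eval_mpoly (p + q) x = eval_mpoly p x + eval_mpoly q x"
proof -
  let ?S = "keys p \<union> keys q"
  have "keys (p + q) \<subseteq> ?S" by (rule Poly_Mapping.keys_add)
  then show ?thesis
    using eval_mpoly_superset[of ?S] by (simp add: lookup_add distrib_right sum.distrib)
qed

lemma eval_mpoly_sum: "eval_mpoly (\<Sum>a\<in>A. f a) x = (\<Sum>a\<in>A. eval_mpoly (f a) x)"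
  by (induction A rule: infinite_finite_induct) (auto simp: eval_mpoly_add)

lemma mpoly_sum_monomials:
  "(\<Sum>m\<in>keys p. single m (lookup p m)) = p"
proof (rule poly_mapping_eqI)
  fix m
  have "lookup (\<Sum>m\<in>keys p. single m (lookup p m)) m =
      (\<Sum>m'\<in>keys p. if m' = m then lookup p m' else 0)"
    by (simp add: lookup_sum lookup_single when_def)
  also have "\<dots> = lookup p m" by (simp add: in_keys_iff)
  finally show "lookup (\<Sum>m\<in>keys p. single m (lookup p m)) m =
      lookup p m" .
qed

lemma eval_mpoly_mult: "eval_mpoly (p * q) x = eval_mpoly p x * eval_mpoly q x"
proof -
  let ?s = "\<lambda>p m. single m (lookup p m) :: complex mpoly"
  have "p * q = (\<Sum>m\<in>keys p. ?s p m) * (\<Sum>m\<in>keys q. ?s q m)"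
    by (simp only: mpoly_sum_monomials)
  also have "\<dots> = (\<Sum>m\<in>keys p. \<Sum>m'\<in>keys q.
      single (m + m') (lookup p m * lookup q m'))"
    by (simp add: sum_product mult_single)
  finally show ?thesis
    by (simp add: eval_mpoly_sum eval_monom_add eval_mpoly_def[of p] eval_mpoly_def[of q] sum_product mult_ac)
qed

lemma eval_mpoly_1 [simp]: "eval_mpoly 1 x = 1"
  by (simp add: single_one[symmetric] del: single_one)

lemma eval_mpoly_uminus: "eval_mpoly (- p) x = - eval_mpoly p x"
  using eval_mpoly_add[of p "- p" x] by (simp add: eq_neg_iff_add_eq_0 add.commute)

lemma eval_mpoly_diff: "eval_mpoly (p - q) x = eval_mpoly p x - eval_mpoly q x"
  using eval_mpoly_add[of p "- q" x] by (simp add: eval_mpoly_uminus)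

lemma eval_mpoly_Const [simp]: "eval_mpoly (Const c) x = c"
  by (simp add: Const_def)

lemma poly_fun_eval_monom: "keys m \<subseteq> {..<n} \<Longrightarrow> poly_fun n (eval_monom m)"
  unfolding eval_monom_def[abs_def] by (intro poly_fun_prod poly_fun_power poly_fun_var) auto

lemma poly_fun_eval_mpoly: "p \<in> mpolys n \<Longrightarrow> poly_fun n (eval_mpoly p)"
  unfolding eval_mpoly_def[abs_def] mpolys_def
  by (intro poly_fun_sum poly_fun_cmult poly_fun_eval_monom) auto

lemma mpolys_exhaust: "\<exists>n. p \<in> mpolys n"
proof -
  let ?S = "\<Union>m\<in>keys p. keys m"
  have "finite ?S" by simp
  then obtain n where "?S \<subseteq> {..<n}" using finite_nat_iff_bounded by blast
  then show ?thesis unfolding mpolys_def by blast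
qed

lemma pd_eval_monom:
  "pd i (eval_monom m) x = of_nat (lookup m i) * eval_monom (m - single i 1) x"
proof (rule pd_eqI)
  let ?S = "insert i (keys m)"
  let ?c = "\<Prod>j\<in>?S - {i}. x j ^ lookup m j"
  have "eval_monom m (x(i := t)) = t ^ lookup m i * ?c" for t
  proof -
    have "eval_monom m (x(i := t)) = (\<Prod>j\<in>?S. (x(i := t)) j ^ lookup m j)"
      by (rule eval_monom_superset) auto
    also have "\<dots> = t ^ lookup m i * (\<Prod>j\<in>?S - {i}. (x(i := t)) j ^ lookup m j)"
      by (subst prod.remove[of _ i]) auto
    also have "(\<Prod>j\<in>?S - {i}. (x(i := t)) j ^ lookup m j) = ?c"
      by (rule prod.cong) auto
    finally show ?thesis .
  qed
  moreover have "eval_monom (m - single i 1) x = x i ^ (lookup m i - 1) * ?c"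
  proof -
    have "keys (m - single i 1) \<subseteq> ?S"
      by (auto simp: in_keys_iff lookup_minus)
    then have "eval_monom (m - single i 1) x =
        (\<Prod>j\<in>?S. x j ^ lookup (m - single i 1) j)"
      by (intro eval_monom_superset) auto
    also have "\<dots> = x i ^ (lookup m i - 1) *
        (\<Prod>j\<in>?S - {i}. x j ^ lookup (m - single i 1) j)"
      by (subst prod.remove[of _ i]) (auto simp: lookup_minus)
    also have "(\<Prod>j\<in>?S - {i}. x j ^ lookup (m - single i 1) j) = ?c"
      by (rule prod.cong) (auto simp: lookup_minus lookup_single)
    finally show ?thesis .
  qed
  ultimately show "((\<lambda>t. eval_monom m (x(i := t))) has_field_derivative
      of_nat (lookup m i) * eval_monom (m - single i 1) x) (at (x i))"
    by (auto intro!: derivative_eq_intros)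
qed

lemma eval_mpoly_partial: "eval_mpoly (partial i p) = pd i (eval_mpoly p)"
proof
  fix x
  obtain n where "p \<in> mpolys n" using mpolys_exhaust by blast
  then have pf: "poly_fun n (eval_monom m)" if "m \<in> keys p" for m
    using that by (intro poly_fun_eval_monom) (auto simp: mpolys_def)
  have "pd i (eval_mpoly p) x = (\<Sum>m\<in>keys p. pd i (\<lambda>x. lookup p m * eval_monom m x) x)"
    unfolding eval_mpoly_def[abs_def] by (subst pd_sum[of _ n]) (auto intro: poly_fun_cmult pf)
  also have "\<dots> = (\<Sum>m\<in>keys p. of_nat (lookup m i) * lookup p m *
      eval_monom (m - single i 1) x)"
    by (rule sum.cong) (auto simp: pd_cmult[OF pf] pd_eval_monom)
  finally show "eval_mpoly (partial i p) x = pd i (eval_mpoly p) x"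
    by (simp add: partial_def eval_mpoly_sum)
qed

text \<open>Only the monomial \<open>m x\<^sub>i\<close> contributes: the truncated subtraction of exponents in the definition is injective on the
  monomials that have a non-zero factor.\<close>

lemma lookup_partial:
  "lookup (partial i p) m =
    of_nat (lookup m i + 1) * lookup p (m + single i 1)"
  for p :: "'a::comm_semiring_1 mpoly"
proof -
  let ?e = "single i 1 :: nat \<Rightarrow>\<^sub>0 nat"
  let ?c = "\<lambda>m'. of_nat (lookup m' i) * lookup p m'"
  have eq: "(?c m' when m' - ?e = m) = (?c m' when m' = m + ?e)" for m'
  proof (cases "lookup m' i = 0")
    case False
    have "m' - ?e = m \<longleftrightarrow> m' = m + ?e"
    proof
      assume "m' - ?e = m"
      then have "lookup m' j = lookup (m + ?e) j" for j
        using False by (auto simp: lookup_add lookup_minus lookup_single when_def)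
      then show "m' = m + ?e" by (rule poly_mapping_eqI)
    qed simp
    then show ?thesis by simp
  qed (simp add: when_def)
  have "lookup (partial i p) m = (\<Sum>m'\<in>keys p. ?c m' when m' - ?e = m)"
    by (simp add: partial_def lookup_sum lookup_single)
  also have "\<dots> = (\<Sum>m'\<in>keys p. if m' = m + ?e then ?c m' else 0)"
    unfolding eq by (simp add: when_def)
  also have "\<dots> = ?c (m + ?e)" by (simp add: sum.delta in_keys_iff)
  finally show ?thesis by (simp add: lookup_add lookup_single)
qed

lemma monom_degree_add_single: "monom_degree (m + single i 1) = Suc (monom_degree m)"
proof -
  let ?e = "single i 1 :: nat \<Rightarrow>\<^sub>0 nat"
  let ?S = "insert i (keys m)"
  have sup: "monom_degree k = (\<Sum>j\<in>?S. lookup k j)" if "keys k \<subseteq> ?S" for k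
    unfolding monom_degree_def by (rule sum.mono_neutral_left) (use that in \<open>auto simp: in_keys_iff\<close>)
  have "keys (m + ?e) \<subseteq> ?S" using Poly_Mapping.keys_add[of m ?e] by auto
  then have "monom_degree (m + ?e) = (\<Sum>j\<in>?S. lookup m j) + (\<Sum>j\<in>?S. lookup ?e j)"
    by (simp only: sup lookup_add sum.distrib)
  also have "(\<Sum>j\<in>?S. lookup ?e j) = (\<Sum>j\<in>?S. if j = i then 1 else 0)"
    by (rule sum.cong) (auto simp: lookup_single when_def)
  also have "\<dots> = 1" by (simp only: sum.delta finite_insert finite_keys) simp
  moreover have "monom_degree m = (\<Sum>j\<in>?S. lookup m j)" by (rule sup) auto
  ultimately show ?thesis by simp
qed

lemma nonzero_monom_obtain:
  fixes m :: "nat \<Rightarrow>\<^sub>0 nat"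
  assumes "m \<noteq> 0"
  obtains i m' where "m = m' + single i 1"
proof -
  obtain i where i: "i \<in> keys m" using assms by fastforce
  have "m = (m - single i 1) + single i 1"
    by (rule poly_mapping_eqI) (use i in \<open>auto simp: lookup_add lookup_minus lookup_single in_keys_iff when_def\<close>)
  then show ?thesis using that by blast
qed

text \<open>If the function of \<open>p\<close> vanishes, then so do those of its partial derivatives, which by induction on the degree are
  zero. Hence \<open>p\<close> is constant.\<close>

lemma eval_mpoly_eq_0:
  assumes "\<And>x. eval_mpoly p x = 0"
  shows "p = 0"
proof -
  have "p = 0" if "\<forall>m\<in>keys p. monom_degree m < D" "\<forall>x. eval_mpoly p x = 0" for D and p :: "complex mpoly"
    using that
  proof (induction D arbitrary: p)
    case 0
    then have "keys p = {}" by auto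
    then show ?case by simp
  next
    case (Suc D)
    have "partial i p = 0" for i
    proof (rule Suc.IH)
      show "\<forall>m\<in>keys (partial i p). monom_degree m < D"
      proof
        fix m assume "m \<in> keys (partial i p)"
        then have "m + single i 1 \<in> keys p"
          by (auto simp: in_keys_iff lookup_partial)
        then show "monom_degree m < D" using Suc.prems(1) monom_degree_add_single by fastforce
      qed
      have "eval_mpoly p = (\<lambda>_. 0)" using Suc.prems(2) by auto
      then show "\<forall>x. eval_mpoly (partial i p) x = 0" by (simp add: eval_mpoly_partial)
    qed
    then have "lookup p (m + single i 1) = 0" for m i
      using lookup_partial[of i p m] by (simp del: of_nat_add of_nat_Suc)
    then have "lookup p m = 0" if "m \<noteq> 0" for m
      using that by (metis nonzero_monom_obtain)
    then have keys: "keys p \<subseteq> {0}" by (auto simp: in_keys_iff)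
    then have "eval_mpoly p x = lookup p 0" for x
      by (subst eval_mpoly_superset[OF _ keys]) auto
    then have "lookup p 0 = 0" using Suc.prems(2) by simp
    then have "lookup p m = lookup 0 m" for m
      using keys by (cases "m = 0") (auto simp: in_keys_iff)
    then show ?case by (rule poly_mapping_eqI)
  qed
  moreover have "\<forall>m\<in>keys p. monom_degree m < Suc (Max (monom_degree ` keys p))"
    by (simp add: less_Suc_eq_le)
  ultimately show ?thesis using assms by blast
qed

lemma eval_mpoly_inject: "(\<And>x. eval_mpoly p x = eval_mpoly q x) \<Longrightarrow> p = q"
  using eval_mpoly_eq_0[of "p - q"] by (simp add: eval_mpoly_diff)

lemma homog_fun_eval_mpoly:
  assumes "homogeneous_of_degree d p" shows "homog_fun d (eval_mpoly p)"
  unfolding homog_fun_def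
proof (intro allI)
  fix t x
  have "eval_monom m (\<lambda>i. t * x i) = t ^ monom_degree m * eval_monom m x" for m
    by (simp add: eval_monom_def monom_degree_def power_mult_distrib prod.distrib power_sum)
  then show "eval_mpoly p (\<lambda>i. t * x i) = t ^ d * eval_mpoly p x"
    using assms by (simp add: eval_mpoly_def homogeneous_of_degree_def sum_distrib_left mult_ac)
qed

lemma eval_mpoly_zero_point: "eval_mpoly p (\<lambda>_. 0) = lookup p 0"
proof -
  have "eval_monom m (\<lambda>_. 0) = (if m = 0 then 1 else 0)" for m
  proof (cases "m = 0")
    case False
    then obtain i where i: "i \<in> keys m" by fastforce
    then have "(0 :: complex) ^ lookup m i = 0" by (simp add: in_keys_iff)
    then show ?thesis using i False by (auto simp: eval_monom_def intro!: prod_zero bexI[of _ i])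
  qed simp
  then show ?thesis by (simp add: eval_mpoly_def if_distrib[of "\<lambda>z. _ * z"] in_keys_iff cong: if_cong)
qed

section \<open>Adding variables\<close>

text \<open>Evaluation at \<open>x\<close> is a ring homomorphism, so it commutes with the determinant.\<close>

lemma hessian_pointwise_singular:
  assumes h: "h \<in> mpolys n" and d: "det (hessian n h) = 0"
  shows "\<exists>w. (\<exists>i<n. w i \<noteq> 0) \<and> (\<forall>j<n. (\<Sum>k<n. w k * pd k (pd j (eval_mpoly h)) x) = 0)"
proof -
  interpret ev: comm_ring_hom "\<lambda>p. eval_mpoly p x"
    by unfold_locales (simp_all add: eval_mpoly_add eval_mpoly_mult)
  let ?M = "map_mat (\<lambda>p. eval_mpoly p x) (hessian n h)"
  have M: "?M \<in> carrier_mat n n" by (simp add: hessian_def)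
  have "det ?M = eval_mpoly (det (hessian n h)) x" by (rule ev.hom_det)
  then have "det ?M = 0" using d by simp
  then obtain w where w: "w \<in> carrier_vec n" "w \<noteq> 0\<^sub>v n" "?M *\<^sub>v w = 0\<^sub>v n"
    using det_0_iff_vec_prod_zero_field[OF M] by blast
  have "\<exists>i<n. w $ i \<noteq> 0" using w(1,2) by (metis carrier_vecD eq_vecI index_zero_vec)
  moreover have "(\<Sum>k<n. w $ k * pd k (pd j (eval_mpoly h)) x) = 0" if j: "j < n" for j
  proof -
    have "0 = (?M *\<^sub>v w) $ j" using w(3) j by simp
    also have "\<dots> = (\<Sum>k<n. pd j (pd k (eval_mpoly h)) x * w $ k)"
      using j w(1) by (simp add: hessian_def scalar_prod_def eval_mpoly_partial atLeast0LessThan)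
    finally show ?thesis
      by (simp add: pd_commute[OF poly_fun_eval_mpoly[OF h], of _ j] mult.commute)
  qed
  ultimately show ?thesis by blast
qed

text \<open>Adding a power of each new variable makes the Hessian block diagonal and keeps it singular, while the new variables
  themselves do not create constant vectors in its kernel.\<close>

definition add_powers :: "nat \<Rightarrow> nat \<Rightarrow> nat \<Rightarrow> (point \<Rightarrow> complex) \<Rightarrow> point \<Rightarrow> complex" where
  "add_powers n N d f x = f x + (\<Sum>i\<in>{n..<N}. x i ^ d)"

lemma pd_power: "pd j (\<lambda>x. c * x i ^ d) x = (if i = j then c * of_nat d * x i ^ (d - 1) else 0)"
  by (rule pd_eqI) (auto intro!: derivative_eq_intros)

lemma poly_fun_add_powers: "poly_fun n f \<Longrightarrow> n \<le> N \<Longrightarrow> poly_fun N (add_powers n N d f)"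
  unfolding add_powers_def[abs_def]
  by (intro poly_fun_add poly_fun_sum poly_fun_power poly_fun_var) (auto intro: poly_fun_mono_vars)

lemma pd_add_powers:
  assumes f: "poly_fun n f" and N: "n \<le> N"
  shows "pd j (add_powers n N d f) =
    (\<lambda>x. pd j f x + (if n \<le> j \<and> j < N then of_nat d * x j ^ (d - 1) else 0))"
proof
  fix x
  have pp: "poly_fun N (\<lambda>x. x i ^ d)" if "i \<in> {n..<N}" for i using that by auto
  have "pd j (add_powers n N d f) x = pd j f x + pd j (\<lambda>x. \<Sum>i\<in>{n..<N}. x i ^ d) x"
    unfolding add_powers_def[abs_def]
    using pd_add[OF poly_fun_mono_vars[OF f N] poly_fun_sum[of "{n..<N}" N "\<lambda>i x. x i ^ d", OF pp], of j] by simp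
  also have "pd j (\<lambda>x. \<Sum>i\<in>{n..<N}. x i ^ d) x = (\<Sum>i\<in>{n..<N}. pd j (\<lambda>x. x i ^ d) x)"
    by (subst pd_sum[of _ N, OF pp]) auto
  also have "\<dots> = (\<Sum>i\<in>{n..<N}. if i = j then of_nat d * x i ^ (d - 1) else 0)"
    using pd_power[of j 1 _ d x] by simp
  also have "\<dots> = (if n \<le> j \<and> j < N then of_nat d * x j ^ (d - 1) else 0)"
    by simp
  finally show "pd j (add_powers n N d f) x = pd j f x + (if n \<le> j \<and> j < N then of_nat d * x j ^ (d - 1) else 0)" .
qed

text \<open>A kernel vector of the smaller Hessian is extended by zeros.\<close>

lemma add_powers_singular:
  assumes f: "poly_fun n f" and N: "n \<le> N"
    and sing: "\<exists>w. (\<exists>i<n. w i \<noteq> 0) \<and> (\<forall>j<n. (\<Sum>k<n. w k * pd k (pd j f) x) = 0)"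
  shows "\<exists>w. (\<exists>i<N. w i \<noteq> 0) \<and> (\<forall>j<N. (\<Sum>k<N. w k * pd k (pd j (add_powers n N d f)) x) = 0)"
proof -
  obtain w where w: "\<exists>i<n. w i \<noteq> 0" "\<forall>j<n. (\<Sum>k<n. w k * pd k (pd j f) x) = 0" using sing by blast
  define w' where "w' k = (if k < n then w k else 0)" for k
  have "(\<Sum>k<N. w' k * pd k (pd j (add_powers n N d f)) x) = 0" if j: "j < N" for j
  proof -
    have "(\<Sum>k<N. w' k * pd k (pd j (add_powers n N d f)) x) = (\<Sum>k<n. w' k * pd k (pd j (add_powers n N d f)) x)"
      by (rule sum.mono_neutral_right) (use N in \<open>auto simp: w'_def\<close>)
    also have "\<dots> = (\<Sum>k<n. w k * pd k (pd j f) x)"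
    proof (rule sum.cong)
      fix k assume k: "k \<in> {..<n}"
      have q: "poly_fun N (\<lambda>x. if n \<le> j \<and> j < N then of_nat d * x j ^ (d - 1) else 0)"
        using j by (intro poly_fun_if poly_fun_cmult poly_fun_power poly_fun_var) auto
      have "pd k (pd j (add_powers n N d f)) x =
        pd k (pd j f) x + pd k (\<lambda>x. if n \<le> j \<and> j < N then of_nat d * x j ^ (d - 1) else 0) x"
        unfolding pd_add_powers[OF f N]
        by (subst pd_add[OF poly_fun_mono_vars[OF poly_fun_pd[OF f] N] q]) simp
      also have "pd k (\<lambda>x. if n \<le> j \<and> j < N then of_nat d * x j ^ (d - 1) else 0) x = 0"
        using k j pd_power[of k "of_nat d" j "d - 1" x] by (cases "n \<le> j") auto
      finally show "w' k * pd k (pd j (add_powers n N d f)) x = w k * pd k (pd j f) x"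
        using k by (simp add: w'_def)
    qed simp
    also have "\<dots> = 0"
    proof (cases "j < n")
      case False
      then have "pd j f = (\<lambda>_. 0)" using pd_other_variable[OF f, of j] by auto
      then show ?thesis by simp
    qed (use w(2) in blast)
    finally show ?thesis .
  qed
  moreover have "\<exists>i<N. w' i \<noteq> 0" using w(1) N by (auto simp: w'_def)
  ultimately show ?thesis by blast
qed

lemma mpoly_relation:
  assumes "\<And>x. (\<Sum>i<n. c i * pd i (eval_mpoly h) x) = c0"
  shows "(\<Sum>i<n. Const (vec n c $ i) * partial i h) = Const c0"
  by (rule eval_mpoly_inject) (use assms in \<open>simp add: eval_mpoly_sum eval_mpoly_mult eval_mpoly_partial\<close>)

lemma vec_nonzero: "\<exists>i<n. c i \<noteq> 0 \<Longrightarrow> vec n c \<noteq> 0\<^sub>v n"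
  by (metis index_vec index_zero_vec(1))

text \<open>In degree at most one the gradient is constant, and with two or more variables some non-zero vector is orthogonal to it.
  Otherwise the missing variables are added; evaluating the resulting relation at the unit vectors of the new
  coordinates shows that it does not involve their derivatives.\<close>

lemma singular_hessian_homogeneous:
  assumes n: "2 \<le> n" "n \<le> 4" and h: "h \<in> mpolys n" and d: "det (hessian n h) = 0"
    and hom: "homogeneous_of_degree d h"
  shows "\<exists>c. (\<exists>i<n. c i \<noteq> 0) \<and> (\<forall>x. (\<Sum>i<n. c i * pd i (eval_mpoly h) x) = 0)"
proof -
  define f where "f = eval_mpoly h"
  have f: "poly_fun n f" unfolding f_def by (rule poly_fun_eval_mpoly[OF h])
  have fhom: "homog_fun d f" unfolding f_def by (rule homog_fun_eval_mpoly[OF hom])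
  have dhom: "homog_fun (d - 1) (pd i f)" for i by (rule homog_fun_pd[OF f fhom])
  show ?thesis
  proof (cases "d \<le> 1")
    case True
    define b where "b i = pd i f (\<lambda>_. 0)" for i
    have b: "pd i f x = b i" for i x
      using homog_funD[OF dhom[of i], of 0 x] True by (simp add: b_def)
    define c where "c i = (if b 0 = 0 \<and> b 1 = 0 then (if i = 0 then 1 else 0)
       else if i = 0 then b 1 else if i = 1 then - b 0 else 0)" for i :: nat
    have "(\<Sum>i<n. c i * pd i f x) = (\<Sum>i<2. c i * b i)" for x
      unfolding b by (rule sum.mono_neutral_right) (use n in \<open>auto simp: c_def\<close>)
    also have "\<dots> = 0" by (simp add: c_def numeral_2_eq_2)
    finally have "\<forall>x. (\<Sum>i<n. c i * pd i f x) = 0" by blast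
    moreover have "c 0 \<noteq> 0 \<or> c 1 \<noteq> 0" by (auto simp: c_def)
    then have "\<exists>i<n. c i \<noteq> 0" using n by (metis One_nat_def Suc_1 Suc_le_lessD less_le_trans zero_less_Suc zero_less_one)
    ultimately show ?thesis unfolding f_def by blast
  next
    case False
    then have d2: "d \<ge> 2" by simp
    let ?g = "add_powers n 4 d f"
    have g: "poly_fun 4 ?g" by (rule poly_fun_add_powers[OF f n(2)])
    have ghom: "homog_fun d ?g"
      unfolding homog_fun_def add_powers_def
      by (simp add: homog_funD[OF fhom] distrib_left sum_distrib_left power_mult_distrib)
    have "\<exists>w. (\<exists>i<4. w i \<noteq> 0) \<and> (\<forall>j<4. (\<Sum>k<4. w k * pd k (pd j ?g) x) = 0)" for x
      by (rule add_powers_singular[OF f n(2)]) (use hessian_pointwise_singular[OF h d] in \<open>simp add: f_def\<close>)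
    from gordan_noether_four_variables[OF g ghom d2 this]
    obtain c where c: "\<exists>i<4. c i \<noteq> 0" "\<And>x. (\<Sum>i<4. c i * pd i ?g x) = 0" by blast
    have pz: "(0 :: complex) ^ (d - 1) = 0" using d2 by (simp add: zero_power)
    have c0: "c i = 0" if i: "n \<le> i" "i < 4" for i
    proof -
      define e where "e = (\<lambda>_::nat. 0::complex)(i := 1)"
      have "pd j ?g e = (if j = i then of_nat d else 0)" if j: "j < 4" for j
      proof -
        have "pd j f e = pd j f (\<lambda>_. 0)"
          by (rule poly_fun_cong_coords[OF poly_fun_pd[OF f]]) (use i in \<open>auto simp: e_def\<close>)
        also have "\<dots> = 0" using homog_funD[OF dhom[of j], of 0 "\<lambda>_. 0"] unfolding pz by simp
        finally show ?thesis
          unfolding pd_add_powers[OF f n(2)] using i j pz by (auto simp: e_def)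
      qed
      then have "(\<Sum>j<4. c j * pd j ?g e) = (\<Sum>j<4. if j = i then c j * of_nat d else 0)"
        by (intro sum.cong) auto
      then have "c i * of_nat d = 0" using c(2)[of e] i by simp
      then show ?thesis using d2 by simp
    qed
    have "(\<Sum>i<n. c i * pd i f x) = 0" for x
    proof -
      have "(\<Sum>i<4. c i * pd i ?g x) = (\<Sum>i<n. c i * pd i ?g x)"
        by (rule sum.mono_neutral_right) (use n c0 in auto)
      also have "\<dots> = (\<Sum>i<n. c i * pd i f x)"
        unfolding pd_add_powers[OF f n(2)] by (rule sum.cong) auto
      finally show ?thesis using c(2) by simp
    qed
    moreover have "\<exists>i<n. c i \<noteq> 0" using c(1) c0 by (meson not_le)
    ultimately show ?thesis unfolding f_def by blast
  qed
qed

lemma singular_hessian_at_most_two_variables: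
  assumes n: "1 \<le> n" "n \<le> 2" and h: "h \<in> mpolys n" and d: "det (hessian n h) = 0"
  shows "\<exists>c c0. (\<exists>i<n. c i \<noteq> 0) \<and> (\<forall>x. (\<Sum>i<n. c i * pd i (eval_mpoly h) x) = c0)"
proof -
  define f where "f = eval_mpoly h"
  have f: "poly_fun n f" unfolding f_def by (rule poly_fun_eval_mpoly[OF h])
  let ?g = "add_powers n 2 2 f"
  have g: "poly_fun 2 ?g" by (rule poly_fun_add_powers[OF f n(2)])
  have "\<exists>w. (\<exists>i<2. w i \<noteq> 0) \<and> (\<forall>j<2. (\<Sum>k<2. w k * pd k (pd j ?g) x) = 0)" for x
    by (rule add_powers_singular[OF f n(2)]) (use hessian_pointwise_singular[OF h d] in \<open>simp add: f_def\<close>)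
  from singular_hessian_two_variables[OF g this]
  obtain c c0 where c: "\<exists>i<2. c i \<noteq> 0" "\<And>x. (\<Sum>i<2. c i * pd i ?g x) = c0" by blast
  show ?thesis
  proof (cases "n = 2")
    case True
    have "pd i ?g = pd i f" if "i < 2" for i
      unfolding pd_add_powers[OF f n(2)] using that True by simp
    then have "\<forall>x. (\<Sum>i<2. c i * pd i f x) = c0" using c(2) by simp
    then show ?thesis using c(1) True unfolding f_def by blast
  next
    case False
    then have n1: "n = 1" using n by simp
    have "pd 1 f x = 0" for x by (rule pd_other_variable[OF f]) (simp add: n1)
    then have g0: "pd 0 ?g x = pd 0 f x" and g1: "pd 1 ?g x = 2 * x 1" for x
      unfolding pd_add_powers[OF f n(2)] by (simp_all add: n1)
    have *: "c 0 * pd 0 f x + c 1 * (2 * x 1) = c0" for x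
    proof -
      have "(\<Sum>i<2. c i * pd i ?g x) = c 0 * pd 0 ?g x + c 1 * pd 1 ?g x"
        by (simp add: numeral_2_eq_2)
      then show ?thesis using c(2)[of x] by (simp only: g0 g1)
    qed
    have "pd 0 f (\<lambda>_. 0) = pd 0 f ((\<lambda>_. 0)(1 := 1))"
      by (rule poly_fun_cong_coords[OF poly_fun_pd[OF f]]) (simp add: n1)
    then have "c 1 = 0" using *[of "\<lambda>_. 0"] *[of "(\<lambda>_. 0)(1 := 1)"] by simp
    moreover have "c 0 \<noteq> 0"
    proof
      assume "c 0 = 0"
      then show False using c(1) \<open>c 1 = 0\<close> by (auto simp: less_2_cases_iff)
    qed
    ultimately show ?thesis
      using * n1 unfolding f_def by (intro exI[of _ c] exI[of _ c0]) simp
  qed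
qed

section \<open>Polynomials with singular Hessian\<close>

theorem theorem3p1:
  fixes n :: nat and h :: "complex mpoly"
  assumes "n \<ge> 1"
    and "h \<in> mpolys n"
    and "det (hessian n h) = 0"
  shows "(2 \<le> n \<and> n \<le> 4 \<and> homogeneous h \<longrightarrow>
      (\<exists>c \<in> carrier_vec n. c \<noteq> 0\<^sub>v n \<and>
        (\<Sum>i<n. Const (c $ i) * partial i h) = 0)) \<and>
    (n \<le> 2 \<longrightarrow>
      (\<exists>c \<in> carrier_vec n. \<exists>c\<^sub>0. c \<noteq> 0\<^sub>v n \<and>
        (\<Sum>i<n. Const (c $ i) * partial i h) = Const c\<^sub>0) \<and>
      ((\<forall>m \<in> Poly_Mapping.keys h. monom_degree m \<noteq> 1) \<longrightarrow>
        (\<exists>c \<in> carrier_vec n. c \<noteq> 0\<^sub>v n \<and>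
          (\<Sum>i<n. Const (c $ i) * partial i h) = 0)))"
proof (intro conjI impI)
  have Const_0: "Const 0 = (0 :: complex mpoly)" by (simp add: Const_def)
  {
    assume *: "2 \<le> n \<and> n \<le> 4 \<and> homogeneous h"
    then obtain d where "homogeneous_of_degree d h" by (auto simp: homogeneous_def)
    then obtain c where c: "\<exists>i<n. c i \<noteq> 0" "\<And>x. (\<Sum>i<n. c i * pd i (eval_mpoly h) x) = 0"
      using singular_hessian_homogeneous assms(2,3) * by blast
    show "\<exists>c \<in> carrier_vec n. c \<noteq> 0\<^sub>v n \<and> (\<Sum>i<n. Const (c $ i) * partial i h) = 0"
      using vec_nonzero[OF c(1)] mpoly_relation[OF c(2)]
      by (intro bexI[of _ "vec n c"]) (simp_all add: Const_0)
  }
  {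
    assume "n \<le> 2"
    then obtain c c0 where c: "\<exists>i<n. c i \<noteq> 0" "\<And>x. (\<Sum>i<n. c i * pd i (eval_mpoly h) x) = c0"
      using singular_hessian_at_most_two_variables assms by blast
    note rel = mpoly_relation[OF c(2)]
    show "\<exists>c \<in> carrier_vec n. \<exists>c\<^sub>0. c \<noteq> 0\<^sub>v n \<and> (\<Sum>i<n. Const (c $ i) * partial i h) = Const c\<^sub>0"
      using vec_nonzero[OF c(1)] rel by (intro bexI[of _ "vec n c"] exI[of _ c0]) auto
    assume no: "\<forall>m \<in> Poly_Mapping.keys h. monom_degree m \<noteq> 1"
    have "pd i (eval_mpoly h) (\<lambda>_. 0) = 0" for i
    proof -
      have "monom_degree (0 + Poly_Mapping.single i 1) = 1"
        unfolding monom_degree_add_single by (simp add: monom_degree_def)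
      then have "Poly_Mapping.lookup h (Poly_Mapping.single i 1) = 0"
        using no by (auto simp: in_keys_iff)
      then show ?thesis
        unfolding eval_mpoly_partial[symmetric] eval_mpoly_zero_point lookup_partial by simp
    qed
    then have "c0 = 0" using c(2)[of "\<lambda>_. 0"] by simp
    then show "\<exists>c \<in> carrier_vec n. c \<noteq> 0\<^sub>v n \<and> (\<Sum>i<n. Const (c $ i) * partial i h) = 0"
      using vec_nonzero[OF c(1)] rel by (intro bexI[of _ "vec n c"]) (simp_all add: Const_0)
  }
qed

end
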